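(* Let $n\ge 2$, let $G:I\times\mathbb R^n\to\mathbb R$ and let $\rho$ be a probability density on $\mathbb R^n$ with $\mathbb E N(G,\rho,I)<+\infty$. Let $t^*\in[l,u)\setminus\Psi_{G,\rho}(I)$. Suppose there exists $\bar\varepsilon\in(0,u-t^*]$ (depending on $t^*$) such that for every $\varepsilon\in(0,\bar\varepsilon)$ the following hold: (1) $G'(t,x),G''(t,x),\nabla G(t,x),\nabla G'(t,x)$ exist and are continuous on $[t^*,t^*+\varepsilon]\times L\big(H((t_1,t_2),x),[t^*,t^*+\varepsilon]^2\big)$, where $H((t_1,t_2),x)=(G(t_1,x),G'(t_2,x))$; (2) $\int_{L(G(t,x),\{t^*\})}\rho(x)\,dx=0$; (3) there is a nonnegative Lebesgue integrable function $C_{t^*,\varepsilon}$ on $[t^*,t^*+\varepsilon]^2$ (depending on the parameters $t^*,\varepsilon$) such that for almost every $(\hat t_1,\hat t_2)\in[t^*,t^*+\varepsilon]^2$ $$K(\hat t_1,\hat t_2)=\int_{L(H((t_1,t_2),x),\{(\hat t_1,\hat t_2)\})}\rho(x)\frac{|G'(\hat t_1,x)|\,|G''(\hat t_2,x)|}{\sqrt{V((\hat t_1,\hat t_2),x)}}\,d\mathbb H^{n-2}\le C_{t^*,\varepsilon}(\hat t_1,\hat t_2),$$ and $\int_{[t^*,t^*+\varepsilon]}d\hat t_1\int_{[t^*,t^*+\varepsilon]}C_{t^*,\varepsilon}(\hat t_1,\hat t_2)\,d\hat t_2=o(\varepsilon)$ (as $\varepsilon\to0_+$), where $V((t_1,t_2),x)=\|\nabla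 G(t_1,x)\|^2\|\nabla G'(t_2,x)\|^2-(\nabla G(t_1,x)^\top\nabla G'(t_2,x))^2$; (4) $\int_{\Xi(H((t_1,t_2),x),\,Q_1((t_1,t_2),x),\,[t^*,t^*+\varepsilon]^2)}\rho(x)\,dx=0$, where $Q_1((t_1,t_2),x)=G'(t_1,x)\,G''(t_2,x)\,V((t_1,t_2),x)$. Let $\Theta(t,\varepsilon)=\{x\in\mathbb R^n\mid G(t,x)\,G(t+\varepsilon,x)\le 0\}$. Then the (right) derivative $$\eta(t^* )=\Big(\int_{\Theta(t^*,\varepsilon)}\rho(x)\,dx\Big)'\Big|_{\varepsilon=0}$$ with respect to $\varepsilon$ at $\varepsilon=0$ exists, and $\varphi'_{G,\rho}(t^* )=\eta(t^* )$.
   Context: $I=[l,u]\subset\mathbb R$. For $J\subseteq I$, $N(x,G,J)=\#\{t\in J\mid G(t,x)=0\}$, $\mathbb E N(G,\rho,J)=\int_{\mathbb R^n}N(x,G,J)\rho(x)\,dx$, and $\Lambda_i(G,J)=\{x\in\mathbb R^n\mid N(x,G,J)\ge i\}$ for $i\in\mathbb N=\{1,2,\dots\}$. The cumulative expectation function is $\varphi_{G,\rho}(t)=\mathbb E N(G,\rho,[l,t])$, $t\in[l,u]$ (derivative at $l$ is the right derivative). $\Psi_{G,\rho}(I)$ is the (Lebesgue null) set of $t\in I$ at which the equality $\varphi_{G,\rho}'(t)=\sum_{i=1}^\infty\big(\int_{\Lambda_i(G,[l,t])}\rho(x)\,dx\big)'$ (derivatives in $t$) fails, including points where a derivative does not exist.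 Notation: primes on $G$ denote derivatives in $t$; $\nabla$ is the gradient in $x$; $\|\cdot\|$ is the Euclidean norm; $\mathbb H^m$ is $m$-dimensional Hausdorff measure. For $J\subseteq A\subseteq\mathbb R^k$ and functions $P(s,x)$ on $A\times\mathbb R^n$ with values in $\mathbb R^m$ and $Q(s,x)$ on $A\times\mathbb R^n$ (vector valued): $L(P(s,x),J)=\bigcup_{s\in J}\{x\in\mathbb R^n\mid P(s,x)=0\}$; $\eta(P(s,x),J,x)=\{s\in J\mid P(s,x)=0\}$; $\Xi(P(s,x),Q(s,x),J)=\{x\in\mathbb R^n\mid \emptyset\ne\eta(P(s,x),J,x)\subseteq\eta(Q(s,x),J,x)\}$ (this three-argument $\eta$ is unrelated to $\eta(t^* )$). *)

theory Defs
  imports "HOL-Analysis.Analysis" "HOL-Library.Landau_Symbols"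
begin

section \<open>Hausdorff measure\<close>

text \<open>
  The normalisation by the volume of the Euclidean unit ball makes the \<open>m\<close>-dimensional
  Hausdorff measure agree with Lebesgue measure in dimension \<open>m\<close>, and with
  the counting measure for \<open>m = 0\<close>. Empty covering sets have to be treated separately because
  \<open>0 ^ 0 = 1\<close>, and boundedness has to be required because \<open>diameter\<close> is
  unspecified for unbounded sets.
\<close>

definition hausdorff_gauge :: "nat \<Rightarrow> 'a::metric_space set \<Rightarrow> ennreal" where
  "hausdorff_gauge m S =
     (if S = {} then 0 else ennreal (unit_ball_vol (real m) * (diameter S / 2) ^ m))"

definition hausdorff_covers :: "real \<Rightarrow> 'a::metric_space set \<Rightarrow> (nat \<Rightarrow> 'a set) set" where
  "hausdorff_covers \<delta> S =
     {C. S \<subseteq> (\<Union>i. C i) \<and> (\<forall>i. bounded (C i) \<and> diameter (C i) \<le> \<delta>)}"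

definition hausdorff_content :: "nat \<Rightarrow> real \<Rightarrow> 'a::metric_space set \<Rightarrow> ennreal" where
  "hausdorff_content m \<delta> S = (INF C\<in>hausdorff_covers \<delta> S. \<Sum>i. hausdorff_gauge m (C i))"

definition hausdorff_outer :: "nat \<Rightarrow> 'a::metric_space set \<Rightarrow> ennreal" where
  "hausdorff_outer m S = (SUP \<delta>\<in>{0<..}. hausdorff_content m \<delta> S)"

definition hausdorff_measure :: "nat \<Rightarrow> 'a::metric_space measure" where
  "hausdorff_measure m =
     measure_of UNIV (lambda_system UNIV UNIV (hausdorff_outer m)) (hausdorff_outer m)"

lemma hausdorff_content_empty:
  assumes "\<delta> > 0"
  shows "hausdorff_content m \<delta> {} = 0"
proof -
  have "(\<lambda>_. {}) \<in> hausdorff_covers \<delta> ({} :: 'a set)"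
    using assms by (simp add: hausdorff_covers_def)
  then have "hausdorff_content m \<delta> ({} :: 'a set) \<le> (\<Sum>i::nat. hausdorff_gauge m ({} :: 'a set))"
    unfolding hausdorff_content_def by (rule INF_lower)
  then show ?thesis
    by (simp add: hausdorff_gauge_def)
qed

lemma hausdorff_content_mono:
  "S \<subseteq> T \<Longrightarrow> hausdorff_content m \<delta> S \<le> hausdorff_content m \<delta> T"
  unfolding hausdorff_content_def
  by (rule INF_superset_mono) (auto simp: hausdorff_covers_def)

lemma hausdorff_content_subadditive:
  fixes A :: "nat \<Rightarrow> 'a::metric_space set"
  shows "hausdorff_content m \<delta> (\<Union>n. A n) \<le> (\<Sum>n. hausdorff_content m \<delta> (A n))"
proof (rule ennreal_le_epsilon)
  fix e :: real
  assume e: "0 < e" and fin: "(\<Sum>n. hausdorff_content m \<delta> (A n)) < top"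
  have "\<exists>C\<in>hausdorff_covers \<delta> (A n).
      (\<Sum>i. hausdorff_gauge m (C i)) \<le> hausdorff_content m \<delta> (A n) + e * (1/2) ^ Suc n" for n
  proof -
    have "hausdorff_content m \<delta> (A n) \<noteq> top"
      using fin by (auto simp: less_top dest!: ennreal_suminf_lessD)
    then have "hausdorff_content m \<delta> (A n) < hausdorff_content m \<delta> (A n) + e * (1/2) ^ Suc n"
      using e by (auto simp: less_top ennreal_zero_less_mult_iff)
    then show ?thesis
      unfolding hausdorff_content_def INF_less_iff by (auto intro: less_imp_le)
  qed
  then obtain B where B: "\<And>n. B n \<in> hausdorff_covers \<delta> (A n)"
    and le: "\<And>n. (\<Sum>i. hausdorff_gauge m (B n i)) \<le> hausdorff_content m \<delta> (A n) + e * (1/2) ^ Suc n"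
    by metis
  define C where "C = case_prod B \<circ> prod_decode"
  have "C \<in> hausdorff_covers \<delta> (\<Union>n. A n)"
    unfolding hausdorff_covers_def
  proof safe
    fix x n assume "x \<in> A n"
    then obtain i where "x \<in> B n i"
      using B[of n] by (auto simp: hausdorff_covers_def)
    then have "x \<in> C (prod_encode (n, i))"
      by (simp add: C_def)
    then show "x \<in> (\<Union>i. C i)" by blast
  qed (use B in \<open>auto simp: hausdorff_covers_def C_def split: prod.split\<close>)
  then have "hausdorff_content m \<delta> (\<Union>n. A n) \<le> (\<Sum>i. hausdorff_gauge m (C i))"
    unfolding hausdorff_content_def by (rule INF_lower)
  also have "\<dots> = (\<Sum>n. \<Sum>i. hausdorff_gauge m (B n i))"
    unfolding C_def comp_def by (intro suminf_ennreal_2dimen) auto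
  also have "\<dots> \<le> (\<Sum>n. hausdorff_content m \<delta> (A n) + e * (1/2) ^ Suc n)"
    by (intro suminf_le le) auto
  also have "\<dots> = (\<Sum>n. hausdorff_content m \<delta> (A n)) + (\<Sum>n. ennreal e * ennreal ((1/2) ^ Suc n))"
    using e by (subst suminf_add[symmetric])
      (auto simp del: ennreal_suminf_cmult simp add: ennreal_mult[symmetric])
  also have "\<dots> = (\<Sum>n. hausdorff_content m \<delta> (A n)) + e"
    unfolding ennreal_suminf_cmult
    by (subst suminf_ennreal_eq[OF zero_le_power power_half_series]) auto
  finally show "hausdorff_content m \<delta> (\<Union>n. A n) \<le> (\<Sum>n. hausdorff_content m \<delta> (A n)) + e" .
qed

lemma outer_measure_space_hausdorff_outer:
  "outer_measure_space UNIV (hausdorff_outer m :: 'a::metric_space set \<Rightarrow> ennreal)"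
  unfolding outer_measure_space_def
proof (intro conjI)
  show "positive UNIV (hausdorff_outer m :: 'a set \<Rightarrow> ennreal)"
    by (simp add: positive_def hausdorff_outer_def hausdorff_content_empty)
  show "increasing UNIV (hausdorff_outer m :: 'a set \<Rightarrow> ennreal)"
    by (auto simp: increasing_def hausdorff_outer_def intro!: SUP_mono hausdorff_content_mono)
  show "countably_subadditive UNIV (hausdorff_outer m :: 'a set \<Rightarrow> ennreal)"
    unfolding countably_subadditive_def
  proof (intro allI impI)
    fix A :: "nat \<Rightarrow> 'a set"
    show "hausdorff_outer m (\<Union>n. A n) \<le> (\<Sum>n. hausdorff_outer m (A n))"
      unfolding hausdorff_outer_def[of _ "\<Union>n. A n"]
    proof (rule SUP_least)
      fix \<delta> :: real assume \<delta>: "\<delta> \<in> {0<..}"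
      have "hausdorff_content m \<delta> (\<Union>n. A n) \<le> (\<Sum>n. hausdorff_content m \<delta> (A n))"
        by (rule hausdorff_content_subadditive)
      also have "\<dots> \<le> (\<Sum>n. hausdorff_outer m (A n))"
        unfolding hausdorff_outer_def using \<delta> by (intro suminf_le SUP_upper) auto
      finally show "hausdorff_content m \<delta> (\<Union>n. A n) \<le> (\<Sum>n. hausdorff_outer m (A n))" .
    qed
  qed
qed

lemma
  fixes S :: "'a::metric_space set"
  shows sets_hausdorff_measure:
      "sets (hausdorff_measure m) = lambda_system (UNIV :: 'a set) UNIV (hausdorff_outer m)" (is ?sets)
    and emeasure_hausdorff_measure:
      "S \<in> sets (hausdorff_measure m) \<Longrightarrow> emeasure (hausdorff_measure m) S = hausdorff_outer m S"
proof -
  have ms: "measure_space (UNIV :: 'a set) (lambda_system UNIV UNIV (hausdorff_outer m)) (hausdorff_outer m)"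
    using sigma_algebra.caratheodory_lemma[OF sigma_algebra_Pow[of UNIV],
        of "hausdorff_outer m :: 'a set \<Rightarrow> ennreal"] outer_measure_space_hausdorff_outer[of m]
    by simp
  then have sa: "sigma_algebra (UNIV :: 'a set) (lambda_system UNIV UNIV (hausdorff_outer m))"
    by (simp add: measure_space_def)
  then show sets: ?sets
    by (simp add: hausdorff_measure_def sigma_algebra.sigma_sets_eq)
  show "emeasure (hausdorff_measure m) S = hausdorff_outer m S"
    if "S \<in> sets (hausdorff_measure m)"
    using emeasure_measure_of_sigma[OF sa, of "hausdorff_outer m" S] ms that sets
    by (simp add: hausdorff_measure_def measure_space_def)
qed


section \<open>Derivatives of a function of time and space\<close>

text \<open>
  Time derivatives are taken relative to \<open>{l..u}\<close>, so they are two-sided at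
  interior points and one-sided at the endpoints.
\<close>

definition dt_exists ::
    "real \<Rightarrow> real \<Rightarrow> (real \<Rightarrow> 'a \<Rightarrow> real) \<Rightarrow> real \<Rightarrow> 'a \<Rightarrow> bool" where
  "dt_exists l u G t x \<longleftrightarrow> (\<lambda>s. G s x) differentiable (at t within {l..u})"

definition dt :: "real \<Rightarrow> real \<Rightarrow> (real \<Rightarrow> 'a \<Rightarrow> real) \<Rightarrow> real \<Rightarrow> 'a \<Rightarrow> real" where
  "dt l u G t x = vector_derivative (\<lambda>s. G s x) (at t within {l..u})"

text \<open>
  The second derivative is only meaningful where the first one exists in a neighbourhood, since
  \<open>dt\<close> is unspecified elsewhere.
\<close>

definition dt2_exists ::
    "real \<Rightarrow> real \<Rightarrow> (real \<Rightarrow> 'a \<Rightarrow> real) \<Rightarrow> real \<Rightarrow> 'a \<Rightarrow> bool" where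
  "dt2_exists l u G t x \<longleftrightarrow>
     dt_exists l u G t x \<and> (\<forall>\<^sub>F s in at t within {l..u}. dt_exists l u G s x) \<and>
     dt_exists l u (dt l u G) t x"

abbreviation dt2 :: "real \<Rightarrow> real \<Rightarrow> (real \<Rightarrow> 'a \<Rightarrow> real) \<Rightarrow> real \<Rightarrow> 'a \<Rightarrow> real" where
  "dt2 l u G \<equiv> dt l u (dt l u G)"

definition grad_exists :: "('a::real_inner \<Rightarrow> real) \<Rightarrow> 'a \<Rightarrow> bool" where
  "grad_exists f x \<longleftrightarrow> (\<exists>D. GDERIV f x :> D)"

definition grad :: "('a::real_inner \<Rightarrow> real) \<Rightarrow> 'a \<Rightarrow> 'a" where
  "grad f x = (THE D. GDERIV f x :> D)"

definition regular_on ::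
    "real \<Rightarrow> real \<Rightarrow> (real \<Rightarrow> 'a::real_inner \<Rightarrow> real) \<Rightarrow> real set \<Rightarrow> 'a set \<Rightarrow> bool" where
  "regular_on l u G T X \<longleftrightarrow>
     (\<forall>t\<in>T. \<forall>x\<in>X. dt_exists l u G t x \<and> dt2_exists l u G t x \<and>
        grad_exists (G t) x \<and> grad_exists (dt l u G t) x) \<and>
     continuous_on (T \<times> X) (\<lambda>(t, x). dt l u G t x) \<and>
     continuous_on (T \<times> X) (\<lambda>(t, x). dt2 l u G t x) \<and>
     continuous_on (T \<times> X) (\<lambda>(t, x). grad (G t) x) \<and>
     continuous_on (T \<times> X) (\<lambda>(t, x). grad (dt l u G t) x)"


section \<open>Zero sets\<close>

definition zero_locus :: "('s \<Rightarrow> 'a \<Rightarrow> 'v::zero) \<Rightarrow> 's set \<Rightarrow> 'a set" where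
  "zero_locus P J = (\<Union>s\<in>J. {x. P s x = 0})"

definition zero_params :: "('s \<Rightarrow> 'a \<Rightarrow> 'v::zero) \<Rightarrow> 's set \<Rightarrow> 'a \<Rightarrow> 's set" where
  "zero_params P J x = {s \<in> J. P s x = 0}"

definition Xi ::
    "('s \<Rightarrow> 'a \<Rightarrow> 'v::zero) \<Rightarrow> ('s \<Rightarrow> 'a \<Rightarrow> 'w::zero) \<Rightarrow> 's set \<Rightarrow> 'a set" where
  "Xi P Q J = {x. zero_params P J x \<noteq> {} \<and> zero_params P J x \<subseteq> zero_params Q J x}"

definition Hmap ::
    "real \<Rightarrow> real \<Rightarrow> (real \<Rightarrow> 'a \<Rightarrow> real) \<Rightarrow> real \<times> real \<Rightarrow> 'a \<Rightarrow> real \<times> real" where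
  "Hmap l u G = (\<lambda>(t1, t2) x. (G t1 x, dt l u G t2 x))"

definition V ::
    "real \<Rightarrow> real \<Rightarrow> (real \<Rightarrow> 'a::real_inner \<Rightarrow> real) \<Rightarrow> real \<times> real \<Rightarrow> 'a \<Rightarrow> real" where
  "V l u G = (\<lambda>(t1, t2) x.
     (norm (grad (G t1) x))\<^sup>2 * (norm (grad (dt l u G t2) x))\<^sup>2
       - (grad (G t1) x \<bullet> grad (dt l u G t2) x)\<^sup>2)"

definition Q1 ::
    "real \<Rightarrow> real \<Rightarrow> (real \<Rightarrow> 'a::real_inner \<Rightarrow> real) \<Rightarrow> real \<times> real \<Rightarrow> 'a \<Rightarrow> real" where
  "Q1 l u G = (\<lambda>(t1, t2) x. dt l u G t1 x * dt2 l u G t2 x * V l u G (t1, t2) x)"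

text \<open>
  The integrand of \<open>K\<close> takes values in \<open>[0,\<infinity>]\<close>; where \<open>V\<close> vanishes it is \<open>\<infinity>\<close> if the numerator
  is positive, and \<open>0\<close> otherwise.
\<close>

definition K ::
    "real \<Rightarrow> real \<Rightarrow> (real \<Rightarrow> real ^ 'n \<Rightarrow> real) \<Rightarrow> (real ^ 'n \<Rightarrow> real) \<Rightarrow>
     real \<times> real \<Rightarrow> ennreal" where
  "K l u G \<rho> = (\<lambda>(t1, t2).
     \<integral>\<^sup>+x\<in>zero_locus (Hmap l u G) {(t1, t2)}.
       (ennreal (\<rho> x * (\<bar>dt l u G t1 x\<bar> * \<bar>dt2 l u G t2 x\<bar>)) / ennreal (sqrt (V l u G (t1, t2) x)))
       \<partial>hausdorff_measure (CARD('n) - 2))"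


section \<open>Number of zeros and its expectation\<close>

definition prob_density :: "('a::euclidean_space \<Rightarrow> real) \<Rightarrow> bool" where
  "prob_density \<rho> \<longleftrightarrow> (\<forall>x. 0 \<le> \<rho> x) \<and> has_bochner_integral lebesgue \<rho> 1"

definition zero_count :: "(real \<Rightarrow> 'a \<Rightarrow> real) \<Rightarrow> real set \<Rightarrow> 'a \<Rightarrow> ennreal" where
  "zero_count G J x = emeasure (count_space UNIV) {t \<in> J. G t x = 0}"

definition expected_zeros ::
    "(real \<Rightarrow> 'a::euclidean_space \<Rightarrow> real) \<Rightarrow> ('a \<Rightarrow> real) \<Rightarrow> real set \<Rightarrow> ennreal" where
  "expected_zeros G \<rho> J = (\<integral>\<^sup>+x. zero_count G J x * ennreal (\<rho> x) \<partial>lebesgue)"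

definition Lambda :: "nat \<Rightarrow> (real \<Rightarrow> 'a \<Rightarrow> real) \<Rightarrow> real set \<Rightarrow> 'a set" where
  "Lambda i G J = {x. of_nat i \<le> zero_count G J x}"

definition cum_expectation ::
    "real \<Rightarrow> (real \<Rightarrow> 'a::euclidean_space \<Rightarrow> real) \<Rightarrow> ('a \<Rightarrow> real) \<Rightarrow> real \<Rightarrow> real" where
  "cum_expectation l G \<rho> t = enn2real (expected_zeros G \<rho> {l..t})"

text \<open>The index is shifted by one: the series starts with the derivative for \<open>Lambda 1\<close>.\<close>

definition Psi ::
    "(real \<Rightarrow> 'a::euclidean_space \<Rightarrow> real) \<Rightarrow> ('a \<Rightarrow> real) \<Rightarrow> real \<Rightarrow> real \<Rightarrow> real set" where
  "Psi G \<rho> l u = {t \<in> {l..u}. \<not> (\<exists>D d.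
     (cum_expectation l G \<rho> has_real_derivative D) (at t within {l..u}) \<and>
     (\<forall>i. ((\<lambda>s. LINT x:Lambda (Suc i) G {l..s}|lebesgue. \<rho> x)
             has_real_derivative d i) (at t within {l..u})) \<and>
     d sums D)}"

definition Theta :: "(real \<Rightarrow> 'a \<Rightarrow> real) \<Rightarrow> real \<Rightarrow> real \<Rightarrow> 'a set" where
  "Theta G t \<epsilon> = {x. G t x * G (t + \<epsilon>) x \<le> 0}"

end

theory Submission
  imports Defs
begin

text \<open>
  For small \<open>\<epsilon> > 0\<close> write \<open>J = [t\<^sup>*, t\<^sup>* + \<epsilon>]\<close> and let \<open>X\<close> be the set of points \<open>x\<close> for which
  \<open>G(\<sqdot>, x)\<close> has in \<open>J\<close> both a zero and a critical time; this is the zero locus of \<open>H\<close> over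
  \<open>J \<times> J\<close>. If \<open>x\<close> is outside \<open>X\<close>, then by Rolle's theorem \<open>G(\<sqdot>, x)\<close> has at most one zero in
  \<open>J\<close>, and it has one exactly if its signs at the two endpoints differ, that is, if
  \<open>x \<in> \<Theta>(t\<^sup>*, \<epsilon>)\<close>: otherwise an extremum in the interior would be a critical time. Points with
  \<open>G(t\<^sup>*, x) = 0\<close> have probability \<open>0\<close>. Hence, up to points of \<open>X\<close>, extending \<open>[l, t\<^sup>*]\<close> by \<open>J\<close> raises
  the number of zeros by the indicator of \<open>\<Theta>\<close> (\<open>zero_count_increment\<close>), and so \<open>x\<close> joins at most one
  of the sets \<open>\<Lambda>\<^sub>i\<close>. Integrating gives, for every \<open>k\<close>,
  \<open>(\<Sum>i\<le>k. P(\<Lambda>\<^sub>i(G, [l, t\<^sup>* + \<epsilon>])) - P(\<Lambda>\<^sub>i(G, [l, t\<^sup>*]))) - k P(X) \<le> P(\<Theta>) \<le> \<phi>(t\<^sup>* + \<epsilon>) - \<phi>(t\<^sup>*)\<close>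
  (\<open>increment_bounds\<close>). If \<open>P(X) = o(\<epsilon>)\<close>, then after division by \<open>\<epsilon>\<close> the right side tends to
  \<open>\<phi>'(t\<^sup>*)\<close> and the left side to a partial sum of the series of the derivatives of \<open>P(\<Lambda>\<^sub>i)\<close>, whose
  sum is again \<open>\<phi>'(t\<^sup>*)\<close> because \<open>t\<^sup>*\<close> is not in \<open>\<Psi>\<close>. So \<open>P(\<Theta>)/\<epsilon>\<close> is squeezed to \<open>\<phi>'(t\<^sup>*)\<close>.

  It remains to show \<open>P(X) = o(\<epsilon>)\<close>. Up to the \<open>\<rho>\<close>-null set \<open>\<Xi>\<close>, a point of \<open>X\<close> has a zero
  \<open>(t\<^sub>1, t\<^sub>2)\<close> of \<open>H\<close> with \<open>G'(t\<^sub>1, x)\<close>, \<open>G''(t\<^sub>2, x)\<close> and \<open>V\<close> all nonzero. If \<open>(t\<^sub>1, t\<^sub>2)\<close> is on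
  the boundary of the square, then \<open>x\<close> is a zero with nonzero gradient of one of four functions, and such
  zeros form a Lebesgue null set (\<open>negligible_regular_zeros\<close>). If it is in the interior, then
  \<open>G(\<sqdot>, x)\<close> and \<open>G'(\<sqdot>, x)\<close> change sign at \<open>t\<^sub>1\<close> and \<open>t\<^sub>2\<close>. These sign changes survive small
  perturbations of \<open>x\<close>, so \<open>x\<close> is an interior point of \<open>X\<close>
  (\<open>nondegenerate_zeros_subset_interior\<close>). In particular \<open>X\<close> is measurable up to null sets, and
  near \<open>x\<close> all derivatives exist on an open set; the implicit function theorem gives
  \<open>t\<^sub>1 = T\<^sub>1(x)\<close> and \<open>t\<^sub>2 = T\<^sub>2(x)\<close> there.

  The map \<open>T = (T\<^sub>1, T\<^sub>2)\<close> has the coarea factor \<open>\<surd>V / |G' G''|\<close>. The coarea formula would thus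
  turn the probability of a small set into the integral over the square of the integral defining \<open>K\<close>,
  restricted to that set. Since only \<open>o(\<epsilon>)\<close> is claimed, an inequality up to a factor depending on \<open>n\<close>
  suffices (\<open>coarea_inequality_local\<close>), and it has an elementary proof. Some \<open>2 \<times> 2\<close> minor of the
  derivative of \<open>T\<close> is comparable to the coarea factor. Replacing the two corresponding coordinates of \<open>x\<close>
  by \<open>T\<^sub>1\<close> and \<open>T\<^sub>2\<close>, one changes variables in the plane of these coordinates for fixed values of the
  others. The remaining \<open>n - 2\<close> coordinates then run through the projection of a fibre of \<open>T\<close>, and the
  Lebesgue measure of a projection is at most a constant times the Hausdorff measure of the fibre: a set of
  diameter \<open>d\<close> projects into a cube of side \<open>2d\<close>. A countable cover by such small sets, cut to be disjoint,
  and the assumed bound \<open>K \<le> C\<close> complete the estimate.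
\<close>

section \<open>Borel sets are measurable for Hausdorff measure\<close>

lemma hausdorff_content_antimono:
  assumes "\<delta> \<le> \<delta>'"
  shows "hausdorff_content m \<delta>' S \<le> hausdorff_content m \<delta> S"
  unfolding hausdorff_content_def
  by (rule INF_superset_mono) (auto simp: hausdorff_covers_def intro: order_trans[OF _ assms])

lemma hausdorff_outer_mono: "S \<subseteq> T \<Longrightarrow> hausdorff_outer m S \<le> hausdorff_outer m T"
  unfolding hausdorff_outer_def by (intro SUP_mono) (blast intro: hausdorff_content_mono)

lemma hausdorff_outer_empty [simp]: "hausdorff_outer m ({} :: 'a::metric_space set) = 0"
  using outer_measure_space_hausdorff_outer[of m, where 'a='a]
  by (simp add: outer_measure_space_def positive_def)

text \<open>
  The property \<open>countably_subadditive\<close> only speaks of disjoint families; a general family is first made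
  disjoint, which can only decrease its members.
\<close>

lemma hausdorff_outer_countably_subadditive:
  "hausdorff_outer m (\<Union>n. A n) \<le> (\<Sum>n. hausdorff_outer m (A n :: 'a::metric_space set))"
proof (cases "disjoint_family A")
  case True
  then show ?thesis
  using outer_measure_space_hausdorff_outer[of m, where 'a='a]
  by (auto simp: outer_measure_space_def countably_subadditive_def)
next
  case False
  have "hausdorff_outer m (\<Union>n. A n) = hausdorff_outer m (\<Union>n. disjointed A n)"
    by (simp add: UN_disjointed_eq)
  also have "\<dots> \<le> (\<Sum>n. hausdorff_outer m (disjointed A n))"
    using outer_measure_space_hausdorff_outer[of m, where 'a='a] disjoint_family_disjointed[of A]
    by (auto simp: outer_measure_space_def countably_subadditive_def)
  also have "\<dots> \<le> (\<Sum>n. hausdorff_outer m (A n))"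
    by (intro suminf_le hausdorff_outer_mono disjointed_subset) auto
  finally show ?thesis .
qed

lemma hausdorff_outer_subadditive:
  fixes A B :: "'a::metric_space set"
  shows "hausdorff_outer m (A \<union> B) \<le> hausdorff_outer m A + hausdorff_outer m B"
proof -
  have "hausdorff_outer m (\<Union>n. binaryset A B n) \<le> (\<Sum>n. hausdorff_outer m (binaryset A B n))"
    by (rule hausdorff_outer_countably_subadditive)
  also have "\<dots> = hausdorff_outer m A + hausdorff_outer m B"
    by (rule suminf_binaryset_eq) simp
  finally show ?thesis
    by (simp add: UN_binaryset_eq)
qed

text \<open>
  If all sets of a cover have diameter below the distance between \<open>A\<close> and \<open>B\<close>, none of them meets both,
  so the cover splits into a cover of \<open>A\<close> and one of \<open>B\<close>.
\<close>

lemma hausdorff_content_Un_separated: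
  fixes A B :: "'a::metric_space set"
  assumes sep: "\<And>x y. x \<in> A \<Longrightarrow> y \<in> B \<Longrightarrow> d \<le> dist x y" and \<delta>: "0 < \<delta>" "\<delta> < d"
  shows "hausdorff_content m \<delta> A + hausdorff_content m \<delta> B \<le> hausdorff_content m \<delta> (A \<union> B)"
  unfolding hausdorff_content_def[of _ _ "A \<union> B"]
proof (rule INF_greatest)
  fix C assume C: "C \<in> hausdorff_covers \<delta> (A \<union> B)"
  define R where "R S i = (if C i \<inter> S = {} then {} else C i)" for S i
  have cover: "R S \<in> hausdorff_covers \<delta> S" if "S \<subseteq> A \<union> B" for S
  proof -
    have "x \<in> (\<Union>i. R S i)" if "x \<in> S" for x
    proof -
      have "A \<union> B \<subseteq> (\<Union>i. C i)"
        using C by (simp add: hausdorff_covers_def)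
      with that \<open>S \<subseteq> A \<union> B\<close> obtain i where "x \<in> C i" by blast
      with that have "x \<in> R S i" by (auto simp: R_def)
      then show ?thesis by blast
    qed
    moreover have "bounded (R S i) \<and> diameter (R S i) \<le> \<delta>" for i
      using C \<delta> by (auto simp: hausdorff_covers_def R_def)
    ultimately show ?thesis by (auto simp: hausdorff_covers_def)
  qed
  have disj: "C i \<inter> A = {} \<or> C i \<inter> B = {}" for i
  proof (rule ccontr)
    assume "\<not> ?thesis"
    then obtain x y where xy: "x \<in> C i" "x \<in> A" "y \<in> C i" "y \<in> B" by blast
    then have "dist x y \<le> diameter (C i)"
      using C by (intro diameter_bounded_bound) (auto simp: hausdorff_covers_def)
    with sep[of x y] xy C \<delta> show False
      by (auto simp: hausdorff_covers_def not_le dest!: spec[of _ i])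
  qed
  have "hausdorff_content m \<delta> A + hausdorff_content m \<delta> B
      \<le> (\<Sum>i. hausdorff_gauge m (R A i)) + (\<Sum>i. hausdorff_gauge m (R B i))"
    unfolding hausdorff_content_def by (intro add_mono INF_lower cover) auto
  also have "\<dots> = (\<Sum>i. hausdorff_gauge m (R A i) + hausdorff_gauge m (R B i))"
    by (rule suminf_add) auto
  also have "\<dots> \<le> (\<Sum>i. hausdorff_gauge m (C i))"
    using disj by (intro suminf_le) (auto simp: R_def hausdorff_gauge_def)
  finally show "hausdorff_content m \<delta> A + hausdorff_content m \<delta> B
      \<le> (\<Sum>i. hausdorff_gauge m (C i))" .
qed

lemma hausdorff_outer_Un_separated:
  fixes A B :: "'a::metric_space set"
  assumes sep: "\<And>x y. x \<in> A \<Longrightarrow> y \<in> B \<Longrightarrow> d \<le> dist x y" and d: "0 < d"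
  shows "hausdorff_outer m (A \<union> B) = hausdorff_outer m A + hausdorff_outer m B"
proof (rule antisym[OF hausdorff_outer_subadditive])
  have *: "hausdorff_content m \<delta>1 A + hausdorff_content m \<delta>2 B \<le> hausdorff_outer m (A \<union> B)"
    if "\<delta>1 > 0" "\<delta>2 > 0" for \<delta>1 \<delta>2
  proof -
    define \<delta> where "\<delta> = min (min \<delta>1 \<delta>2) (d/2)"
    have "hausdorff_content m \<delta>1 A + hausdorff_content m \<delta>2 B
        \<le> hausdorff_content m \<delta> A + hausdorff_content m \<delta> B"
      by (intro add_mono hausdorff_content_antimono) (auto simp: \<delta>_def)
    also have "\<dots> \<le> hausdorff_content m \<delta> (A \<union> B)"
      using that d by (intro hausdorff_content_Un_separated[OF sep]) (auto simp: \<delta>_def)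
    also have "\<dots> \<le> hausdorff_outer m (A \<union> B)"
      unfolding hausdorff_outer_def using that d by (intro SUP_upper) (auto simp: \<delta>_def)
    finally show ?thesis .
  qed
  have "hausdorff_outer m A + hausdorff_content m \<delta>2 B \<le> hausdorff_outer m (A \<union> B)"
    if "\<delta>2 > 0" for \<delta>2
    unfolding hausdorff_outer_def[of m A]
    by (subst ennreal_SUP_add_left[symmetric]) (auto intro!: SUP_least * that)
  then show "hausdorff_outer m A + hausdorff_outer m B \<le> hausdorff_outer m (A \<union> B)"
    unfolding hausdorff_outer_def[of m B]
    by (subst ennreal_SUP_add_right) (auto intro!: SUP_least)
qed

text \<open>
  This is the core of Caratheodory's criterion. The sets \<open>T k\<close>, which keep a distance \<open>1 / (k + 1)\<close> from
  \<open>A\<close>, exhaust \<open>S - A\<close>; the differences \<open>T (k + 1) - T k\<close> form shells around \<open>A\<close>. Shells whose indices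
  differ by at least two are separated, so the measures of the shells with even index add up to at most the
  measure of \<open>S\<close>, and likewise for odd indices. The series over all shells therefore converges and its
  tails, which bound what \<open>T n\<close> misses of \<open>S - A\<close>, tend to zero.
\<close>

lemma hausdorff_outer_Diff_closed:
  fixes A S :: "'a::metric_space set"
  assumes A: "closed A" "A \<noteq> {}" and fin: "hausdorff_outer m S < \<infinity>"
  defines "T \<equiv> \<lambda>k. {x \<in> S. 1 / real (Suc k) \<le> infdist x A}"
  shows "hausdorff_outer m (S - A) \<le> (SUP k. hausdorff_outer m (T k))"
proof -
  define R where "R k = T (Suc k) - T k" for k
  have Tmono: "T k \<subseteq> T k'" if "k \<le> k'" for k k'
    using that unfolding T_def by (auto intro: order_trans[rotated] simp: frac_le)
  have Rsep: "1 / real (Suc (Suc i)) - 1 / real (Suc j) \<le> dist x y"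
    if "x \<in> R i" "y \<in> R j" for x y i j
  proof -
    have "1 / real (Suc (Suc i)) \<le> infdist x A" "infdist y A < 1 / real (Suc j)"
      using that by (auto simp: R_def T_def)
    then show ?thesis
      using infdist_triangle[of x A y] by simp
  qed
  have fin': "(\<Sum>k<n. hausdorff_outer m (R (2 * k + p))) \<le> hausdorff_outer m S" for n p
  proof -
    have "hausdorff_outer m (\<Union>k<n. R (2 * k + p)) = (\<Sum>k<n. hausdorff_outer m (R (2 * k + p)))"
    proof (induction n)
      case (Suc n)
      \<comment> \<open>the gap between the shell with index \<open>2 * n + p\<close> and all earlier ones; for \<open>n = 0\<close> there
        are no earlier ones and any positive number will do\<close>
      define d where "d = (if n = 0 then 1 else 1 / real (2 * n + p) - 1 / real (Suc (2 * n + p)))"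
      have "0 < d" by (auto simp: d_def intro!: divide_strict_left_mono)
      have "d \<le> dist x y" if "x \<in> (\<Union>k<n. R (2 * k + p))" "y \<in> R (2 * n + p)" for x y
      proof -
        from that obtain k where k: "k < n" "x \<in> R (2 * k + p)" by auto
        have "1 / real (2 * n + p) \<le> 1 / real (Suc (Suc (2 * k + p)))"
          using k by (intro divide_left_mono) auto
        with Rsep[OF k(2) that(2)] k show ?thesis by (auto simp: d_def)
      qed
      then have "hausdorff_outer m ((\<Union>k<n. R (2 * k + p)) \<union> R (2 * n + p))
          = hausdorff_outer m (\<Union>k<n. R (2 * k + p)) + hausdorff_outer m (R (2 * n + p))"
        using \<open>0 < d\<close> by (intro hausdorff_outer_Un_separated) auto
      with Suc show ?case
        by (simp add: lessThan_Suc Un_commute add.commute)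
    qed simp
    moreover have "hausdorff_outer m (\<Union>k<n. R (2 * k + p)) \<le> hausdorff_outer m S"
      by (intro hausdorff_outer_mono) (auto simp: R_def T_def)
    ultimately show ?thesis by simp
  qed
  have fin2: "(\<Sum>k<n. hausdorff_outer m (R k)) \<le> 2 * hausdorff_outer m S" for n
  proof -
    have "(\<Sum>k<2*n. hausdorff_outer m (R k))
        = (\<Sum>k<n. hausdorff_outer m (R (2 * k + 0))) + (\<Sum>k<n. hausdorff_outer m (R (2 * k + 1)))"
      by (induction n) (auto simp: algebra_simps)
    also have "\<dots> \<le> hausdorff_outer m S + hausdorff_outer m S"
      by (intro add_mono fin')
    finally have "(\<Sum>k<2*n. hausdorff_outer m (R k)) \<le> 2 * hausdorff_outer m S"
      by (simp add: mult_2)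
    moreover have "(\<Sum>k<n. hausdorff_outer m (R k)) \<le> (\<Sum>k<2*n. hausdorff_outer m (R k))"
      by (intro sum_mono2) auto
    ultimately show ?thesis by order
  qed
  have "(\<Sum>k. hausdorff_outer m (R k)) \<le> 2 * hausdorff_outer m S"
    by (intro suminf_le_const summableI fin2)
  also have "\<dots> < \<infinity>" using fin by (simp add: ennreal_mult_less_top)
  finally have sumfin: "(\<Sum>k. hausdorff_outer m (R k)) \<noteq> \<infinity>" by simp
  have le: "hausdorff_outer m (S - A) \<le> (SUP k. hausdorff_outer m (T k))
      + (\<Sum>k. hausdorff_outer m (R (k + n)))" for n
  proof -
    have "S - A \<subseteq> T n \<union> (\<Union>k. R (k + n))"
    proof
      fix x assume x: "x \<in> S - A"
      then have "0 < infdist x A"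
        using A in_closed_iff_infdist_zero[of A x] infdist_nonneg[of x A] by (auto simp: less_le)
      then obtain k where "inverse (real (Suc k)) < infdist x A"
        using reals_Archimedean by blast
      then have "x \<in> T k" using x by (simp add: T_def inverse_eq_divide)
      \<comment> \<open>the first \<open>T k\<close> to contain \<open>x\<close> determines its shell\<close>
      define k0 where "k0 = (LEAST k. x \<in> T k)"
      have k0: "x \<in> T k0" unfolding k0_def by (rule LeastI) fact
      show "x \<in> T n \<union> (\<Union>k. R (k + n))"
      proof (cases "k0 \<le> n")
        case True
        then show ?thesis using Tmono k0 by blast
      next
        case False
        then obtain j where j: "k0 = Suc j" "n \<le> j"
          by (metis not_less_eq_eq not_less Suc_le_D less_eq_Suc_le Suc_le_mono)
        then have "x \<notin> T j" unfolding k0_def by (metis lessI not_less_Least)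
        with j k0 have "x \<in> R ((j - n) + n)" by (simp add: R_def)
        then show ?thesis by blast
      qed
    qed
    then have "hausdorff_outer m (S - A) \<le> hausdorff_outer m (T n \<union> (\<Union>k. R (k + n)))"
      by (rule hausdorff_outer_mono)
    also have "\<dots> \<le> hausdorff_outer m (T n) + hausdorff_outer m (\<Union>k. R (k + n))"
      by (rule hausdorff_outer_subadditive)
    also have "\<dots> \<le> (SUP k. hausdorff_outer m (T k)) + (\<Sum>k. hausdorff_outer m (R (k + n)))"
      by (intro add_mono SUP_upper hausdorff_outer_countably_subadditive) auto
    finally show ?thesis .
  qed
  have tail: "(\<lambda>n. \<Sum>k. hausdorff_outer m (R (k + n))) \<longlonglongrightarrow> 0"
  proof -
    define r where "r k = enn2real (hausdorff_outer m (R k))" for k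
    have r: "hausdorff_outer m (R k) = ennreal (r k)" for k
      using sumfin ennreal_suminf_lessD[of "\<lambda>k. hausdorff_outer m (R k)" \<infinity> k]
      by (auto simp: r_def less_top)
    have rnn: "r k \<ge> 0" for k by (simp add: r_def)
    have "summable r"
      using sumfin rnn unfolding r by (intro summable_suminf_not_top) auto
    then have "(\<lambda>n. ennreal (\<Sum>k. r (k + n))) \<longlonglongrightarrow> ennreal 0"
      by (intro tendsto_ennrealI suminf_exist_split2)
    moreover have "(\<Sum>k. hausdorff_outer m (R (k + n))) = ennreal (\<Sum>k. r (k + n))" for n
      unfolding r using \<open>summable r\<close> rnn by (intro suminf_ennreal2 summable_ignore_initial_segment) auto
    ultimately show ?thesis by simp
  qed
  have "(\<lambda>n. (SUP k. hausdorff_outer m (T k)) + (\<Sum>k. hausdorff_outer m (R (k + n))))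
      \<longlonglongrightarrow> (SUP k. hausdorff_outer m (T k)) + 0"
    by (intro tendsto_add tendsto_const tail)
  then show ?thesis
    using le by (intro LIMSEQ_le_const[of _ _ "hausdorff_outer m (S - A)"]) auto
qed

lemma closed_in_sets_hausdorff:
  fixes A :: "'a::metric_space set"
  assumes A: "closed A"
  shows "A \<in> sets (hausdorff_measure m)"
proof (cases "A = {}")
  case False
  have "hausdorff_outer m (A \<inter> S) + hausdorff_outer m ((UNIV - A) \<inter> S) = hausdorff_outer m S" for S
  proof (rule antisym)
    have "S = A \<inter> S \<union> (UNIV - A) \<inter> S" by blast
    then show "hausdorff_outer m S \<le> hausdorff_outer m (A \<inter> S) + hausdorff_outer m ((UNIV - A) \<inter> S)"
      using hausdorff_outer_subadditive by metis
    define T where "T = (\<lambda>k. {x \<in> S. 1 / real (Suc k) \<le> infdist x A})"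
    show "hausdorff_outer m (A \<inter> S) + hausdorff_outer m ((UNIV - A) \<inter> S) \<le> hausdorff_outer m S"
    proof (cases "hausdorff_outer m S < \<infinity>")
      case True
      have "hausdorff_outer m (A \<inter> S) + hausdorff_outer m (T k) \<le> hausdorff_outer m S" for k
      proof -
        have "1 / real (Suc k) \<le> dist x y" if "x \<in> A \<inter> S" "y \<in> T k" for x y
          using that infdist_le[of x A y] by (auto simp: T_def dist_commute)
        then have "hausdorff_outer m (A \<inter> S) + hausdorff_outer m (T k) = hausdorff_outer m (A \<inter> S \<union> T k)"
          by (intro hausdorff_outer_Un_separated[symmetric, where d = "1 / real (Suc k)"]) auto
        also have "\<dots> \<le> hausdorff_outer m S"
          by (intro hausdorff_outer_mono) (auto simp: T_def)
        finally show ?thesis .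
      qed
      then have "hausdorff_outer m (A \<inter> S) + (SUP k. hausdorff_outer m (T k)) \<le> hausdorff_outer m S"
        by (subst ennreal_SUP_add_right) (auto intro!: SUP_least)
      moreover have "hausdorff_outer m ((UNIV - A) \<inter> S) \<le> (SUP k. hausdorff_outer m (T k))"
        using hausdorff_outer_Diff_closed[OF A False True] by (simp add: T_def Int_commute Diff_eq)
      ultimately show ?thesis
        by (meson add_left_mono order_trans)
    qed (simp add: not_less top_unique)
  qed
  then show ?thesis
    by (simp add: sets_hausdorff_measure lambda_system_def)
qed simp

text \<open>
  The integral over a fibre in the definition of \<open>K\<close> is bounded below by integrals of Borel functions, which
  is informative only because these functions are measurable for the Hausdorff measure.
\<close>

proposition borel_subset_sets_hausdorff:
  "sets (borel :: 'a::metric_space measure) \<subseteq> sets (hausdorff_measure m)"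
proof -
  have sp: "space (hausdorff_measure m :: 'a measure) = UNIV"
    unfolding hausdorff_measure_def by (subst space_measure_of) auto
  have "sigma_sets UNIV (Collect closed) \<subseteq> sets (hausdorff_measure m :: 'a measure)"
    using closed_in_sets_hausdorff sp by (metis mem_Collect_eq sets.sigma_sets_subset subsetI)
  then show ?thesis
    by (simp add: borel_eq_closed)
qed

section \<open>Lebesgue measure of projections and Fubini for two coordinates\<close>

text \<open>
  A set of diameter \<open>d\<close> projects into a cube of side \<open>2d\<close>, whose volume is a fixed multiple of the
  gauge of the set. Using cubes instead of the isodiametric inequality loses the optimal constant \<open>1\<close>.
\<close>

lemma emeasure_projection_le_hausdorff:
  fixes A :: "'a::euclidean_space set"
  assumes J: "J \<subseteq> Basis" and Y: "Y \<in> sets (\<Pi>\<^sub>M b\<in>J. lborel)"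
    and sub: "Y \<subseteq> (\<lambda>x. \<lambda>b\<in>J. x \<bullet> b) ` A"
  shows "ennreal (unit_ball_vol (card J) / 4 ^ card J) * emeasure (\<Pi>\<^sub>M b\<in>J. lborel) Y
    \<le> hausdorff_outer (card J) A"
proof -
  interpret product_sigma_finite "\<lambda>_. lborel :: real measure" ..
  have finJ: "finite J" by (rule finite_subset[OF J finite_Basis])
  let ?P = "\<lambda>x. \<lambda>b\<in>J. x \<bullet> b" and ?m = "card J"
  define \<kappa> where "\<kappa> = unit_ball_vol (real ?m) / 4 ^ ?m"
  have \<kappa>: "\<kappa> \<ge> 0" by (simp add: \<kappa>_def)
  define p where "p S = (SOME x. x \<in> S)" for S :: "'a set"
  define Box where "Box S = (if S = {} then {} else
      (\<Pi>\<^sub>E b\<in>J. {p S \<bullet> b - diameter S .. p S \<bullet> b + diameter S}))" for S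
  have Box_sets [measurable]: "Box S \<in> sets (\<Pi>\<^sub>M b\<in>J. lborel)" for S
    using finJ by (auto simp: Box_def intro!: sets_PiM_I_finite)
  have vol: "ennreal \<kappa> * emeasure (\<Pi>\<^sub>M b\<in>J. lborel) (Box S) = hausdorff_gauge ?m S" if "bounded S" for S
  proof (cases "S = {}")
    case False
    have "emeasure (\<Pi>\<^sub>M b\<in>J. lborel) (Box S) = (\<Prod>b\<in>J. ennreal (2 * diameter S))"
      using False finJ diameter_ge_0[OF that] by (simp add: Box_def emeasure_PiM)
    also have "\<dots> = ennreal ((2 * diameter S) ^ ?m)"
      using diameter_ge_0[OF that] by (simp add: ennreal_power)
    also have "ennreal \<kappa> * \<dots> = ennreal (\<kappa> * (2 * diameter S) ^ ?m)"
      using \<kappa> by (simp add: ennreal_mult' )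
    also have "\<kappa> * (2 * diameter S) ^ ?m = unit_ball_vol ?m * (diameter S / 2) ^ ?m"
    proof -
      have "(diameter S / 2) ^ ?m = (2 * diameter S / 4) ^ ?m" by simp
      also have "\<dots> = (2 * diameter S) ^ ?m / 4 ^ ?m" by (rule power_divide)
      finally show ?thesis by (simp add: \<kappa>_def)
    qed
    finally show ?thesis using False by (simp add: hausdorff_gauge_def)
  qed (simp add: Box_def hausdorff_gauge_def)
  have proj: "?P x \<in> Box S" if "x \<in> S" "bounded S" for x S
  proof -
    have "p S \<in> S" unfolding p_def using that by (intro someI)
    then have "dist x (p S) \<le> diameter S"
      using that by (intro diameter_bounded_bound)
    then have "\<bar>x \<bullet> b - p S \<bullet> b\<bar> \<le> diameter S" if "b \<in> J" for b
      using Basis_le_norm[of b "x - p S"] that J by (auto simp: dist_norm inner_diff_left)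
    then have "x \<bullet> b \<in> {p S \<bullet> b - diameter S .. p S \<bullet> b + diameter S}" if "b \<in> J" for b
      using that by (force simp: abs_le_iff)
    then show ?thesis using that by (auto simp: Box_def)
  qed
  have "ennreal \<kappa> * emeasure (\<Pi>\<^sub>M b\<in>J. lborel) Y \<le> hausdorff_content ?m 1 A"
    unfolding hausdorff_content_def
  proof (rule INF_greatest)
    fix C assume C: "C \<in> hausdorff_covers 1 A"
    then have bdd: "bounded (C i)" and cov: "A \<subseteq> (\<Union>i. C i)" for i
      by (auto simp: hausdorff_covers_def)
    have "Y \<subseteq> (\<Union>i. Box (C i))"
    proof
      fix y assume "y \<in> Y"
      with sub obtain x where x: "x \<in> A" "y = ?P x" by blast
      with cov obtain i where "x \<in> C i" by blast
      with proj[OF this bdd] x show "y \<in> (\<Union>i. Box (C i))" by blast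
    qed
    then have "emeasure (\<Pi>\<^sub>M b\<in>J. lborel) Y \<le> emeasure (\<Pi>\<^sub>M b\<in>J. lborel) (\<Union>i. Box (C i))"
      by (intro emeasure_mono) auto
    also have "\<dots> \<le> (\<Sum>i. emeasure (\<Pi>\<^sub>M b\<in>J. lborel) (Box (C i)))"
      by (intro emeasure_subadditive_countably) auto
    finally have "ennreal \<kappa> * emeasure (\<Pi>\<^sub>M b\<in>J. lborel) Y
        \<le> ennreal \<kappa> * (\<Sum>i. emeasure (\<Pi>\<^sub>M b\<in>J. lborel) (Box (C i)))"
      by (rule mult_left_mono) simp
    also have "\<dots> = (\<Sum>i. hausdorff_gauge ?m (C i))"
      using vol[OF bdd] by (simp flip: ennreal_suminf_cmult)
    finally show "ennreal \<kappa> * emeasure (\<Pi>\<^sub>M b\<in>J. lborel) Y \<le> (\<Sum>i. hausdorff_gauge ?m (C i))" .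
  qed
  also have "\<dots> \<le> hausdorff_outer ?m A"
    unfolding hausdorff_outer_def by (rule SUP_upper) simp
  finally show ?thesis by (simp add: \<kappa>_def)
qed

text \<open>
  The point with coordinates \<open>t\<close> in the plane of the two basis vectors \<open>b\<close> and \<open>c\<close>, and \<open>w\<close> in the
  remaining directions.
\<close>

definition assemble :: "'a::euclidean_space \<Rightarrow> 'a \<Rightarrow> real \<times> real \<Rightarrow> ('a \<Rightarrow> real) \<Rightarrow> 'a" where
  "assemble b c t w = fst t *\<^sub>R b + snd t *\<^sub>R c + (\<Sum>e\<in>Basis - {b, c}. w e *\<^sub>R e)"

lemma measurable_assemble [measurable]:
  "(\<lambda>(t, w). assemble b c t w) \<in> borel_measurable (lborel \<Otimes>\<^sub>M (\<Pi>\<^sub>M e\<in>Basis - {b, c}. lborel))"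
proof -
  have "(\<lambda>x. snd x e) \<in> borel_measurable ((lborel :: (real \<times> real) measure) \<Otimes>\<^sub>M (\<Pi>\<^sub>M e\<in>Basis - {b, c}. lborel))"
    if "e \<in> Basis - {b, c}" for e
    using that by measurable
  moreover have "fst \<in> borel_measurable (borel :: (real \<times> real) measure)"
    "snd \<in> borel_measurable (borel :: (real \<times> real) measure)"
    by (auto intro!: borel_measurable_continuous_onI continuous_intros)
  ultimately show ?thesis
    unfolding assemble_def case_prod_beta
    by (intro borel_measurable_add borel_measurable_sum borel_measurable_scaleR) (auto intro!: measurable_compose[OF measurable_fst])
qed

lemma nn_integral_lborel_assemble:
  fixes F :: "'a::euclidean_space \<Rightarrow> ennreal"
  assumes F [measurable]: "F \<in> borel_measurable borel"
    and bc: "b \<in> Basis" "c \<in> Basis" "b \<noteq> c"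
  defines "W \<equiv> \<Pi>\<^sub>M e\<in>Basis - {b, c}. (lborel :: real measure)"
  shows "(\<integral>\<^sup>+x. F x \<partial>lborel) = (\<integral>\<^sup>+w. \<integral>\<^sup>+t. F (assemble b c t w) \<partial>lborel \<partial>W)"
    and "(\<integral>\<^sup>+x. F x \<partial>lborel) = (\<integral>\<^sup>+t. \<integral>\<^sup>+w. F (assemble b c t w) \<partial>W \<partial>lborel)"
proof -
  interpret product_sigma_finite "\<lambda>_. lborel :: real measure" ..
  let ?J = "Basis - {b, c}"
  interpret W: sigma_finite_measure W
    unfolding W_def by (rule sigma_finite) simp
  interpret P: pair_sigma_finite "lborel :: (real \<times> real) measure" W ..
  let ?S = "\<lambda>f. \<Sum>e\<in>Basis. f e *\<^sub>R e :: 'a"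
  have B: "Basis = insert b (insert c ?J)" using bc by auto
  have S [measurable]: "?S \<in> borel_measurable (\<Pi>\<^sub>M e\<in>Basis. lborel)" by simp
  have ins: "?S (w(c := t2, b := t1)) = assemble b c (t1, t2) w" for w t1 t2
  proof -
    have "?S (w(c := t2, b := t1)) = (\<Sum>e\<in>insert b (insert c ?J). (w(c := t2, b := t1)) e *\<^sub>R e)"
      using B by simp
    also have "\<dots> = t1 *\<^sub>R b + (t2 *\<^sub>R c + (\<Sum>e\<in>?J. (w(c := t2, b := t1)) e *\<^sub>R e))"
      using bc by (simp add: sum.insert)
    also have "(\<Sum>e\<in>?J. (w(c := t2, b := t1)) e *\<^sub>R e) = (\<Sum>e\<in>?J. w e *\<^sub>R e)"
      by (intro sum.cong) auto
    finally show ?thesis by (simp only: assemble_def add.assoc fst_conv snd_conv)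
  qed
  have m1 [measurable]: "(\<lambda>f. F (?S f)) \<in> borel_measurable (\<Pi>\<^sub>M e\<in>insert b (insert c ?J). lborel)"
    unfolding B[symmetric] by measurable
  have "(\<integral>\<^sup>+x. F x \<partial>lborel) = (\<integral>\<^sup>+f. F (?S f) \<partial>(\<Pi>\<^sub>M e\<in>Basis. lborel))"
    by (subst lborel_eq) (simp add: nn_integral_distr)
  also have "\<dots> = (\<integral>\<^sup>+f. F (?S f) \<partial>(\<Pi>\<^sub>M e\<in>insert b (insert c ?J). lborel))"
    using B by simp
  also have "\<dots> = (\<integral>\<^sup>+f. \<integral>\<^sup>+t1. F (?S (f(b := t1))) \<partial>lborel \<partial>(\<Pi>\<^sub>M e\<in>insert c ?J. lborel))"
    using bc by (intro product_nn_integral_insert m1) auto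
  also have "\<dots> = (\<integral>\<^sup>+w. \<integral>\<^sup>+t2. \<integral>\<^sup>+t1. F (?S (w(c := t2, b := t1))) \<partial>lborel \<partial>lborel \<partial>(\<Pi>\<^sub>M e\<in>?J. lborel))"
  proof (intro product_nn_integral_insert lborel.borel_measurable_nn_integral)
    have "(\<lambda>(f, y). f(b := y)) \<in> (\<Pi>\<^sub>M e\<in>insert c ?J. lborel) \<Otimes>\<^sub>M lborel \<rightarrow>\<^sub>M (\<Pi>\<^sub>M e\<in>insert b (insert c ?J). lborel)"
      by (rule measurable_add_dim)
    from measurable_compose[OF this m1]
    show "(\<lambda>(f, y). F (?S (f(b := y)))) \<in> borel_measurable ((\<Pi>\<^sub>M e\<in>insert c ?J. lborel) \<Otimes>\<^sub>M lborel)"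
      by (simp add: case_prod_beta')
  qed auto
  also have "\<dots> = (\<integral>\<^sup>+w. \<integral>\<^sup>+t2. \<integral>\<^sup>+t1. F (assemble b c (t1, t2) w) \<partial>lborel \<partial>lborel \<partial>W)"
    unfolding ins W_def ..
  also have "\<dots> = (\<integral>\<^sup>+w. \<integral>\<^sup>+t. F (assemble b c t w) \<partial>lborel \<partial>W)"
  proof (intro nn_integral_cong)
    fix w
    have "(\<lambda>t. assemble b c t w) \<in> borel_measurable borel"
      unfolding assemble_def by (intro borel_measurable_continuous_onI continuous_intros)
    from measurable_compose[OF this F]
    have [measurable]: "(\<lambda>t. F (assemble b c t w)) \<in> borel_measurable borel" .
    show "(\<integral>\<^sup>+t2. \<integral>\<^sup>+t1. F (assemble b c (t1, t2) w) \<partial>lborel \<partial>lborel)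
        = (\<integral>\<^sup>+t. F (assemble b c t w) \<partial>lborel)"
      by (subst lborel_prod[symmetric], rule lborel_pair.nn_integral_snd)
         (simp add: lborel_prod)
  qed
  finally show 1: "(\<integral>\<^sup>+x. F x \<partial>lborel) = (\<integral>\<^sup>+w. \<integral>\<^sup>+t. F (assemble b c t w) \<partial>lborel \<partial>W)" .
  have "(\<lambda>(t, w). F (assemble b c t w)) \<in> borel_measurable (lborel \<Otimes>\<^sub>M W)"
    using measurable_compose[OF measurable_assemble[of b c] F] by (simp add: W_def case_prod_beta')
  from P.Fubini[OF this] 1
  show "(\<integral>\<^sup>+x. F x \<partial>lborel) = (\<integral>\<^sup>+t. \<integral>\<^sup>+w. F (assemble b c t w) \<partial>W \<partial>lborel)"
    by simp
qed

section \<open>Replacing two coordinates by two functions\<close>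

text \<open>
  The change of variables theorem is about absolutely integrable functions. This dictionary turns it into
  an identity between nonnegative integrals that covers the value \<open>\<infinity>\<close> as well.
\<close>

lemma nn_integral_nonneg_on:
  fixes w :: "'a::euclidean_space \<Rightarrow> real"
  assumes [measurable]: "(\<lambda>x. indicator A x * w x) \<in> borel_measurable borel"
    and nn: "\<And>x. x \<in> A \<Longrightarrow> 0 \<le> w x"
  shows "(\<integral>\<^sup>+x. ennreal (indicator A x * w x) \<partial>lborel)
    = (if w absolutely_integrable_on A then ennreal (integral A w) else \<infinity>)"
proof -
  have nn': "0 \<le> indicator A x * w x" for x using nn by (auto simp: indicator_def)
  have iff: "w absolutely_integrable_on A \<longleftrightarrow> integrable lborel (\<lambda>x. indicator A x * w x)"
    unfolding set_integrable_def by (simp add: integrable_completion)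
  show ?thesis
  proof (cases "w absolutely_integrable_on A")
    case True
    then have "integral A w = (LINT x:A|lebesgue. w x)"
      by (simp add: set_lebesgue_integral_eq_integral(2))
    also have "\<dots> = (LINT x|lborel. indicator A x * w x)"
      unfolding set_lebesgue_integral_def by (simp add: integral_completion)
    finally show ?thesis
      using True iff nn' by (simp add: nn_integral_eq_integral)
  next
    case False
    then have "\<not> (\<integral>\<^sup>+x. ennreal (indicator A x * w x) \<partial>lborel) < \<infinity>"
      using iff nn' by (auto intro: integrableI_nonneg)
    with False show ?thesis by (simp add: not_less top_unique)
  qed
qed

text \<open>
  The change of variables theorem is stated for \<open>real ^ 2\<close>, whereas the pairs \<open>(t\<^sub>1, t\<^sub>2)\<close> of times
  live in \<open>real \<times> real\<close>.
\<close>

definition vec2 :: "real \<times> real \<Rightarrow> real ^ 2" where "vec2 p = vector [fst p, snd p]"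
definition unvec2 :: "real ^ 2 \<Rightarrow> real \<times> real" where "unvec2 v = (v $ 1, v $ 2)"

lemma vec2_inverse [simp]: "unvec2 (vec2 p) = p" "vec2 (unvec2 v) = v"
  by (simp_all add: vec2_def unvec2_def vec_eq_iff forall_2)

lemma vec2_image: "vec2 ` S = unvec2 -` S"
  by auto (metis image_eqI vec2_inverse(2))

lemma bounded_linear_vec2: "bounded_linear vec2"
  by (auto simp: vec2_def linear_iff vec_eq_iff forall_2 intro!: linear_conv_bounded_linear[THEN iffD1])

lemma bounded_linear_unvec2: "bounded_linear unvec2"
  by (auto simp: unvec2_def linear_iff intro!: linear_conv_bounded_linear[THEN iffD1])

lemma measurable_vec2 [measurable]: "vec2 \<in> borel_measurable borel" "unvec2 \<in> borel_measurable borel"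
  by (auto intro!: borel_measurable_continuous_onI linear_continuous_on
      bounded_linear_vec2 bounded_linear_unvec2)

lemma nn_integral_vec2:
  assumes F [measurable]: "F \<in> borel_measurable borel"
  shows "(\<integral>\<^sup>+v. F v \<partial>lborel) = (\<integral>\<^sup>+p. F (vec2 p) \<partial>lborel)"
proof -
  let ?b = "axis 1 1 :: real ^ 2" and ?c = "axis 2 1 :: real ^ 2"
  have B: "Basis = {?b, ?c}" by (auto simp: Basis_vec_def UNIV_2)
  have "?b \<noteq> ?c" by (simp add: axis_eq_axis)
  moreover have "assemble ?b ?c p w = vec2 p" for p w
    using B by (simp add: assemble_def vec2_def vec_eq_iff forall_2 axis_def)
  ultimately show ?thesis
    using nn_integral_lborel_assemble(2)[OF F, of ?b ?c] B
    by (simp add: space_PiM_empty)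
qed

lemma nn_integral_change_of_variables_plane:
  fixes g :: "real \<times> real \<Rightarrow> real \<times> real" and f :: "real \<times> real \<Rightarrow> real"
  assumes S [measurable]: "S \<in> sets borel"
    and der: "\<And>x. x \<in> S \<Longrightarrow> (g has_derivative (\<lambda>h. (h \<bullet> p x, h \<bullet> q x))) (at x within S)"
    and inj: "inj_on g S" and nn: "\<And>y. 0 \<le> f y"
  defines "J \<equiv> \<lambda>x. fst (p x) * snd (q x) - snd (p x) * fst (q x)"
  assumes meas1: "(\<lambda>x. indicator S x * (\<bar>J x\<bar> * f (g x))) \<in> borel_measurable borel"
    and meas2: "(\<lambda>y. indicator (g ` S) y * f y) \<in> borel_measurable borel"
  shows "(\<integral>\<^sup>+x. ennreal (indicator S x * (\<bar>J x\<bar> * f (g x))) \<partial>lborel)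
       = (\<integral>\<^sup>+y. ennreal (indicator (g ` S) y * f y) \<partial>lborel)"
proof -
  define h where "h = vec2 \<circ> g \<circ> unvec2"
  define h' where "h' v = (\<lambda>k. vec2 (unvec2 k \<bullet> p (unvec2 v), unvec2 k \<bullet> q (unvec2 v)))" for v
  let ?U = "vec2 ` S"
  note U = vec2_image[of S]
  have U_sets: "?U \<in> sets borel"
    unfolding U using measurable_sets[OF measurable_vec2(2) S] by simp
  have hU: "h ` ?U = vec2 ` g ` S" by (auto simp: h_def image_image)
  note gSU = vec2_image[of "g ` S"]
  have ders: "(h has_derivative h' v) (at v within ?U)" if "v \<in> ?U" for v
  proof -
    have uv: "unvec2 v \<in> S" using that by auto
    have "(unvec2 has_derivative unvec2) (at v within ?U)"
      by (rule bounded_linear_imp_has_derivative[OF bounded_linear_unvec2])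
    moreover have "(g has_derivative (\<lambda>h. (h \<bullet> p (unvec2 v), h \<bullet> q (unvec2 v)))) (at (unvec2 v) within unvec2 ` ?U)"
      using der[OF uv] by (simp add: image_image)
    ultimately have "((g \<circ> unvec2) has_derivative
        ((\<lambda>h. (h \<bullet> p (unvec2 v), h \<bullet> q (unvec2 v))) \<circ> unvec2)) (at v within ?U)"
      by (rule diff_chain_within)
    from bounded_linear.has_derivative[OF bounded_linear_vec2 this]
    show ?thesis by (simp add: h_def h'_def o_def)
  qed
  have injU: "inj_on h ?U"
    using inj by (auto simp: inj_on_def h_def) (metis vec2_inverse(1))
  have detJ: "det (matrix (h' v)) = J (unvec2 v)" for v
    by (simp add: det_2 matrix_def h'_def vec2_def unvec2_def axis_def J_def inner_prod_def)
  let ?f = "\<lambda>v. f (unvec2 v)"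
  have key: "(\<lambda>v. \<bar>J (unvec2 v)\<bar> * ?f (h v)) absolutely_integrable_on ?U \<and>
           integral ?U (\<lambda>v. \<bar>J (unvec2 v)\<bar> * ?f (h v)) = r
     \<longleftrightarrow> ?f absolutely_integrable_on (h ` ?U) \<and> integral (h ` ?U) ?f = r" for r
  proof -
    have "(\<lambda>v. \<bar>det (matrix (h' v))\<bar> *\<^sub>R (vec (?f (h v)) :: real ^ 1)) absolutely_integrable_on ?U \<and>
           integral ?U (\<lambda>v. \<bar>det (matrix (h' v))\<bar> *\<^sub>R (vec (?f (h v)) :: real ^ 1)) = vec r
     \<longleftrightarrow> (\<lambda>v. vec (?f v) :: real ^ 1) absolutely_integrable_on (h ` ?U)
         \<and> integral (h ` ?U) (\<lambda>v. vec (?f v) :: real ^ 1) = vec r"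
      using U_sets by (intro has_absolute_integral_change_of_variables ders injU) auto
    then show ?thesis
      by (simp add: absolutely_integrable_on_1_iff integral_on_1_eq detJ)
  qed
  have m1: "(\<lambda>v. indicator ?U v * (\<bar>J (unvec2 v)\<bar> * ?f (h v))) \<in> borel_measurable borel"
  proof -
    have "(\<lambda>v. indicator ?U v * (\<bar>J (unvec2 v)\<bar> * ?f (h v)))
        = (\<lambda>x. indicator S x * (\<bar>J x\<bar> * f (g x))) \<circ> unvec2"
      by (auto simp: U h_def indicator_def)
    then show ?thesis using measurable_comp[OF measurable_vec2(2) meas1] by simp
  qed
  have m2: "(\<lambda>v. indicator (h ` ?U) v * ?f v) \<in> borel_measurable borel"
  proof -
    have "(\<lambda>v. indicator (h ` ?U) v * ?f v) = (\<lambda>y. indicator (g ` S) y * f y) \<circ> unvec2"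
      unfolding hU gSU by (auto simp: indicator_def)
    then show ?thesis using measurable_comp[OF measurable_vec2(2) meas2] by simp
  qed
  have "(\<integral>\<^sup>+x. ennreal (indicator S x * (\<bar>J x\<bar> * f (g x))) \<partial>lborel)
      = (\<integral>\<^sup>+v. ennreal (indicator ?U v * (\<bar>J (unvec2 v)\<bar> * ?f (h v))) \<partial>lborel)"
    using m1 by (subst nn_integral_vec2) (auto simp: h_def U indicator_def)
  also have "\<dots> = (\<integral>\<^sup>+v. ennreal (indicator (h ` ?U) v * ?f v) \<partial>lborel)"
  proof -
    have "(\<integral>\<^sup>+v. ennreal (indicator ?U v * (\<bar>J (unvec2 v)\<bar> * ?f (h v))) \<partial>lborel)
      = (if (\<lambda>v. \<bar>J (unvec2 v)\<bar> * ?f (h v)) absolutely_integrable_on ?U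
         then ennreal (integral ?U (\<lambda>v. \<bar>J (unvec2 v)\<bar> * ?f (h v))) else \<infinity>)"
      by (rule nn_integral_nonneg_on[OF m1]) (simp add: nn)
    moreover have "(\<integral>\<^sup>+v. ennreal (indicator (h ` ?U) v * ?f v) \<partial>lborel)
      = (if ?f absolutely_integrable_on (h ` ?U) then ennreal (integral (h ` ?U) ?f) else \<infinity>)"
      by (rule nn_integral_nonneg_on[OF m2]) (simp add: nn)
    ultimately show ?thesis
      using key[of "integral ?U (\<lambda>v. \<bar>J (unvec2 v)\<bar> * ?f (h v))"] key[of "integral (h ` ?U) ?f"]
      by presburger
  qed
  also have "\<dots> = (\<integral>\<^sup>+y. ennreal (indicator (g ` S) y * f y) \<partial>lborel)"
    using m2 by (subst nn_integral_vec2) (auto simp: hU gSU indicator_def)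
  finally show ?thesis .
qed

lemma assemble_inner:
  assumes "b \<in> Basis" "c \<in> Basis" "b \<noteq> c"
  shows "assemble b c t w \<bullet> b = fst t" "assemble b c t w \<bullet> c = snd t"
    "e \<in> Basis - {b, c} \<Longrightarrow> assemble b c t w \<bullet> e = w e"
  using assms
  by (auto simp: assemble_def inner_add_left inner_sum_left inner_Basis sum.delta' if_distrib cong: if_cong)

lemma assemble_add: "assemble b c (fst t + x, snd t + y) w = assemble b c t w + x *\<^sub>R b + y *\<^sub>R c"
  by (simp add: assemble_def algebra_simps)

text \<open>
  The map \<open>\<Phi>\<close> replaces the coordinates of \<open>x\<close> along \<open>b\<close> and \<open>c\<close> by \<open>T1 x\<close> and \<open>T2 x\<close> and keeps the
  others, so its Jacobian is the minor \<open>J\<close>. On the plane through fixed remaining coordinates \<open>w\<close> it is a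
  map between plane sets, to which the change of variables theorem applies. Fubini's theorem then gives the
  integral over \<open>B\<close> as an integral over \<open>t\<close> of \<open>h t\<close>, where \<open>h t\<close> is an integral over the projections
  \<open>w\<close> of the points of the fibre \<open>(T1, T2) = t\<close>. Transporting Lebesgue measure in \<open>w\<close> to the fibre gives a
  measure that is at most a multiple of the Hausdorff measure, by
  \<open>emeasure_projection_le_hausdorff\<close>.
\<close>

lemma coarea_inequality_two_coordinates:
  fixes T1 T2 :: "'a::euclidean_space \<Rightarrow> real" and p q :: "'a \<Rightarrow> 'a" and f :: "'a \<Rightarrow> real"
  assumes bc: "b \<in> Basis" "c \<in> Basis" "b \<noteq> c" and D: "compact D"
    and der: "\<And>x. x \<in> D \<Longrightarrow> GDERIV T1 x :> p x" "\<And>x. x \<in> D \<Longrightarrow> GDERIV T2 x :> q x"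
    and cont: "continuous_on D p" "continuous_on D q"
  defines "J \<equiv> \<lambda>x. (p x \<bullet> b) * (q x \<bullet> c) - (p x \<bullet> c) * (q x \<bullet> b)"
    and "\<Phi> \<equiv> \<lambda>x. x + (T1 x - x \<bullet> b) *\<^sub>R b + (T2 x - x \<bullet> c) *\<^sub>R c"
  assumes J: "\<And>x. x \<in> D \<Longrightarrow> J x \<noteq> 0" and inj: "inj_on \<Phi> D"
    and B [measurable]: "B \<in> sets borel" and BD: "B \<subseteq> D"
    and f [measurable]: "f \<in> borel_measurable borel" and fnn: "\<And>x. 0 \<le> f x"
  shows "\<exists>h\<in>borel_measurable borel.
    (\<integral>\<^sup>+x\<in>B. ennreal (f x) \<partial>lborel) = (\<integral>\<^sup>+t. h t \<partial>lborel) \<and>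
    (\<forall>t. ennreal (unit_ball_vol (DIM('a) - 2) / 4 ^ (DIM('a) - 2)) * h t
      \<le> (\<integral>\<^sup>+x\<in>{x \<in> B. (T1 x, T2 x) = t}. ennreal (f x / \<bar>J x\<bar>) \<partial>hausdorff_measure (DIM('a) - 2)))"
proof -
  let ?J = "Basis - {b, c}" and ?m = "DIM('a) - 2"
  define W where "W = (\<Pi>\<^sub>M e\<in>?J. (lborel :: real measure))"
  interpret product_sigma_finite "\<lambda>_. lborel :: real measure" ..
  interpret W: sigma_finite_measure W
    unfolding W_def by (rule sigma_finite) simp
  let ?A = "assemble b c"
  have cardJ: "card ?J = ?m" using bc by (simp add: card_Diff_subset)
  have T_cont: "continuous_on D T1" "continuous_on D T2"
    using der by (auto simp: gderiv_def intro!: continuous_at_imp_continuous_on dest: has_derivative_continuous)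
  have \<Phi>_cont: "continuous_on D \<Phi>"
    unfolding \<Phi>_def by (intro continuous_intros T_cont)
  have \<Phi>_inner: "\<Phi> x \<bullet> b = T1 x" "\<Phi> x \<bullet> c = T2 x" "e \<in> ?J \<Longrightarrow> \<Phi> x \<bullet> e = x \<bullet> e" for x e
    using bc by (auto simp: \<Phi>_def inner_add_left inner_Basis)
  have Dm [measurable]: "D \<in> sets borel" and \<Phi>D [measurable]: "\<Phi> ` D \<in> sets borel"
    using D compact_continuous_image[OF \<Phi>_cont D] by (auto intro: borel_compact)
  \<comment> \<open>the inverse of \<open>\<Phi>\<close>, continuous since \<open>D\<close> is compact; the value \<open>0\<close> elsewhere only
    makes it a total Borel function\<close>
  define \<Psi> where "\<Psi> z = (if z \<in> \<Phi> ` D then inv_into D \<Phi> z else 0)" for z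
  have \<Psi>_\<Phi>: "\<Psi> (\<Phi> x) = x" if "x \<in> D" for x
    using that inj by (simp add: \<Psi>_def)
  have "continuous_on (\<Phi> ` D) (inv_into D \<Phi>)"
    using \<Phi>_cont D inj by (intro continuous_on_inv) auto
  then have \<Psi> [measurable]: "\<Psi> \<in> borel_measurable borel"
    unfolding \<Psi>_def by (intro borel_measurable_continuous_on_if) auto
  have \<Phi>B_eq: "\<Phi> ` B = \<Phi> ` D \<inter> (\<Psi> -` B \<inter> space borel)"
    using BD \<Psi>_\<Phi> by (auto simp: subset_eq)
  have \<Phi>B [measurable]: "\<Phi> ` B \<in> sets borel"
    unfolding \<Phi>B_eq by (intro sets.Int \<Phi>D measurable_sets[OF \<Psi> B])
  define J' where "J' x = (if x \<in> D then J x else 1)" for x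
  have J' [measurable]: "J' \<in> borel_measurable borel"
    unfolding J'_def J_def
    by (intro borel_measurable_continuous_on_if) (auto intro!: continuous_intros cont)
  \<comment> \<open>the density on the image side, so that the change of variables turns \<open>f\<close> on \<open>B\<close> into \<open>F\<close>\<close>
  define F where "F z = indicator (\<Phi> ` B) z * (f (\<Psi> z) / \<bar>J' (\<Psi> z)\<bar>)" for z
  have F [measurable]: "F \<in> borel_measurable borel"
    unfolding F_def by measurable
  have Fnn: "0 \<le> F z" for z by (simp add: F_def fnn)
  have F\<Phi>: "\<bar>J x\<bar> * F (\<Phi> x) = f x" if "x \<in> B" for x
    using that BD J by (auto simp: F_def \<Psi>_\<Phi> J'_def subset_eq)
  have A_cont: "continuous_on X (\<lambda>t. ?A t w)" for w X
    unfolding assemble_def by (intro continuous_intros)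
  have A_meas [measurable]: "(\<lambda>t. ?A t w) \<in> borel_measurable borel" for w
    by (intro borel_measurable_continuous_onI A_cont)
  have pair: "(\<lambda>(t, w). F (?A t w)) \<in> borel_measurable (lborel \<Otimes>\<^sub>M W)"
    using measurable_compose[OF measurable_assemble[of b c] F] by (simp add: W_def case_prod_beta')
  define h where "h t = (\<integral>\<^sup>+w. ennreal (F (?A t w)) \<partial>W)" for t
  have "(\<lambda>t. \<integral>\<^sup>+w. ennreal (F (?A t w)) \<partial>W) \<in> borel_measurable lborel"
    by (rule W.borel_measurable_nn_integral)
      (use measurable_compose[OF pair measurable_ennreal] in \<open>simp add: case_prod_beta'\<close>)
  then have h: "h \<in> borel_measurable borel" by (simp add: h_def[abs_def])

  have slice: "(\<integral>\<^sup>+s. ennreal (indicator B (?A s w) * f (?A s w)) \<partial>lborel)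
      = (\<integral>\<^sup>+t. ennreal (F (?A t w)) \<partial>lborel)" for w
  proof -
    define S where "S = {s. ?A s w \<in> B}"
    have S: "S \<in> sets borel"
      using measurable_sets[OF A_meas[of w] B] by (simp add: S_def vimage_def)
    define g where "g s = (T1 (?A s w), T2 (?A s w))" for s
    have \<Phi>g: "\<Phi> (?A s w) = ?A (g s) w" for s
    proof -
      have "\<Phi> (?A s w) = ?A (fst s + (T1 (?A s w) - fst s), snd s + (T2 (?A s w) - snd s)) w"
        unfolding \<Phi>_def assemble_add by (simp add: assemble_inner bc)
      then show ?thesis by (simp add: g_def)
    qed
    have injg: "inj_on g S"
    proof (rule inj_onI)
      fix s s' assume s: "s \<in> S" "s' \<in> S" "g s = g s'"
      then have "\<Phi> (?A s w) = \<Phi> (?A s' w)" by (simp add: \<Phi>g)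
      with s inj BD have "?A s w = ?A s' w" by (auto simp: S_def dest: inj_onD)
      then show "s = s'" using assemble_inner(1,2)[OF bc] by (metis prod_eqI)
    qed
    let ?p = "\<lambda>s. (p (?A s w) \<bullet> b, p (?A s w) \<bullet> c)" and ?q = "\<lambda>s. (q (?A s w) \<bullet> b, q (?A s w) \<bullet> c)"
    have derg: "(g has_derivative (\<lambda>h. (h \<bullet> ?p s, h \<bullet> ?q s))) (at s within S)" if "s \<in> S" for s
    proof -
      have sD: "?A s w \<in> D" using that BD by (auto simp: S_def)
      have dA: "((\<lambda>s. ?A s w) has_derivative (\<lambda>h. fst h *\<^sub>R b + snd h *\<^sub>R c)) (at s within S)"
        unfolding assemble_def by (auto intro!: derivative_eq_intros)
      have "((\<lambda>s. T (?A s w)) has_derivative (\<lambda>h. h \<bullet> (r \<bullet> b, r \<bullet> c))) (at s within S)"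
        if "GDERIV T (?A s w) :> r" for T :: "'a \<Rightarrow> real" and r
        using has_derivative_compose[OF dA that[unfolded gderiv_def]]
        by (simp add: inner_add_left inner_add_right inner_prod_def inner_commute)
      from this[OF der(1)[OF sD]] this[OF der(2)[OF sD]]
      show ?thesis unfolding g_def by (rule has_derivative_Pair)
    qed
    have F_out: "F (?A t w) = indicator (g ` S) t * F (?A t w)" for t
    proof (cases "?A t w \<in> \<Phi> ` B")
      case True
      then obtain x where x: "x \<in> B" "\<Phi> x = ?A t w" by auto
      define s where "s = (fst t + - (T1 x - x \<bullet> b), snd t + - (T2 x - x \<bullet> c))"
      have "x = \<Phi> x + (- (T1 x - x \<bullet> b)) *\<^sub>R b + (- (T2 x - x \<bullet> c)) *\<^sub>R c"
        by (simp add: \<Phi>_def algebra_simps)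
      then have xs: "x = ?A s w"
        unfolding x(2) assemble_add[symmetric] s_def .
      have "g s = t"
        using \<Phi>_inner(1,2)[of x] x(2) by (simp add: g_def prod_eq_iff assemble_inner bc flip: xs)
      moreover have "s \<in> S" using x(1) xs by (simp add: S_def)
      ultimately show ?thesis by force
    qed (simp add: F_def)
    have lhs: "indicator S s * (\<bar>fst (?p s) * snd (?q s) - snd (?p s) * fst (?q s)\<bar> * F (?A (g s) w))
        = indicator B (?A s w) * f (?A s w)" for s
      using F\<Phi>[of "?A s w"] by (auto simp: \<Phi>g J_def S_def indicator_def)
    have m: "(\<lambda>t. F (?A t w)) \<in> borel_measurable borel" by measurable
    show ?thesis
      using nn_integral_change_of_variables_plane[of S g ?p ?q "\<lambda>t. F (?A t w)", OF S derg injg Fnn]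
      unfolding lhs F_out[symmetric] using m by simp
  qed

  have "(\<integral>\<^sup>+x\<in>B. ennreal (f x) \<partial>lborel) = (\<integral>\<^sup>+x. ennreal (indicator B x * f x) \<partial>lborel)"
    by (intro nn_integral_cong) (auto simp: indicator_def)
  also have "\<dots> = (\<integral>\<^sup>+w. \<integral>\<^sup>+s. ennreal (indicator B (?A s w) * f (?A s w)) \<partial>lborel \<partial>W)"
    unfolding W_def by (intro nn_integral_lborel_assemble(1) bc) measurable
  also have "\<dots> = (\<integral>\<^sup>+w. \<integral>\<^sup>+t. ennreal (F (?A t w)) \<partial>lborel \<partial>W)"
    unfolding slice ..
  also have "\<dots> = (\<integral>\<^sup>+z. ennreal (F z) \<partial>lborel)"
    unfolding W_def by (intro nn_integral_lborel_assemble(1)[symmetric] bc) measurable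
  also have "\<dots> = (\<integral>\<^sup>+t. h t \<partial>lborel)"
    unfolding h_def W_def by (intro nn_integral_lborel_assemble(2) bc) measurable
  finally have eq: "(\<integral>\<^sup>+x\<in>B. ennreal (f x) \<partial>lborel) = (\<integral>\<^sup>+t. h t \<partial>lborel)" .

  let ?H = "hausdorff_measure ?m :: 'a measure"
  have id: "(\<lambda>x. x) \<in> ?H \<rightarrow>\<^sub>M borel"
    using borel_subset_sets_hausdorff[of ?m, where 'a='a]
    by (auto simp: measurable_def hausdorff_measure_def)
  have bound: "ennreal (unit_ball_vol ?m / 4 ^ ?m) * h t
      \<le> (\<integral>\<^sup>+x\<in>{x \<in> B. (T1 x, T2 x) = t}. ennreal (f x / \<bar>J x\<bar>) \<partial>?H)" for t
  proof -
    define E where "E = {x \<in> B. (T1 x, T2 x) = t}"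
    have E [measurable]: "E \<in> sets borel"
    proof -
      have "closed {x \<in> D. T1 x = fst t}" "closed {x \<in> D. T2 x = snd t}"
        using continuous_closed_preimage_constant[OF T_cont(1) compact_imp_closed[OF D]]
          continuous_closed_preimage_constant[OF T_cont(2) compact_imp_closed[OF D]] by auto
      moreover have "E = B \<inter> {x \<in> D. T1 x = fst t} \<inter> {x \<in> D. T2 x = snd t}"
        using BD by (auto simp: E_def)
      ultimately show ?thesis by auto
    qed
    have At [measurable]: "(\<lambda>w. ?A t w) \<in> borel_measurable W"
      using measurable_Pair2[OF measurable_assemble[of b c], of t] by (simp add: W_def)
    define \<kappa> where "\<kappa> = ennreal (unit_ball_vol ?m / 4 ^ ?m)"
    \<comment> \<open>\<open>M2\<close> is the measure on the fibre that integrates \<open>f / |J|\<close> to \<open>h t\<close>, and \<open>N\<close> the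
      restriction of the Hausdorff measure to the fibre\<close>
    define M1 where "M1 = density W (\<lambda>w. indicator (\<Phi> ` B) (?A t w))"
    define M2 where "M2 = distr M1 borel (\<lambda>w. \<Psi> (?A t w))"
    define N where "N = density (distr ?H borel (\<lambda>x. x)) (indicator E)"
    let ?g = "\<lambda>x. ennreal (f x / \<bar>J' x\<bar>)"
    have "scale_measure \<kappa> M2 \<le> N"
    proof (subst le_measure)
      show "sets (scale_measure \<kappa> M2) = sets N" by (simp add: M2_def N_def)
      show "\<forall>X\<in>sets (scale_measure \<kappa> M2). emeasure (scale_measure \<kappa> M2) X \<le> emeasure N X"
      proof
        fix X assume "X \<in> sets (scale_measure \<kappa> M2)"
        then have X [measurable]: "X \<in> sets borel" by (simp add: M2_def)
        define Y where "Y = {w \<in> space W. ?A t w \<in> \<Phi> ` B \<and> \<Psi> (?A t w) \<in> X}"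
        have Y: "Y \<in> sets W" unfolding Y_def by measurable
        have "emeasure M2 X = emeasure M1 {w \<in> space W. \<Psi> (?A t w) \<in> X}"
          unfolding M2_def by (subst emeasure_distr)
            (auto simp: M1_def intro!: arg_cong2[where f=emeasure])
        also have "\<dots> = (\<integral>\<^sup>+w. indicator (\<Phi> ` B) (?A t w)
            * indicator {w \<in> space W. \<Psi> (?A t w) \<in> X} w \<partial>W)"
          unfolding M1_def by (rule emeasure_density) measurable
        also have "\<dots> = (\<integral>\<^sup>+w. indicator Y w \<partial>W)"
          by (intro nn_integral_cong) (auto simp: Y_def split: split_indicator)
        also have "\<dots> = emeasure W Y" using Y by simp
        finally have "emeasure (scale_measure \<kappa> M2) X = \<kappa> * emeasure W Y" by simp
        also have "\<dots> \<le> hausdorff_outer ?m (X \<inter> E)"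
        proof -
          have "Y \<subseteq> (\<lambda>x. \<lambda>e\<in>?J. x \<bullet> e) ` (X \<inter> E)"
          proof
            fix w assume w: "w \<in> Y"
            then obtain x where x: "x \<in> B" "\<Phi> x = ?A t w" by (auto simp: Y_def)
            have "x = \<Psi> (?A t w)" using x BD \<Psi>_\<Phi> by (metis subsetD)
            with w have "x \<in> X" by (simp add: Y_def)
            moreover have "x \<in> E"
              using x \<Phi>_inner(1,2)[of x] by (simp add: E_def assemble_inner bc prod_eq_iff)
            moreover have "w = (\<lambda>e\<in>?J. x \<bullet> e)"
            proof
              fix e
              show "w e = (\<lambda>e\<in>?J. x \<bullet> e) e"
              proof (cases "e \<in> ?J")
                case True
                then show ?thesis
                  using \<Phi>_inner(3)[OF True, of x] assemble_inner(3)[OF bc True, of t w] x(2) by simp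
              next
                case False
                then show ?thesis
                  using w by (auto simp: Y_def W_def space_PiM PiE_def extensional_def)
              qed
            qed
            ultimately show "w \<in> (\<lambda>x. \<lambda>e\<in>?J. x \<bullet> e) ` (X \<inter> E)" by blast
          qed
          from emeasure_projection_le_hausdorff[OF _ Y[unfolded W_def] this]
          show ?thesis by (simp add: cardJ \<kappa>_def W_def)
        qed
        also have "\<dots> = emeasure ?H (X \<inter> E)"
          using borel_subset_sets_hausdorff[of ?m, where 'a='a]
          by (subst emeasure_hausdorff_measure) auto
        also have "\<dots> = emeasure N X"
        proof -
          have "emeasure N X = (\<integral>\<^sup>+x. indicator E x * indicator X x \<partial>distr ?H borel (\<lambda>x. x))"
            unfolding N_def by (rule emeasure_density) auto
          also have "\<dots> = (\<integral>\<^sup>+x. indicator (X \<inter> E) x \<partial>distr ?H borel (\<lambda>x. x))"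
            by (intro nn_integral_cong) (auto split: split_indicator)
          also have "\<dots> = emeasure (distr ?H borel (\<lambda>x. x)) (X \<inter> E)" by simp
          also have "\<dots> = emeasure ?H (X \<inter> E)"
            by (subst emeasure_distr[OF id]) (auto simp: hausdorff_measure_def)
          finally show ?thesis by simp
        qed
        finally show "emeasure (scale_measure \<kappa> M2) X \<le> emeasure N X" .
      qed
    qed
    have "\<kappa> * h t = \<kappa> * (\<integral>\<^sup>+x. ?g x \<partial>M2)"
    proof -
      have "(\<integral>\<^sup>+x. ?g x \<partial>M2) = (\<integral>\<^sup>+w. indicator (\<Phi> ` B) (?A t w) * ?g (\<Psi> (?A t w)) \<partial>W)"
        unfolding M2_def by (subst nn_integral_distr) (auto simp: M1_def nn_integral_density)
      also have "\<dots> = h t"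
        unfolding h_def F_def by (intro nn_integral_cong) (auto simp: indicator_def)
      finally show ?thesis by simp
    qed
    also have "\<dots> = (\<integral>\<^sup>+x. ?g x \<partial>scale_measure \<kappa> M2)"
      by (subst nn_integral_scale_measure) (auto simp: M2_def)
    also have "\<dots> \<le> (\<integral>\<^sup>+x. ?g x \<partial>N)"
      by (intro nn_integral_mono_measure \<open>scale_measure \<kappa> M2 \<le> N\<close>) (simp add: M2_def N_def)
    also have "\<dots> = (\<integral>\<^sup>+x. indicator E x * ?g x \<partial>?H)"
      unfolding N_def by (subst nn_integral_density) (auto simp: nn_integral_distr[OF id])
    also have "\<dots> = (\<integral>\<^sup>+x\<in>E. ennreal (f x / \<bar>J x\<bar>) \<partial>?H)"
      using BD by (intro nn_integral_cong) (auto simp: indicator_def E_def J'_def)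
    finally show ?thesis by (simp add: \<kappa>_def E_def)
  qed
  from h eq bound show ?thesis by (intro bexI[of _ h] conjI allI)
qed

section \<open>A local coarea inequality for maps to the plane\<close>

text \<open>
  The Gram determinant of \<open>p\<close> and \<open>q\<close>; its square root is the factor in the coarea formula for a map to
  the plane with gradients \<open>p\<close> and \<open>q\<close>.
\<close>

definition gram :: "'a::real_inner \<Rightarrow> 'a \<Rightarrow> real" where
  "gram p q = (norm p)\<^sup>2 * (norm q)\<^sup>2 - (p \<bullet> q)\<^sup>2"

lemma gram_scaleR: "gram (r *\<^sub>R p) (s *\<^sub>R q) = (r * s)\<^sup>2 * gram p q"
  by (simp add: gram_def power_mult_distrib algebra_simps)

lemma gram_nonneg: "0 \<le> gram p q"
  using Cauchy_Schwarz_ineq[of p q] by (simp add: gram_def power2_norm_eq_inner)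

text \<open>
  Lagrange's identity; each unordered pair of coordinates is counted twice.
\<close>

lemma sum_minors_eq_gram:
  fixes p q :: "'a::euclidean_space"
  shows "(\<Sum>b\<in>Basis. \<Sum>c\<in>Basis. ((p \<bullet> b) * (q \<bullet> c) - (p \<bullet> c) * (q \<bullet> b))\<^sup>2) = 2 * gram p q"
proof -
  have n2: "(\<Sum>b\<in>Basis. (y \<bullet> b)\<^sup>2) = (norm y)\<^sup>2" for y :: 'a
    by (simp only: power2_norm_eq_inner) (simp add: euclidean_inner[of y y] power2_eq_square)
  have "(\<Sum>b\<in>Basis. \<Sum>c\<in>Basis. ((p \<bullet> b) * (q \<bullet> c) - (p \<bullet> c) * (q \<bullet> b))\<^sup>2)
    = (\<Sum>b\<in>Basis. \<Sum>c\<in>Basis. (p \<bullet> b)\<^sup>2 * (q \<bullet> c)\<^sup>2)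
    + (\<Sum>b\<in>Basis. \<Sum>c\<in>Basis. (q \<bullet> b)\<^sup>2 * (p \<bullet> c)\<^sup>2)
    - 2 * (\<Sum>b\<in>Basis. \<Sum>c\<in>Basis. ((p \<bullet> b) * (q \<bullet> b)) * ((p \<bullet> c) * (q \<bullet> c)))"
    by (simp add: power2_eq_square algebra_simps sum.distrib sum_subtractf sum_distrib_left)
  also have "\<dots> = 2 * ((\<Sum>b\<in>Basis. (p \<bullet> b)\<^sup>2) * (\<Sum>c\<in>Basis. (q \<bullet> c)\<^sup>2))
    - 2 * (\<Sum>b\<in>Basis. (p \<bullet> b) * (q \<bullet> b))\<^sup>2"
    by (simp add: power2_eq_square flip: sum_product) 
  also have "(\<Sum>b\<in>Basis. (p \<bullet> b) * (q \<bullet> b)) = p \<bullet> q"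
    by (rule euclidean_inner[symmetric])
  finally show ?thesis by (simp add: gram_def n2)
qed

text \<open>
  By Lagrange's identity not all of the \<open>DIM('a)\<^sup>2\<close> minors can be small compared to the Gram determinant.
  The strict inequality leaves room to keep it in a neighbourhood.
\<close>

lemma large_minor:
  fixes p q :: "'a::euclidean_space"
  assumes "gram p q > 0"
  obtains b c where "b \<in> Basis" "c \<in> Basis" "b \<noteq> c"
    "sqrt (gram p q) < 2 * real DIM('a) * \<bar>(p \<bullet> b) * (q \<bullet> c) - (p \<bullet> c) * (q \<bullet> b)\<bar>"
proof -
  let ?m = "\<lambda>b c. (p \<bullet> b) * (q \<bullet> c) - (p \<bullet> c) * (q \<bullet> b)" and ?n = "real DIM('a)"
  have "\<exists>b\<in>Basis. \<exists>c\<in>Basis. sqrt (gram p q) < 2 * ?n * \<bar>?m b c\<bar>"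
  proof (rule ccontr)
    assume "\<not> ?thesis"
    then have le: "2 * ?n * \<bar>?m b c\<bar> \<le> sqrt (gram p q)" if "b \<in> Basis" "c \<in> Basis" for b c
      using that by (auto simp: not_less)
    have "4 * ?n\<^sup>2 * (?m b c)\<^sup>2 \<le> gram p q" if "b \<in> Basis" "c \<in> Basis" for b c
      using power_mono[OF le[OF that], of 2] assms by (simp add: power_mult_distrib)
    then have "(\<Sum>b\<in>Basis. \<Sum>c\<in>Basis. 4 * ?n\<^sup>2 * (?m b c)\<^sup>2)
        \<le> (\<Sum>b\<in>(Basis :: 'a set). \<Sum>c\<in>(Basis :: 'a set). gram p q)"
      by (intro sum_mono)
    also have "(\<Sum>b\<in>Basis. \<Sum>c\<in>Basis. 4 * ?n\<^sup>2 * (?m b c)\<^sup>2) = 4 * ?n\<^sup>2 * (2 * gram p q)"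
      by (simp only: sum_minors_eq_gram[symmetric] sum_distrib_left)
    also have "(\<Sum>b\<in>(Basis :: 'a set). \<Sum>c\<in>(Basis :: 'a set). gram p q) = ?n\<^sup>2 * gram p q"
      by (simp add: power2_eq_square)
    finally have "7 * (?n\<^sup>2 * gram p q) \<le> 0" by linarith
    moreover have "0 < ?n\<^sup>2 * gram p q" using assms by simp
    ultimately show False by linarith
  qed
  then obtain b c where bc: "b \<in> Basis" "c \<in> Basis" "sqrt (gram p q) < 2 * ?n * \<bar>?m b c\<bar>"
    by blast
  with assms have "b \<noteq> c" by auto
  with bc that show thesis by blast
qed

text \<open>
  The derivative of the coordinate change at \<open>x0\<close> is injective because its determinant is the minor in
  \<open>J\<close>. Continuity of the gradients makes the derivative continuous, so the map is injective near \<open>x0\<close>.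
\<close>

lemma inj_on_two_coordinate_change:
  fixes T1 T2 :: "'a::euclidean_space \<Rightarrow> real" and p q :: "'a \<Rightarrow> 'a"
  assumes U: "open U" "x0 \<in> U" and bc: "b \<in> Basis" "c \<in> Basis" "b \<noteq> c"
    and der: "\<And>x. x \<in> U \<Longrightarrow> GDERIV T1 x :> p x" "\<And>x. x \<in> U \<Longrightarrow> GDERIV T2 x :> q x"
    and cont: "continuous_on U p" "continuous_on U q"
    and J: "(p x0 \<bullet> b) * (q x0 \<bullet> c) - (p x0 \<bullet> c) * (q x0 \<bullet> b) \<noteq> 0"
  obtains r where "r > 0" "ball x0 r \<subseteq> U"
    "inj_on (\<lambda>x. x + (T1 x - x \<bullet> b) *\<^sub>R b + (T2 x - x \<bullet> c) *\<^sub>R c) (ball x0 r)"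
proof -
  let ?\<Phi> = "\<lambda>x. x + (T1 x - x \<bullet> b) *\<^sub>R b + (T2 x - x \<bullet> c) *\<^sub>R c"
  define L where "L x = (\<lambda>v. v + (v \<bullet> p x - v \<bullet> b) *\<^sub>R b + (v \<bullet> q x - v \<bullet> c) *\<^sub>R c)" for x
  have dL: "(?\<Phi> has_derivative L x) (at x)" if "x \<in> U" for x
    unfolding L_def using der[OF that] unfolding gderiv_def
    by (auto intro!: derivative_eq_intros)
  have linL: "linear (L x)" for x
    by (auto simp: L_def linear_iff algebra_simps)
  have "inj (L x0)"
    unfolding linear_injective_0[OF linL]
  proof (intro allI impI)
    fix v assume v: "L x0 v = 0"
    have v0: "v \<bullet> e = 0" if "e \<in> Basis" "e \<noteq> b" "e \<noteq> c" for e
    proof -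
      have "L x0 v \<bullet> e = v \<bullet> e"
        using that bc by (simp add: L_def inner_add_left inner_Basis)
      with v show ?thesis by simp
    qed
    have "L x0 v \<bullet> b = v \<bullet> p x0" "L x0 v \<bullet> c = v \<bullet> q x0"
      using bc by (simp_all add: L_def inner_add_left inner_Basis)
    with v have v12: "v \<bullet> p x0 = 0" "v \<bullet> q x0 = 0" by simp_all
    have exp: "v \<bullet> y = (v \<bullet> b) * (y \<bullet> b) + (v \<bullet> c) * (y \<bullet> c)" for y
    proof -
      have "v \<bullet> y = (\<Sum>e\<in>Basis. (v \<bullet> e) * (y \<bullet> e))" by (rule euclidean_inner)
      also have "\<dots> = (\<Sum>e\<in>{b, c}. (v \<bullet> e) * (y \<bullet> e))"
        using bc v0 by (intro sum.mono_neutral_right) auto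
      finally show ?thesis using bc by simp
    qed
    let ?J = "(p x0 \<bullet> b) * (q x0 \<bullet> c) - (p x0 \<bullet> c) * (q x0 \<bullet> b)"
    have e1: "(v \<bullet> b) * (p x0 \<bullet> b) + (v \<bullet> c) * (p x0 \<bullet> c) = 0"
      and e2: "(v \<bullet> b) * (q x0 \<bullet> b) + (v \<bullet> c) * (q x0 \<bullet> c) = 0"
      using v12 exp by metis+
    have "(v \<bullet> b) * ?J = ((v \<bullet> b) * (p x0 \<bullet> b) + (v \<bullet> c) * (p x0 \<bullet> c)) * (q x0 \<bullet> c)
        - ((v \<bullet> b) * (q x0 \<bullet> b) + (v \<bullet> c) * (q x0 \<bullet> c)) * (p x0 \<bullet> c)"
      "(v \<bullet> c) * ?J = ((v \<bullet> b) * (q x0 \<bullet> b) + (v \<bullet> c) * (q x0 \<bullet> c)) * (p x0 \<bullet> b)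
        - ((v \<bullet> b) * (p x0 \<bullet> b) + (v \<bullet> c) * (p x0 \<bullet> c)) * (q x0 \<bullet> b)"
      by (simp_all add: algebra_simps)
    then have "(v \<bullet> b) * ?J = 0" "(v \<bullet> c) * ?J = 0"
      unfolding e1 e2 by simp_all
    with J have "v \<bullet> b = 0" "v \<bullet> c = 0" by simp_all
    then have "v \<bullet> v = 0" using exp[of v] by simp
    then show "v = 0" by simp
  qed
  from linear_injective_left_inverse[OF linL this]
  obtain g' where g': "linear g'" "g' \<circ> L x0 = id" by blast
  have small: "\<exists>d>0. \<forall>x. dist x0 x < d \<longrightarrow> onorm (\<lambda>v. L x v - L x0 v) < e" if "e > 0" for e
  proof -
    have "isCont p x0" "isCont q x0"
      using cont U by (auto simp: continuous_on_eq_continuous_at)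
    then obtain d1 d2 where d: "d1 > 0" "\<And>x. dist x x0 < d1 \<Longrightarrow> dist (p x) (p x0) < e / 4"
      "d2 > 0" "\<And>x. dist x x0 < d2 \<Longrightarrow> dist (q x) (q x0) < e / 4"
      unfolding continuous_at_eps_delta using \<open>e > 0\<close> by (metis zero_less_divide_iff zero_less_numeral)
    have "onorm (\<lambda>v. L x v - L x0 v) < e" if x: "dist x0 x < min d1 d2" for x
    proof -
      have "onorm (\<lambda>v. L x v - L x0 v) \<le> e / 2"
      proof (rule onorm_bound)
        fix v
        have "L x v - L x0 v = (v \<bullet> (p x - p x0)) *\<^sub>R b + (v \<bullet> (q x - q x0)) *\<^sub>R c"
          by (simp add: L_def algebra_simps)
        also have "norm \<dots> \<le> \<bar>v \<bullet> (p x - p x0)\<bar> + \<bar>v \<bullet> (q x - q x0)\<bar>"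
          using bc by (intro norm_triangle_le) simp
        also have "\<dots> \<le> norm v * norm (p x - p x0) + norm v * norm (q x - q x0)"
          by (intro add_mono Cauchy_Schwarz_ineq2)
        also have "\<dots> \<le> norm v * (e / 4) + norm v * (e / 4)"
          using d(2,4)[of x] x by (intro add_mono mult_left_mono) (auto simp: dist_norm dist_commute norm_minus_commute)
        finally show "norm (L x v - L x0 v) \<le> e / 2 * norm v" by simp
      qed (use \<open>e > 0\<close> in simp)
      with \<open>e > 0\<close> show ?thesis by simp
    qed
    with d show ?thesis by (intro exI[of _ "min d1 d2"]) auto
  qed
  have "bounded_linear g'" using g'(1) by (simp add: linear_conv_bounded_linear)
  from has_derivative_locally_injective[OF U(2,1) this g'(2) dL small]
  show thesis using that by blast
qed

text \<open>
  This is half of the coarea formula for \<open>(T1, T2)\<close>, up to a constant: the integral of \<open>f\<close> over \<open>B\<close> is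
  bounded by the integral over \<open>t\<close> of the integrals of \<open>f / \<surd>gram\<close> over the fibres. The minor selected at
  \<open>x0\<close> stays comparable to the coarea factor on a small ball. The measurability claim lets the fibre
  integrals of countably many disjoint sets \<open>B\<close> be added.
\<close>

proposition coarea_inequality_local:
  fixes T1 T2 :: "'a::euclidean_space \<Rightarrow> real" and p q :: "'a \<Rightarrow> 'a"
  assumes U: "open U" "x0 \<in> U"
    and der: "\<And>x. x \<in> U \<Longrightarrow> GDERIV T1 x :> p x" "\<And>x. x \<in> U \<Longrightarrow> GDERIV T2 x :> q x"
    and cont: "continuous_on U p" "continuous_on U q"
    and gram0: "gram (p x0) (q x0) > 0"
  obtains r where "r > 0" "ball x0 r \<subseteq> U"
    "\<forall>B\<in>sets borel. \<forall>f\<in>borel_measurable borel. B \<subseteq> ball x0 r \<longrightarrow> (\<forall>x. 0 \<le> f x) \<longrightarrow>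
      (\<exists>h\<in>borel_measurable borel.
        (\<integral>\<^sup>+x\<in>B. ennreal (f x) \<partial>lborel) = (\<integral>\<^sup>+t. h t \<partial>lborel) \<and>
        (\<forall>t. (\<lambda>x. ennreal (f x / sqrt (gram (p x) (q x))) * indicator {x \<in> B. (T1 x, T2 x) = t} x)
            \<in> borel_measurable borel \<and>
          ennreal (unit_ball_vol (DIM('a) - 2) / 4 ^ (DIM('a) - 2)) * h t
          \<le> ennreal (2 * DIM('a)) * (\<integral>\<^sup>+x\<in>{x \<in> B. (T1 x, T2 x) = t}.
                ennreal (f x / sqrt (gram (p x) (q x))) \<partial>hausdorff_measure (DIM('a) - 2))))"
proof -
  from large_minor[OF gram0] obtain b c where bc: "b \<in> Basis" "c \<in> Basis" "b \<noteq> c"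
    and large: "sqrt (gram (p x0) (q x0))
      < 2 * real DIM('a) * \<bar>(p x0 \<bullet> b) * (q x0 \<bullet> c) - (p x0 \<bullet> c) * (q x0 \<bullet> b)\<bar>" .
  define J where "J x = (p x \<bullet> b) * (q x \<bullet> c) - (p x \<bullet> c) * (q x \<bullet> b)" for x
  let ?n = "real DIM('a)"
  have J0: "J x0 \<noteq> 0" using large gram0 by (auto simp: J_def)
  obtain r1 where r1: "r1 > 0" "ball x0 r1 \<subseteq> U"
    and inj: "inj_on (\<lambda>x. x + (T1 x - x \<bullet> b) *\<^sub>R b + (T2 x - x \<bullet> c) *\<^sub>R c) (ball x0 r1)"
    by (rule inj_on_two_coordinate_change[OF U bc der cont J0[unfolded J_def]])
  have "continuous_on U (\<lambda>x. 2 * ?n * \<bar>J x\<bar> - sqrt (gram (p x) (q x)))"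
    unfolding J_def gram_def by (intro continuous_intros cont)
  moreover have "continuous_on U (\<lambda>x. gram (p x) (q x))"
    unfolding gram_def by (intro continuous_intros cont)
  ultimately have "open ((U \<inter> (\<lambda>x. 2 * ?n * \<bar>J x\<bar> - sqrt (gram (p x) (q x))) -` {0<..})
      \<inter> (U \<inter> (\<lambda>x. gram (p x) (q x)) -` {0<..}))" (is "open ?O")
    using U(1) by (intro open_Int continuous_open_preimage) auto
  moreover have "x0 \<in> ?O" using large gram0 U(2) by (simp add: J_def)
  ultimately obtain r2 where r2: "r2 > 0" "ball x0 r2 \<subseteq> ?O"
    by (rule openE)
  \<comment> \<open>halved, so that the closed ball is still contained in the two open ones\<close>
  define r where "r = min r1 r2 / 2"
  have r: "r > 0" "cball x0 r \<subseteq> ball x0 r1" "cball x0 r \<subseteq> ball x0 r2"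
    using r1 r2 by (auto simp: r_def)
  have bounds: "sqrt (gram (p x) (q x)) < 2 * ?n * \<bar>J x\<bar>" "0 < gram (p x) (q x)" if "x \<in> cball x0 r" for x
  proof -
    have "x \<in> (\<lambda>x. 2 * ?n * \<bar>J x\<bar> - sqrt (gram (p x) (q x))) -` {0<..} \<inter> (\<lambda>x. gram (p x) (q x)) -` {0<..}"
      using r2(2) r(3) that by blast
    then show "sqrt (gram (p x) (q x)) < 2 * ?n * \<bar>J x\<bar>" "0 < gram (p x) (q x)" by simp_all
  qed
  have cU: "cball x0 r \<subseteq> U" using r(2) r1(2) by blast
  show thesis
  proof (rule that[of r], goal_cases)
    case 3
    show ?case
    proof (intro ballI impI)
      fix B and f :: "'a \<Rightarrow> real"
      assume B: "B \<in> sets borel" "B \<subseteq> ball x0 r" and f: "f \<in> borel_measurable borel" and "\<forall>x. 0 \<le> f x"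
      then have f: "f \<in> borel_measurable borel" "\<And>x. 0 \<le> f x" by auto
      have Bc: "B \<subseteq> cball x0 r" using B(2) by auto
      have J_ne: "J x \<noteq> 0" if "x \<in> cball x0 r" for x
        using bounds[OF that] by auto
      obtain h where h: "h \<in> borel_measurable borel"
        "(\<integral>\<^sup>+x\<in>B. ennreal (f x) \<partial>lborel) = (\<integral>\<^sup>+t. h t \<partial>lborel)"
        and le: "\<And>t. ennreal (unit_ball_vol (DIM('a) - 2) / 4 ^ (DIM('a) - 2)) * h t
        \<le> (\<integral>\<^sup>+x\<in>{x \<in> B. (T1 x, T2 x) = t}. ennreal (f x / \<bar>J x\<bar>) \<partial>hausdorff_measure (DIM('a) - 2))"
        using coarea_inequality_two_coordinates[OF bc compact_cball, of x0 r T1 p T2 q B f]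
          der cont cU J_ne inj_on_subset[OF inj r(2)] B(1) Bc f
        unfolding J_def by (blast intro: continuous_on_subset)
      have meas: "(\<lambda>x. ennreal (f x / sqrt (gram (p x) (q x))) * indicator {x \<in> B. (T1 x, T2 x) = t} x)
          \<in> borel_measurable borel" for t
      proof -
        define w where "w x = (if x \<in> cball x0 r then f x / sqrt (gram (p x) (q x)) else 0)" for x
        have cb: "cball x0 r \<in> sets borel" by auto
        have "{x \<in> B. (T1 x, T2 x) = t} \<in> sets borel"
        proof -
          have "continuous_on (cball x0 r) (\<lambda>x. (T1 x, T2 x))"
            using der cU by (auto simp: gderiv_def intro!: continuous_intros continuous_at_imp_continuous_on
                dest!: has_derivative_continuous)
          from continuous_closed_preimage_constant[OF this closed_cball]
          have "closed {x \<in> cball x0 r. (T1 x, T2 x) = t}" .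
          moreover have "{x \<in> B. (T1 x, T2 x) = t} = B \<inter> {x \<in> cball x0 r. (T1 x, T2 x) = t}"
            using Bc by auto
          ultimately show ?thesis using B(1) by auto
        qed
        moreover have "w \<in> borel_measurable borel"
        proof -
          have "(\<lambda>x. if x \<in> cball x0 r then sqrt (gram (p x) (q x)) else 0) \<in> borel_measurable borel"
            unfolding gram_def
            by (intro borel_measurable_continuous_on_if)
              (auto intro!: continuous_intros continuous_on_subset[OF cont(1) cU] continuous_on_subset[OF cont(2) cU])
          with f(1) have "(\<lambda>x. f x / (if x \<in> cball x0 r then sqrt (gram (p x) (q x)) else 0)) \<in> borel_measurable borel"
            by simp
          also have "(\<lambda>x. f x / (if x \<in> cball x0 r then sqrt (gram (p x) (q x)) else 0)) = w"
            by (auto simp: w_def)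
          finally show ?thesis .
        qed
        ultimately have "(\<lambda>x. ennreal (w x) * indicator {x \<in> B. (T1 x, T2 x) = t} x) \<in> borel_measurable borel"
          by simp
        also have "(\<lambda>x. ennreal (w x) * indicator {x \<in> B. (T1 x, T2 x) = t} x)
          = (\<lambda>x. ennreal (f x / sqrt (gram (p x) (q x))) * indicator {x \<in> B. (T1 x, T2 x) = t} x)"
          using Bc by (intro ext) (auto simp: w_def split: split_indicator)
        finally show ?thesis .
      qed
      have "(\<integral>\<^sup>+x\<in>{x \<in> B. (T1 x, T2 x) = t}. ennreal (f x / \<bar>J x\<bar>) \<partial>hausdorff_measure (DIM('a) - 2))
        \<le> ennreal (2 * ?n) * (\<integral>\<^sup>+x\<in>{x \<in> B. (T1 x, T2 x) = t}.
              ennreal (f x / sqrt (gram (p x) (q x))) \<partial>hausdorff_measure (DIM('a) - 2))" (is "?lhs \<le> ?rhs") for t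
      proof -
        have "?lhs \<le> (\<integral>\<^sup>+x. ennreal (2 * ?n) * (ennreal (f x / sqrt (gram (p x) (q x)))
            * indicator {x \<in> B. (T1 x, T2 x) = t} x) \<partial>hausdorff_measure (DIM('a) - 2))"
        proof (rule nn_integral_mono)
          fix x
          have "f x / \<bar>J x\<bar> \<le> 2 * ?n * (f x / sqrt (gram (p x) (q x)))" if "x \<in> B"
          proof -
            have x: "x \<in> cball x0 r" using that Bc by blast
            have "f x * sqrt (gram (p x) (q x)) \<le> f x * (2 * ?n * \<bar>J x\<bar>)"
              using bounds(1)[OF x] f(2)[of x] by (intro mult_left_mono) auto
            then show ?thesis
              using bounds(2)[OF x] J_ne[OF x] by (simp add: divide_simps mult_ac)
          qed
          then have "ennreal (f x / \<bar>J x\<bar>) \<le> ennreal (2 * ?n) * ennreal (f x / sqrt (gram (p x) (q x)))"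
            if "x \<in> B" using that f(2)[of x] by (subst ennreal_mult[symmetric]) (auto intro!: ennreal_leI divide_nonneg_nonneg simp: gram_nonneg)
          then show "ennreal (f x / \<bar>J x\<bar>) * indicator {x \<in> B. (T1 x, T2 x) = t} x
            \<le> ennreal (2 * ?n) * (ennreal (f x / sqrt (gram (p x) (q x))) * indicator {x \<in> B. (T1 x, T2 x) = t} x)"
            by (auto simp: indicator_def)
        qed
        also have "\<dots> = ?rhs"
          using meas[of t] borel_subset_sets_hausdorff[of "DIM('a) - 2", where 'a='a]
          by (intro nn_integral_cmult) (auto simp: measurable_def hausdorff_measure_def)
        finally show ?thesis .
      qed
      with h le meas show "\<exists>h\<in>borel_measurable borel.
          (\<integral>\<^sup>+x\<in>B. ennreal (f x) \<partial>lborel) = (\<integral>\<^sup>+t. h t \<partial>lborel) \<and>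
          (\<forall>t. (\<lambda>x. ennreal (f x / sqrt (gram (p x) (q x))) * indicator {x \<in> B. (T1 x, T2 x) = t} x)
              \<in> borel_measurable borel \<and>
            ennreal (unit_ball_vol (DIM('a) - 2) / 4 ^ (DIM('a) - 2)) * h t
            \<le> ennreal (2 * DIM('a)) * (\<integral>\<^sup>+x\<in>{x \<in> B. (T1 x, T2 x) = t}.
                  ennreal (f x / sqrt (gram (p x) (q x))) \<partial>hausdorff_measure (DIM('a) - 2)))"
        by (intro bexI[of _ h] conjI allI order_trans[OF le]) auto
    qed
  qed (use r(1) cU in auto)
qed

section \<open>Implicit functions, sign changes and regular zeros\<close>

text \<open>
  A factor that multiplies a function with a zero at \<open>x\<close> contributes to the derivative at \<open>x\<close> only through
  its value, so its continuity is enough.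
\<close>

lemma has_derivative_mult_vanishing:
  fixes F k :: "'a::real_normed_vector \<Rightarrow> real"
  assumes F: "(F has_derivative F') (at x)" and F0: "F x = 0" and k: "isCont k x"
  shows "((\<lambda>y. F y * k y) has_derivative (\<lambda>h. F' h * k x)) (at x)"
proof -
  have bl: "bounded_linear F'" using F by (rule has_derivative_bounded_linear)
  then obtain B where B: "B > 0" "\<And>h. \<bar>F' h\<bar> \<le> norm h * B"
    using bounded_linear.pos_bounded by (metis real_norm_def)
  have "((\<lambda>y. F y * (k y - k x)) has_derivative (\<lambda>h. 0)) (at x)"
    unfolding has_derivative_within_alt2
  proof (intro conjI allI impI)
    fix e :: real assume e: "e > 0"
    have "\<forall>\<^sub>F y in at x. norm (F y - F x - F' (y - x)) \<le> 1 * norm (y - x)"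
      using F unfolding has_derivative_within_alt2 by (metis zero_less_one)
    moreover have "\<forall>\<^sub>F y in at x. \<bar>k y - k x\<bar> < e / (B + 1)"
      using tendstoD[OF k[unfolded isCont_def], of "e / (B + 1)"] e B(1) by (simp add: dist_real_def)
    ultimately show "\<forall>\<^sub>F y in at x. norm (F y * (k y - k x) - F x * (k x - k x) - 0) \<le> e * norm (y - x)"
    proof eventually_elim
      case (elim y)
      have "\<bar>F y\<bar> \<le> norm (y - x) * (B + 1)"
        using elim(1) B(2)[of "y - x"] F0 by (simp add: algebra_simps)
      then have "\<bar>F y\<bar> * \<bar>k y - k x\<bar> \<le> (norm (y - x) * (B + 1)) * (e / (B + 1))"
        using elim(2) B(1) by (intro mult_mono) auto
      then show ?case using B(1) by (simp add: abs_mult F0 mult.commute)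
    qed
  qed simp
  from has_derivative_add[OF this has_derivative_mult_left[OF F, of "k x"]]
  show ?thesis by (simp add: algebra_simps)
qed

text \<open>
  Near \<open>(\<tau>, x0)\<close> the functions \<open>f(\<sqdot>, x)\<close> increase with slope at least \<open>c > 0\<close>, so each has exactly
  one zero \<open>T x\<close> there. By the mean value theorem in \<open>t\<close> alone,
  \<open>T y - T x = - f (T x) y / d (\<xi> y) y\<close> with \<open>\<xi> y\<close> between \<open>T x\<close> and \<open>T y\<close>. The numerator is
  differentiable at \<open>x\<close> with value \<open>0\<close>, and the denominator is continuous there, so
  \<open>has_derivative_mult_vanishing\<close> gives the derivative of \<open>T\<close>.
\<close>

lemma implicit_scalar_function_pos:
  fixes f :: "real \<Rightarrow> 'a::euclidean_space \<Rightarrow> real"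
  assumes U: "open U" "x0 \<in> U" and \<tau>: "a < \<tau>" "\<tau> < b"
    and dt: "\<And>t x. t \<in> {a<..<b} \<Longrightarrow> x \<in> U \<Longrightarrow> ((\<lambda>s. f s x) has_real_derivative d t x) (at t)"
    and dx: "\<And>t x. t \<in> {a<..<b} \<Longrightarrow> x \<in> U \<Longrightarrow> GDERIV (f t) x :> g t x"
    and cd: "continuous_on ({a<..<b} \<times> U) (\<lambda>(t, x). d t x)"
    and f0: "f \<tau> x0 = 0" and d0: "d \<tau> x0 > 0"
  obtains r T where "r > 0" "ball x0 r \<subseteq> U" "T x0 = \<tau>"
    "\<And>x. x \<in> ball x0 r \<Longrightarrow> a < T x \<and> T x < b \<and> f (T x) x = 0 \<and> d (T x) x \<noteq> 0
      \<and> GDERIV T x :> (- 1 / d (T x) x) *\<^sub>R g (T x) x"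
proof -
  define c where "c = d \<tau> x0 / 2"
  have c: "c > 0" "c < d \<tau> x0" using d0 by (simp_all add: c_def)
  have "open (({a<..<b} \<times> U) \<inter> (\<lambda>(t, x). d t x) -` {c<..})"
    using U(1) by (intro continuous_open_preimage cd open_Times) auto
  moreover have "(\<tau>, x0) \<in> ({a<..<b} \<times> U) \<inter> (\<lambda>(t, x). d t x) -` {c<..}"
    using \<tau> U c by simp
  ultimately obtain A1 A2 where A: "open A1" "open A2" "\<tau> \<in> A1" "x0 \<in> A2"
    "A1 \<times> A2 \<subseteq> ({a<..<b} \<times> U) \<inter> (\<lambda>(t, x). d t x) -` {c<..}"
    by (rule open_prod_elim) auto
  obtain \<delta> where \<delta>: "\<delta> > 0" "cball \<tau> \<delta> \<subseteq> A1" using A(1,3) open_contains_cball by blast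
  define lo hi where "lo = \<tau> - \<delta>" "hi = \<tau> + \<delta>"
  have lohi: "lo < \<tau>" "\<tau> < hi" "{lo..hi} \<subseteq> A1"
    using \<delta> by (auto simp: lo_hi_def cball_eq_atLeastAtMost)
  have A1: "A1 \<subseteq> {a<..<b}" and A2: "A2 \<subseteq> U" and dc: "\<And>t x. t \<in> A1 \<Longrightarrow> x \<in> A2 \<Longrightarrow> c < d t x"
    using A by auto
  have mvt: "\<exists>\<xi>. \<bar>\<xi> - s\<bar> \<le> \<bar>t - s\<bar> \<and> \<xi> \<in> {lo..hi} \<and> f t x - f s x = d \<xi> x * (t - s)"
    if st: "s \<in> {lo..hi}" "t \<in> {lo..hi}" and x: "x \<in> A2" for s t x
  proof -
    have DD: "DERIV (\<lambda>s. f s x) z :> d z x" if "z \<in> {lo..hi}" for z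
      using that lohi(3) A1 A2 x by (intro dt) blast+
    consider "s = t" | "s < t" | "t < s" by linarith
    then show ?thesis
    proof cases
      case 2
      then obtain z where "s < z" "z < t" "f t x - f s x = (t - s) * d z x"
        using MVT2[of s t "\<lambda>s. f s x" "\<lambda>z. d z x"] DD st by auto
      with st show ?thesis by (intro exI[of _ z]) auto
    next
      case 3
      then obtain z where "t < z" "z < s" "f s x - f t x = (s - t) * d z x"
        using MVT2[of t s "\<lambda>s. f s x" "\<lambda>z. d z x"] DD st by auto
      with st show ?thesis by (intro exI[of _ z]) (auto simp: algebra_simps)
    qed (use st in auto)
  qed
  have grow: "c * \<bar>t - s\<bar> \<le> \<bar>f t x - f s x\<bar>" "s < t \<Longrightarrow> f s x < f t x"
    if "s \<in> {lo..hi}" "t \<in> {lo..hi}" "x \<in> A2" for s t x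
  proof -
    from mvt[OF that] obtain \<xi> where \<xi>: "\<xi> \<in> {lo..hi}" "f t x - f s x = d \<xi> x * (t - s)" by blast
    then have "c < d \<xi> x" using dc lohi(3) that(3) by blast
    then have "c * \<bar>t - s\<bar> \<le> \<bar>d \<xi> x\<bar> * \<bar>t - s\<bar>" using c by (intro mult_right_mono) auto
    then show "c * \<bar>t - s\<bar> \<le> \<bar>f t x - f s x\<bar>" by (simp add: \<xi>(2) abs_mult)
    assume "s < t"
    then have "0 < d \<xi> x * (t - s)" using \<open>c < d \<xi> x\<close> c by simp
    with \<xi>(2) show "f s x < f t x" by simp
  qed
  have cx: "isCont (f t) x" if "t \<in> {lo..hi}" "x \<in> A2" for t x
  proof -
    have "GDERIV (f t) x :> g t x" using that lohi(3) A1 A2 by (intro dx) blast+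
    then show ?thesis by (simp add: gderiv_def has_derivative_continuous)
  qed
  have "continuous_on A2 (f lo)" "continuous_on A2 (f hi)"
    using cx lohi by (auto intro!: continuous_at_imp_continuous_on)
  then have "open ((A2 \<inter> f lo -` {..<0}) \<inter> (A2 \<inter> f hi -` {0<..}))" (is "open ?O")
    using A(2) by (intro open_Int continuous_open_preimage) auto
  moreover have "x0 \<in> ?O"
    using grow(2)[of lo \<tau> x0] grow(2)[of \<tau> hi x0] lohi A f0 by auto
  ultimately obtain r where r: "r > 0" "ball x0 r \<subseteq> ?O" by (rule openE)
  define T where "T x = (SOME t. t \<in> {lo..hi} \<and> f t x = 0)" for x
  have T: "T x \<in> {lo..hi}" "f (T x) x = 0" if "x \<in> ball x0 r" for x
  proof -
    have x: "x \<in> A2" "f lo x < 0" "0 < f hi x" using r that by auto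
    have "continuous_on {lo..hi} (\<lambda>t. f t x)"
      using dt A1 A2 lohi(3) x(1) by (intro continuous_at_imp_continuous_on ballI DERIV_isCont) blast
    then have "\<exists>t\<ge>lo. t \<le> hi \<and> f t x = 0"
      using x lohi by (intro IVT') auto
    then have "\<exists>t. t \<in> {lo..hi} \<and> f t x = 0" by auto
    from someI_ex[OF this] show "T x \<in> {lo..hi}" "f (T x) x = 0" by (simp_all add: T_def)
  qed
  have rA2: "ball x0 r \<subseteq> A2" using r by auto
  have der: "GDERIV T x :> (- 1 / d (T x) x) *\<^sub>R g (T x) x" if x: "x \<in> ball x0 r" for x
  proof -
    define D where "D = d (T x) x"
    have "\<forall>y\<in>ball x0 r. \<exists>\<xi>. \<bar>\<xi> - T x\<bar> \<le> \<bar>T y - T x\<bar> \<and> \<xi> \<in> {lo..hi} \<and> f (T y) y - f (T x) y = d \<xi> y * (T y - T x)"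
      using mvt T x rA2 by blast
    then obtain \<xi> where \<xi>: "\<And>y. y \<in> ball x0 r \<Longrightarrow> \<bar>\<xi> y - T x\<bar> \<le> \<bar>T y - T x\<bar>"
      "\<And>y. y \<in> ball x0 r \<Longrightarrow> \<xi> y \<in> {lo..hi}"
      "\<And>y. y \<in> ball x0 r \<Longrightarrow> f (T y) y - f (T x) y = d (\<xi> y) y * (T y - T x)"
      by metis
    have \<xi>x: "\<xi> x = T x" using \<xi>(1)[OF x] by simp
    \<comment> \<open>\<open>T\<close> is continuous at \<open>x\<close>: \<open>|T y - T x| \<le> |f (T x) y| / c\<close>, and \<open>f (T x)\<close> is continuous
      with value \<open>0\<close> at \<open>x\<close>\<close>
    have ev: "\<forall>\<^sub>F y in nhds x. y \<in> ball x0 r" using x by (intro eventually_nhds_in_open) auto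
    have "\<forall>\<^sub>F y in at x. \<bar>\<xi> y - T x\<bar> \<le> \<bar>f (T x) y\<bar> / c"
    proof (rule eventually_mono[OF filter_leD[OF at_within_le_nhds ev]])
      fix y assume y: "y \<in> ball x0 r"
      have "c * \<bar>T y - T x\<bar> \<le> \<bar>f (T y) y - f (T x) y\<bar>"
        using grow(1)[of "T x" "T y" y] T x y rA2 by blast
      with T(2)[OF y] have "\<bar>T y - T x\<bar> \<le> \<bar>f (T x) y\<bar> / c" using c by (simp add: field_simps)
      with \<xi>(1)[OF y] show "\<bar>\<xi> y - T x\<bar> \<le> \<bar>f (T x) y\<bar> / c" by simp
    qed
    moreover have "((\<lambda>y. \<bar>f (T x) y\<bar> / c) \<longlongrightarrow> 0) (at x)"
    proof -
      have "((\<lambda>y. \<bar>f (T x) y\<bar> / c) \<longlongrightarrow> \<bar>f (T x) x\<bar> / c) (at x)"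
        using cx[of "T x" x] T[OF x] x rA2 c unfolding isCont_def
        by (intro tendsto_intros) auto
      then show ?thesis by (simp add: T(2)[OF x])
    qed
    ultimately have "((\<lambda>y. \<xi> y - T x) \<longlongrightarrow> 0) (at x)"
      by (intro Lim_null_comparison[of "\<lambda>y. \<xi> y - T x" "\<lambda>y. \<bar>f (T x) y\<bar> / c"]) simp_all
    then have "(\<xi> \<longlongrightarrow> T x) (at x)" by (simp add: LIM_zero_iff)
    then have pair: "isCont (\<lambda>y. (\<xi> y, y)) x"
      unfolding isCont_def by (auto simp: \<xi>x intro!: tendsto_intros)
    have TU: "(T x, x) \<in> {a<..<b} \<times> U" using T[OF x] x rA2 A1 A2 lohi(3) by blast
    have "isCont (\<lambda>(t, x). d t x) (T x, x)"
      using cd TU U(1) by (subst (asm) continuous_on_eq_continuous_at) (auto intro: open_Times)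
    then have "isCont (\<lambda>y. d (\<xi> y) y) x"
      using isCont_o2[OF pair, of "\<lambda>(t, x). d t x"] by (simp add: \<xi>x)
    moreover have Dc: "c < D" using dc T[OF x] x rA2 lohi(3) unfolding D_def by blast
    ultimately have k: "isCont (\<lambda>y. - 1 / d (\<xi> y) y) x"
      using c by (auto simp: \<xi>x D_def intro!: continuous_intros)
    have "(f (T x) has_derivative (\<lambda>h. h \<bullet> g (T x) x)) (at x)"
      using dx[of "T x" x] TU by (simp add: gderiv_def)
    from has_derivative_mult_vanishing[OF this T(2)[OF x] k]
    have "((\<lambda>y. f (T x) y * (- 1 / d (\<xi> y) y)) has_derivative (\<lambda>h. (h \<bullet> g (T x) x) * (- 1 / D))) (at x)"
      by (simp add: \<xi>x D_def)
    from has_derivative_add[OF has_derivative_const[of "T x"] this]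
    have 1: "((\<lambda>y. T x + f (T x) y * (- 1 / d (\<xi> y) y)) has_derivative (\<lambda>h. h \<bullet> ((- 1 / D) *\<^sub>R g (T x) x))) (at x)"
      by (simp add: mult.commute)
    have 2: "T x + f (T x) y * (- 1 / d (\<xi> y) y) = T y" if "y \<in> ball x0 r" for y
    proof -
      have "d (\<xi> y) y > 0" using dc \<xi>(2)[OF that] that rA2 lohi(3) c by (meson less_trans subsetD)
      then show ?thesis using \<xi>(3)[OF that] T(2)[OF that] by (simp add: field_simps)
    qed
    show ?thesis
      unfolding gderiv_def
      using has_derivative_transform_within_open[OF 1 open_ball x 2] by (simp add: D_def)
  qed
  show thesis
  proof (rule that[of r T])
    show "r > 0" by fact
    show "ball x0 r \<subseteq> U" using rA2 A2 by blast
    have x0: "x0 \<in> ball x0 r" using r by simp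
    show "T x0 = \<tau>"
      using grow(1)[of \<tau> "T x0" x0] T[OF x0] f0 lohi A(4) c by (auto simp: mult_le_0_iff)
    fix x assume x: "x \<in> ball x0 r"
    have "c < d (T x) x" using dc T[OF x] x rA2 lohi(3) by blast
    moreover have "T x \<in> {a<..<b}" using T[OF x] A1 lohi(3) by blast
    ultimately show "a < T x \<and> T x < b \<and> f (T x) x = 0 \<and> d (T x) x \<noteq> 0
      \<and> GDERIV T x :> (- 1 / d (T x) x) *\<^sub>R g (T x) x"
      using T[OF x] der[OF x] c by auto
  qed
qed

lemma implicit_scalar_function:
  fixes f :: "real \<Rightarrow> 'a::euclidean_space \<Rightarrow> real"
  assumes U: "open U" "x0 \<in> U" and \<tau>: "a < \<tau>" "\<tau> < b"
    and dt: "\<And>t x. t \<in> {a<..<b} \<Longrightarrow> x \<in> U \<Longrightarrow> ((\<lambda>s. f s x) has_real_derivative d t x) (at t)"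
    and dx: "\<And>t x. t \<in> {a<..<b} \<Longrightarrow> x \<in> U \<Longrightarrow> GDERIV (f t) x :> g t x"
    and cd: "continuous_on ({a<..<b} \<times> U) (\<lambda>(t, x). d t x)"
    and f0: "f \<tau> x0 = 0" and d0: "d \<tau> x0 \<noteq> 0"
  obtains r T where "r > 0" "ball x0 r \<subseteq> U" "T x0 = \<tau>"
    "\<And>x. x \<in> ball x0 r \<Longrightarrow> a < T x \<and> T x < b \<and> f (T x) x = 0 \<and> d (T x) x \<noteq> 0
      \<and> GDERIV T x :> (- 1 / d (T x) x) *\<^sub>R g (T x) x"
proof (cases "d \<tau> x0 > 0")
  case True
  show thesis
    by (rule implicit_scalar_function_pos[OF U \<tau> dt dx cd f0 True]) (use that in blast)+
next
  case False
  have cd': "continuous_on ({a<..<b} \<times> U) (\<lambda>(t, x). - d t x)"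
    using continuous_on_minus[OF cd] by (simp add: case_prod_beta')
  show thesis
  proof (rule implicit_scalar_function_pos[OF U \<tau>, of "\<lambda>t x. - f t x" "\<lambda>t x. - d t x" "\<lambda>t x. - g t x"])
    show "((\<lambda>s. - f s x) has_real_derivative - d t x) (at t)" if "t \<in> {a<..<b}" "x \<in> U" for t x
      using DERIV_minus[OF dt[OF that]] .
    show "GDERIV (\<lambda>x. - f t x) x :> - g t x" if "t \<in> {a<..<b}" "x \<in> U" for t x
      using GDERIV_minus[OF dx[OF that]] .
  qed (use f0 d0 False cd' that in auto)
qed

text \<open>
  Darboux's property: at a point where \<open>f\<close> is extremal on \<open>[a, b]\<close> the derivative vanishes, and the signs of
  the derivative at \<open>a\<close> and \<open>b\<close> keep a suitable extremum off the endpoints.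
\<close>

lemma derivative_zero_between:
  fixes f :: "real \<Rightarrow> real"
  assumes "a < b" and der: "\<And>x. x \<in> {a..b} \<Longrightarrow> (f has_real_derivative f' x) (at x)"
    and sgn: "f' a * f' b < 0"
  obtains z where "a < z" "z < b" "f' z = 0"
proof -
  have neg: "\<exists>z. a < z \<and> z < b \<and> g' z = 0"
    if g: "\<And>x. x \<in> {a..b} \<Longrightarrow> (g has_real_derivative g' x) (at x)" and "g' a < 0" "0 < g' b"
    for g g' :: "real \<Rightarrow> real"
  proof -
    have "continuous_on {a..b} g"
      using g by (intro continuous_at_imp_continuous_on ballI DERIV_isCont)
    then obtain m where m: "m \<in> {a..b}" "\<And>x. x \<in> {a..b} \<Longrightarrow> g m \<le> g x"
      using continuous_attains_inf[of "{a..b}" g] \<open>a < b\<close> by auto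
    have "m \<noteq> a"
    proof
      assume "m = a"
      obtain d where d: "d > 0" "\<And>h. 0 < h \<Longrightarrow> h < d \<Longrightarrow> g (a + h) < g a"
        using DERIV_neg_dec_right[OF g[of a] \<open>g' a < 0\<close>] \<open>a < b\<close> by auto
      have "g (a + min (d / 2) (b - a)) < g a" using d \<open>a < b\<close> by (intro d(2)) auto
      moreover have "a + min (d / 2) (b - a) \<in> {a..b}" using d(1) \<open>a < b\<close> by (auto simp: min_def)
      ultimately show False using m(2) \<open>m = a\<close> by fastforce
    qed
    moreover have "m \<noteq> b"
    proof
      assume "m = b"
      obtain d where d: "d > 0" "\<And>h. 0 < h \<Longrightarrow> h < d \<Longrightarrow> g (b - h) < g b"
        using DERIV_pos_inc_left[OF g[of b] \<open>0 < g' b\<close>] \<open>a < b\<close> by auto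
      have "g (b - min (d / 2) (b - a)) < g b" using d \<open>a < b\<close> by (intro d(2)) auto
      moreover have "b - min (d / 2) (b - a) \<in> {a..b}" using d(1) \<open>a < b\<close> by (auto simp: min_def)
      ultimately show False using m(2) \<open>m = b\<close> by fastforce
    qed
    ultimately have mm: "a < m" "m < b" using m(1) by auto
    have "g' m = 0"
    proof (rule DERIV_local_min[OF g[OF m(1)]])
      show "0 < min (m - a) (b - m)" using mm by simp
      show "\<forall>y. \<bar>m - y\<bar> < min (m - a) (b - m) \<longrightarrow> g m \<le> g y"
        by (intro allI impI m(2)) (auto simp: abs_if split: if_splits)
    qed
    with mm show ?thesis by blast
  qed
  from sgn consider "f' a < 0" "0 < f' b" | "0 < f' a" "f' b < 0"
    by (auto simp: mult_less_0_iff)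
  then have "\<exists>z. a < z \<and> z < b \<and> f' z = 0"
  proof cases
    case 1
    then show ?thesis using neg[of f f'] der by blast
  next
    case 2
    then show ?thesis using neg[of "\<lambda>x. - f x" "\<lambda>x. - f' x"] der by (auto intro: DERIV_minus)
  qed
  with that show thesis by blast
qed

lemma sign_change_at_simple_zero:
  fixes f :: "real \<Rightarrow> real"
  assumes "(f has_real_derivative D) (at t)" "D \<noteq> 0" "f t = 0" "a < t" "t < b"
  obtains s s' where "a < s" "s < t" "t < s'" "s' < b" "f s * f s' < 0"
proof -
  have pos: "\<exists>s s'. a < s \<and> s < t \<and> t < s' \<and> s' < b \<and> g s < 0 \<and> 0 < g s'"
    if g: "(g has_real_derivative E) (at t)" "E > 0" "g t = 0" for g E
  proof -
    obtain d where d: "d > 0" "\<And>h. 0 < h \<Longrightarrow> h < d \<Longrightarrow> g t < g (t + h)"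
      using DERIV_pos_inc_right[OF g(1,2)] by auto
    obtain e where e: "e > 0" "\<And>h. 0 < h \<Longrightarrow> h < e \<Longrightarrow> g (t - h) < g t"
      using DERIV_pos_inc_left[OF g(1,2)] by auto
    define h where "h = min (min d e) (min (t - a) (b - t)) / 2"
    have "0 < h" "h < d" "h < e" "h < t - a" "h < b - t"
      using d e assms by (auto simp: h_def)
    with d(2)[of h] e(2)[of h] g(3) show ?thesis
      by (intro exI[of _ "t - h"] exI[of _ "t + h"]) auto
  qed
  show thesis
  proof (cases "D > 0")
    case True
    from pos[OF assms(1) this assms(3)] that show thesis by (auto simp: mult_less_0_iff)
  next
    case False
    from pos[OF DERIV_minus[OF assms(1)]] False assms(2,3) that show thesis by (auto simp: mult_less_0_iff)
  qed
qed

text \<open>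
  If the derivative in the direction of a basis vector \<open>b\<close> is nonzero, then the map that replaces the
  coordinate along \<open>b\<close> by \<open>f\<close> has an injective derivative, and it sends the zeros of \<open>f\<close> to a hyperplane.
  The lemma serves for points near which \<open>f\<close> is known only at the zeros themselves.
\<close>

lemma negligible_regular_zeros:
  fixes f :: "'a::euclidean_space \<Rightarrow> real"
  shows "negligible {x. f x = 0 \<and> (\<exists>D. D \<noteq> 0 \<and> GDERIV f x :> D)}"
proof -
  define Z where "Z b = {x. \<exists>D. D \<bullet> b \<noteq> 0 \<and> GDERIV f x :> D}" for b
  have "negligible {x \<in> Z b. x + (f x - x \<bullet> b) *\<^sub>R b \<in> {z. b \<bullet> z = 0}}" if b: "b \<in> Basis" for b
  proof -
    have "\<forall>x\<in>Z b. \<exists>D. D \<bullet> b \<noteq> 0 \<and> GDERIV f x :> D" by (simp add: Z_def)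
    then obtain D where D: "\<And>x. x \<in> Z b \<Longrightarrow> D x \<bullet> b \<noteq> 0" "\<And>x. x \<in> Z b \<Longrightarrow> GDERIV f x :> D x"
      by metis
    show ?thesis
    proof (rule negligible_differentiable_vimage[of _ _ "\<lambda>x h. h + (h \<bullet> D x - h \<bullet> b) *\<^sub>R b"])
      show "negligible {z. b \<bullet> z = 0}" using b by (intro negligible_hyperplane) auto
      fix x assume x: "x \<in> Z b"
      show "((\<lambda>x. x + (f x - x \<bullet> b) *\<^sub>R b) has_derivative (\<lambda>h. h + (h \<bullet> D x - h \<bullet> b) *\<^sub>R b)) (at x within Z b)"
        using D(2)[OF x, unfolded gderiv_def, THEN has_derivative_at_withinI]
        by (auto intro!: derivative_eq_intros)
      show "inj (\<lambda>h. h + (h \<bullet> D x - h \<bullet> b) *\<^sub>R b)"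
      proof (subst linear_injective_0, goal_cases)
        case 1
        then show ?case by (auto simp: linear_iff algebra_simps)
      next
        case 2
        show ?case
        proof (intro allI impI)
          fix h assume h: "h + (h \<bullet> D x - h \<bullet> b) *\<^sub>R b = 0"
          then have "(h + (h \<bullet> D x - h \<bullet> b) *\<^sub>R b) \<bullet> b = 0" by simp
          then have 0: "h \<bullet> D x = 0" using b by (simp add: inner_add_left)
          with h have hb: "h = (h \<bullet> b) *\<^sub>R b" by simp
          then have "h \<bullet> D x = (h \<bullet> b) * (D x \<bullet> b)" by (metis inner_commute inner_scaleR_left)
          with 0 D(1)[OF x] have "h \<bullet> b = 0" by simp
          with hb show "h = 0" by simp
        qed
      qed
    qed
  qed
  then have "negligible (\<Union>b\<in>Basis. {x \<in> Z b. x + (f x - x \<bullet> b) *\<^sub>R b \<in> {z. b \<bullet> z = 0}})"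
    by (intro negligible_Union) auto
  moreover have "{x. f x = 0 \<and> (\<exists>D. D \<noteq> 0 \<and> GDERIV f x :> D)}
      \<subseteq> (\<Union>b\<in>Basis. {x \<in> Z b. x + (f x - x \<bullet> b) *\<^sub>R b \<in> {z. b \<bullet> z = 0}})"
  proof
    fix x assume "x \<in> {x. f x = 0 \<and> (\<exists>D. D \<noteq> 0 \<and> GDERIV f x :> D)}"
    then obtain D where D: "f x = 0" "D \<noteq> 0" "GDERIV f x :> D" by blast
    then obtain b where "b \<in> Basis" "D \<bullet> b \<noteq> 0" using euclidean_all_zero_iff by blast
    with D show "x \<in> (\<Union>b\<in>Basis. {x \<in> Z b. x + (f x - x \<bullet> b) *\<^sub>R b \<in> {z. b \<bullet> z = 0}})"
      by (auto simp: Z_def inner_add_right inner_commute intro!: bexI[of _ b])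
  qed
  ultimately show ?thesis by (rule negligible_subset)
qed

section \<open>Points with both a zero and a critical time\<close>

lemma V_eq_gram: "V l u G (t1, t2) x = gram (grad (G t1) x) (grad (dt l u G t2) x)"
  by (simp add: V_def gram_def)

lemma GDERIV_isCont: "GDERIV f x :> D \<Longrightarrow> isCont f x"
  unfolding gderiv_def by (rule has_derivative_continuous)

lemma dt_exists_imp_deriv:
  "dt_exists l u G t x \<Longrightarrow> ((\<lambda>s. G s x) has_real_derivative dt l u G t x) (at t within {l..u})"
  unfolding dt_exists_def dt_def
  by (simp add: has_real_derivative_iff_has_vector_derivative vector_derivative_works)

lemma grad_exists_imp_GDERIV:
  assumes "grad_exists f x"
  shows "GDERIV f x :> grad f x"
proof -
  from assms obtain D where D: "GDERIV f x :> D" by (auto simp: grad_exists_def)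
  moreover have "E = D" if "GDERIV f x :> E" for E
  proof -
    have "(\<lambda>h. h \<bullet> E) = (\<lambda>h. h \<bullet> D)"
      using that D unfolding gderiv_def by (rule has_derivative_unique)
    then have "(E - D) \<bullet> E = (E - D) \<bullet> D" by meson
    then have "(E - D) \<bullet> (E - D) = 0" by (simp add: inner_diff_right)
    then show ?thesis by simp
  qed
  ultimately show ?thesis unfolding grad_def by (metis theI)
qed

lemma mem_zero_locus_Hmap:
  "x \<in> zero_locus (Hmap l u G) (S \<times> T) \<longleftrightarrow> (\<exists>t1\<in>S. \<exists>t2\<in>T. G t1 x = 0 \<and> dt l u G t2 x = 0)"
  by (simp add: zero_locus_def Hmap_def zero_prod_def Bex_def) blast

lemma regular_onD:
  assumes reg: "regular_on l u G T X" and tx: "t \<in> T" "x \<in> X"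
  shows "((\<lambda>s. G s x) has_real_derivative dt l u G t x) (at t within {l..u})"
    "((\<lambda>s. dt l u G s x) has_real_derivative dt2 l u G t x) (at t within {l..u})"
    "GDERIV (G t) x :> grad (G t) x" "GDERIV (dt l u G t) x :> grad (dt l u G t) x"
proof -
  have "dt_exists l u G t x" "dt_exists l u (dt l u G) t x" "grad_exists (G t) x" "grad_exists (dt l u G t) x"
    using reg tx by (auto simp: regular_on_def dt2_exists_def)
  then show "((\<lambda>s. G s x) has_real_derivative dt l u G t x) (at t within {l..u})"
    "((\<lambda>s. dt l u G s x) has_real_derivative dt2 l u G t x) (at t within {l..u})"
    "GDERIV (G t) x :> grad (G t) x" "GDERIV (dt l u G t) x :> grad (dt l u G t) x"
    by (auto intro: dt_exists_imp_deriv grad_exists_imp_GDERIV)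
qed

text \<open>
  The times are taken in the open interval so that sign changes on both sides of them can be used.
\<close>

definition nondegenerate_zeros ::
    "real \<Rightarrow> real \<Rightarrow> (real \<Rightarrow> 'a::real_inner \<Rightarrow> real) \<Rightarrow> real \<Rightarrow> real \<Rightarrow> 'a set" where
  "nondegenerate_zeros l u G a e = {x. \<exists>t1\<in>{a<..<e}. \<exists>t2\<in>{a<..<e}.
     Hmap l u G (t1, t2) x = 0 \<and> Q1 l u G (t1, t2) x \<noteq> 0}"

text \<open>
  \<open>G(\<sqdot>, x0)\<close> changes sign at the zero \<open>t1\<close>, and \<open>G'(\<sqdot>, x0)\<close> changes sign at \<open>t2\<close>. Four fixed times
  witness this, and at each of them \<open>G\<close> or \<open>G'\<close> is continuous in \<open>x\<close> at \<open>x0\<close>, so for \<open>x\<close> near \<open>x0\<close>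
  the same four values have the same signs. The intermediate value theorem for \<open>G(\<sqdot>, x)\<close> and Darboux's
  property for \<open>G'(\<sqdot>, x)\<close>, which need not be continuous for \<open>x\<close> outside the zero locus, put \<open>x\<close> into
  the locus.
\<close>

lemma nondegenerate_zeros_subset_interior:
  fixes G :: "real \<Rightarrow> 'a::euclidean_space \<Rightarrow> real"
  assumes le: "l \<le> a" "e < u"
    and diff: "\<And>t x. t \<in> {a..e} \<Longrightarrow> dt_exists l u G t x"
    and reg: "regular_on l u G {a..e} (zero_locus (Hmap l u G) ({a..e} \<times> {a..e}))"
  shows "nondegenerate_zeros l u G a e \<subseteq> interior (zero_locus (Hmap l u G) ({a..e} \<times> {a..e}))"
proof
  let ?X = "zero_locus (Hmap l u G) ({a..e} \<times> {a..e})"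
  fix x0 assume "x0 \<in> nondegenerate_zeros l u G a e"
  then obtain t1 t2 where t: "a < t1" "t1 < e" "a < t2" "t2 < e"
    and z: "G t1 x0 = 0" "dt l u G t2 x0 = 0" and n: "dt l u G t1 x0 \<noteq> 0" "dt2 l u G t2 x0 \<noteq> 0"
    by (auto simp: nondegenerate_zeros_def Hmap_def Q1_def zero_prod_def)
  have at_eq: "at s within {l..u} = at s" if "a < s" "s < e" for s
    using that le by (intro at_within_Icc_at) auto
  have x0: "x0 \<in> ?X" using t z by (force simp: mem_zero_locus_Hmap)
  have cont: "isCont (G s) x0" "isCont (dt l u G s) x0" if "s \<in> {a..e}" for s
    using regular_onD(3,4)[OF reg that x0] by (auto intro: GDERIV_isCont)
  have "((\<lambda>s. G s x0) has_real_derivative dt l u G t1 x0) (at t1)"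
    using regular_onD(1)[OF reg _ x0, of t1] t at_eq[of t1] by simp
  from sign_change_at_simple_zero[OF this n(1) z(1) t(1,2)]
  obtain s1 s1' where s1: "a < s1" "s1 < t1" "t1 < s1'" "s1' < e" "G s1 x0 * G s1' x0 < 0" .
  have "((\<lambda>s. dt l u G s x0) has_real_derivative dt2 l u G t2 x0) (at t2)"
    using regular_onD(2)[OF reg _ x0, of t2] t at_eq[of t2] by simp
  from sign_change_at_simple_zero[OF this n(2) z(2) t(3,4)]
  obtain s2 s2' where s2: "a < s2" "s2 < t2" "t2 < s2'" "s2' < e"
    "dt l u G s2 x0 * dt l u G s2' x0 < 0" .
  have "((\<lambda>x. G s1 x * G s1' x) \<longlongrightarrow> G s1 x0 * G s1' x0) (nhds x0)"
    "((\<lambda>x. dt l u G s2 x * dt l u G s2' x) \<longlongrightarrow> dt l u G s2 x0 * dt l u G s2' x0) (nhds x0)"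
    using cont s1 s2 by (auto intro!: tendsto_intros simp: isCont_def tendsto_at_iff_tendsto_nhds)
  then have "\<forall>\<^sub>F x in nhds x0. G s1 x * G s1' x < 0" "\<forall>\<^sub>F x in nhds x0. dt l u G s2 x * dt l u G s2' x < 0"
    using s1(5) s2(5) by (auto dest: order_tendstoD(2))
  then have "\<forall>\<^sub>F x in nhds x0. x \<in> ?X"
  proof eventually_elim
    case (elim x)
    have der: "((\<lambda>s. G s x) has_real_derivative dt l u G s x) (at s)" if "a < s" "s < e" for s
      using dt_exists_imp_deriv[OF diff[of s x]] that at_eq[OF that] by simp
    have "continuous_on {s1..s1'} (\<lambda>s. G s x)"
      using der s1 by (intro continuous_at_imp_continuous_on ballI DERIV_isCont) (auto intro: der)
    then have "\<exists>s\<in>{s1..s1'}. G s x = 0"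
      using elim(1) s1 IVT'[of "\<lambda>s. G s x" s1 0 s1'] IVT2'[of "\<lambda>s. G s x" s1' 0 s1]
      by (fastforce simp: mult_less_0_iff)
    then obtain z1 where z1: "z1 \<in> {s1..s1'}" "G z1 x = 0" by blast
    obtain z2 where z2: "s2 < z2" "z2 < s2'" "dt l u G z2 x = 0"
    proof (rule derivative_zero_between[of s2 s2' "\<lambda>s. G s x" "\<lambda>s. dt l u G s x"])
      show "((\<lambda>s. G s x) has_real_derivative dt l u G s x) (at s)" if "s \<in> {s2..s2'}" for s
        using that s2 by (intro der) auto
    qed (use s2 elim(2) in auto)
    show "x \<in> ?X"
      unfolding mem_zero_locus_Hmap using z1 z2 s1 s2 by (intro bexI[of _ z1] bexI[of _ z2]) auto
  qed
  then show "x0 \<in> interior ?X"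
    by (auto simp: eventually_nhds interior_def)
qed

text \<open>
  A zero \<open>(t1, t2)\<close> of \<open>H\<close> with \<open>Q1 \<noteq> 0\<close> that is not in the open square has \<open>t1\<close> or \<open>t2\<close> among
  the endpoints. As \<open>V \<noteq> 0\<close> forces both gradients to be nonzero, \<open>x\<close> is a regular zero of \<open>G\<close> or \<open>G'\<close>
  at an endpoint.
\<close>

lemma degenerate_zeros_negligible:
  fixes G :: "real \<Rightarrow> 'a::euclidean_space \<Rightarrow> real"
  assumes le: "a < e"
    and reg: "regular_on l u G {a..e} (zero_locus (Hmap l u G) ({a..e} \<times> {a..e}))"
  shows "negligible (zero_locus (Hmap l u G) ({a..e} \<times> {a..e})
    - Xi (Hmap l u G) (Q1 l u G) ({a..e} \<times> {a..e}) - nondegenerate_zeros l u G a e)"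
proof -
  let ?X = "zero_locus (Hmap l u G) ({a..e} \<times> {a..e})"
  define Z where "Z f = {x. f x = 0 \<and> (\<exists>D. D \<noteq> 0 \<and> GDERIV f x :> D)}" for f :: "'a \<Rightarrow> real"
  have "negligible (Z (G a) \<union> Z (G e) \<union> Z (dt l u G a) \<union> Z (dt l u G e))"
    unfolding Z_def by (intro negligible_Un negligible_regular_zeros)
  moreover have "?X - Xi (Hmap l u G) (Q1 l u G) ({a..e} \<times> {a..e}) - nondegenerate_zeros l u G a e
    \<subseteq> Z (G a) \<union> Z (G e) \<union> Z (dt l u G a) \<union> Z (dt l u G e)"
  proof
    fix x assume x: "x \<in> ?X - Xi (Hmap l u G) (Q1 l u G) ({a..e} \<times> {a..e}) - nondegenerate_zeros l u G a e"
    then have "zero_params (Hmap l u G) ({a..e} \<times> {a..e}) x \<noteq> {}"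
      unfolding zero_locus_def zero_params_def by blast
    with x obtain p where p: "p \<in> {a..e} \<times> {a..e}" "Hmap l u G p x = 0" "Q1 l u G p x \<noteq> 0"
      unfolding Xi_def zero_params_def by blast
    obtain t1 t2 where [simp]: "p = (t1, t2)" by (cases p)
    from p have t: "t1 \<in> {a..e}" "t2 \<in> {a..e}" "G t1 x = 0" "dt l u G t2 x = 0" "V l u G (t1, t2) x \<noteq> 0"
      by (auto simp: Hmap_def Q1_def zero_prod_def)
    then have "grad (G t1) x \<noteq> 0" "grad (dt l u G t2) x \<noteq> 0"
      by (auto simp: V_def)
    moreover have xX: "x \<in> ?X" using x by blast
    ultimately have ZZ: "x \<in> Z (G t1)" "x \<in> Z (dt l u G t2)"
      using t regular_onD(3)[OF reg t(1) xX] regular_onD(4)[OF reg t(2) xX] unfolding Z_def by blast+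
    have "\<not> (t1 \<in> {a<..<e} \<and> t2 \<in> {a<..<e})"
      using x p by (auto simp: nondegenerate_zeros_def)
    then have "t1 = a \<or> t1 = e \<or> t2 = a \<or> t2 = e" using t by auto
    with ZZ show "x \<in> Z (G a) \<union> Z (G e) \<union> Z (dt l u G a) \<union> Z (dt l u G e)" by auto
  qed
  ultimately show ?thesis by (rule negligible_subset)
qed

text \<open>
  Near a nondegenerate zero the two times are implicit functions \<open>T1\<close> and \<open>T2\<close>. Their gradients are
  \<open>- \<nabla>G / G'\<close> and \<open>- \<nabla>G' / G''\<close>, so \<open>f / \<surd>gram\<close> is the integrand of \<open>K\<close> with \<open>f\<close> in place of
  \<open>\<rho>\<close>, restricted to the zeros of \<open>H\<close> that are found by \<open>(T1, T2)\<close>. The functions \<open>w t\<close> are minorants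
  of that integrand that vanish off \<open>B\<close>.
\<close>

lemma nondegenerate_zero_chart:
  fixes G :: "real \<Rightarrow> real ^ 'n \<Rightarrow> real"
  assumes le: "l \<le> a" "e < u"
    and diff: "\<And>t x. t \<in> {a..e} \<Longrightarrow> dt_exists l u G t x"
    and reg: "regular_on l u G {a..e} (zero_locus (Hmap l u G) ({a..e} \<times> {a..e}))"
    and x0: "x0 \<in> nondegenerate_zeros l u G a e"
  obtains r where "r > 0" "ball x0 r \<subseteq> zero_locus (Hmap l u G) ({a..e} \<times> {a..e})"
    "\<forall>B\<in>sets borel. \<forall>f\<in>borel_measurable borel. B \<subseteq> ball x0 r \<longrightarrow> (\<forall>x. 0 \<le> f x) \<longrightarrow>
      (\<exists>h w. h \<in> borel_measurable borel \<and> (\<forall>t. w t \<in> borel_measurable borel) \<and>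
        (\<integral>\<^sup>+x\<in>B. ennreal (f x) \<partial>lborel) = (\<integral>\<^sup>+t. h t \<partial>lborel) \<and>
        (\<forall>t. t \<notin> {a..e} \<times> {a..e} \<longrightarrow> h t = 0) \<and>
        (\<forall>t. ennreal (unit_ball_vol (CARD('n) - 2) / 4 ^ (CARD('n) - 2)) * h t
          \<le> ennreal (2 * CARD('n)) * (\<integral>\<^sup>+x. w t x \<partial>hausdorff_measure (CARD('n) - 2))) \<and>
        (\<forall>t1 t2 x. w (t1, t2) x \<le> ennreal (f x * (\<bar>dt l u G t1 x\<bar> * \<bar>dt2 l u G t2 x\<bar>))
            / ennreal (sqrt (V l u G (t1, t2) x)) * indicator (zero_locus (Hmap l u G) {(t1, t2)}) x
            * indicator B x))"
proof -
  let ?X = "zero_locus (Hmap l u G) ({a..e} \<times> {a..e})"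
  let ?U = "interior ?X"
  have U: "open ?U" "?U \<subseteq> ?X" by (auto intro: interior_subset[THEN subsetD])
  have x0U: "x0 \<in> ?U"
    using nondegenerate_zeros_subset_interior[OF le diff reg] x0 by blast
  from x0 obtain \<tau>1 \<tau>2 where \<tau>: "a < \<tau>1" "\<tau>1 < e" "a < \<tau>2" "\<tau>2 < e"
    and z: "G \<tau>1 x0 = 0" "dt l u G \<tau>2 x0 = 0"
    and n: "dt l u G \<tau>1 x0 \<noteq> 0" "dt2 l u G \<tau>2 x0 \<noteq> 0" "V l u G (\<tau>1, \<tau>2) x0 \<noteq> 0"
    by (auto simp: nondegenerate_zeros_def Hmap_def Q1_def zero_prod_def)
  have at_eq: "at s within {l..u} = at s" if "s \<in> {a<..<e}" for s
    using that le by (intro at_within_Icc_at) auto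
  have sub: "{a<..<e} \<times> ?U \<subseteq> {a..e} \<times> ?X" using U by auto
  have cont: "continuous_on ({a<..<e} \<times> ?U) (\<lambda>(t, x). dt l u G t x)"
    "continuous_on ({a<..<e} \<times> ?U) (\<lambda>(t, x). dt2 l u G t x)"
    "continuous_on ({a<..<e} \<times> ?U) (\<lambda>(t, x). grad (G t) x)"
    "continuous_on ({a<..<e} \<times> ?U) (\<lambda>(t, x). grad (dt l u G t) x)"
    using reg by (auto simp: regular_on_def intro: continuous_on_subset[OF _ sub])
  obtain r1 T1 where r1: "r1 > 0" "ball x0 r1 \<subseteq> ?U" "T1 x0 = \<tau>1" and
    T1: "\<And>x. x \<in> ball x0 r1 \<Longrightarrow> a < T1 x \<and> T1 x < e \<and> G (T1 x) x = 0 \<and> dt l u G (T1 x) x \<noteq> 0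
      \<and> GDERIV T1 x :> (- 1 / dt l u G (T1 x) x) *\<^sub>R grad (G (T1 x)) x"
  proof (rule implicit_scalar_function[where U = ?U and a = a and \<tau> = \<tau>1 and b = e and f = G
        and d = "dt l u G" and g = "\<lambda>t x. grad (G t) x", OF U(1) x0U \<tau>(1,2)])
    show "((\<lambda>s. G s x) has_real_derivative dt l u G t x) (at t)" if "t \<in> {a<..<e}" "x \<in> ?U" for t x
      using regular_onD(1)[OF reg, of t x] that at_eq[OF that(1)] U(2) by auto
    show "GDERIV (G t) x :> grad (G t) x" if "t \<in> {a<..<e}" "x \<in> ?U" for t x
      using regular_onD(3)[OF reg, of t x] that U(2) by auto
  qed (use that cont z n in blast)+
  obtain r2 T2 where r2: "r2 > 0" "ball x0 r2 \<subseteq> ?U" "T2 x0 = \<tau>2" and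
    T2: "\<And>x. x \<in> ball x0 r2 \<Longrightarrow> a < T2 x \<and> T2 x < e \<and> dt l u G (T2 x) x = 0 \<and> dt2 l u G (T2 x) x \<noteq> 0
      \<and> GDERIV T2 x :> (- 1 / dt2 l u G (T2 x) x) *\<^sub>R grad (dt l u G (T2 x)) x"
  proof (rule implicit_scalar_function[where U = ?U and a = a and \<tau> = \<tau>2 and b = e and f = "dt l u G"
        and d = "dt2 l u G" and g = "\<lambda>t x. grad (dt l u G t) x", OF U(1) x0U \<tau>(3,4)])
    show "((\<lambda>s. dt l u G s x) has_real_derivative dt2 l u G t x) (at t)" if "t \<in> {a<..<e}" "x \<in> ?U" for t x
      using regular_onD(2)[OF reg, of t x] that at_eq[OF that(1)] U(2) by auto
    show "GDERIV (dt l u G t) x :> grad (dt l u G t) x" if "t \<in> {a<..<e}" "x \<in> ?U" for t x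
      using regular_onD(4)[OF reg, of t x] that U(2) by auto
  qed (use that cont z n in blast)+
  define r0 where "r0 = min r1 r2"
  have r0: "r0 > 0" "x0 \<in> ball x0 r0" "ball x0 r0 \<subseteq> ball x0 r1" "ball x0 r0 \<subseteq> ball x0 r2"
    using r1 r2 by (auto simp: r0_def)
  define p where "p x = (- 1 / dt l u G (T1 x) x) *\<^sub>R grad (G (T1 x)) x" for x
  define q where "q x = (- 1 / dt2 l u G (T2 x) x) *\<^sub>R grad (dt l u G (T2 x)) x" for x
  have derp: "GDERIV T1 x :> p x" and derq: "GDERIV T2 x :> q x" if "x \<in> ball x0 r0" for x
    using T1[of x] T2[of x] that r0 by (auto simp: p_def q_def)
  have cT: "continuous_on (ball x0 r0) T1" "continuous_on (ball x0 r0) T2"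
    using derp derq by (auto intro!: continuous_at_imp_continuous_on GDERIV_isCont)
  have comp: "continuous_on (ball x0 r0) (\<lambda>x. F (T x) x)"
    if "continuous_on ({a<..<e} \<times> ?U) (\<lambda>(t, x). F t x)" "continuous_on (ball x0 r0) T"
      "\<And>x. x \<in> ball x0 r0 \<Longrightarrow> T x \<in> {a<..<e}" for F :: "real \<Rightarrow> real ^ 'n \<Rightarrow> 'z::topological_space" and T
  proof -
    have "continuous_on (ball x0 r0) ((\<lambda>(t, x). F t x) \<circ> (\<lambda>x. (T x, x)))"
      using that r0 r1 by (intro continuous_on_compose continuous_on_subset[OF that(1)])
        (auto intro!: continuous_intros)
    then show ?thesis by (simp add: o_def)
  qed
  have T12: "T1 x \<in> {a<..<e}" "T2 x \<in> {a<..<e}" if "x \<in> ball x0 r0" for x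
    using T1[of x] T2[of x] that r0 by auto
  have cp: "continuous_on (ball x0 r0) p"
    unfolding p_def using comp[OF cont(1) cT(1) T12(1)] comp[OF cont(3) cT(1) T12(1)] T1 r0
    by (intro continuous_intros) auto
  have cq: "continuous_on (ball x0 r0) q"
    unfolding q_def using comp[OF cont(2) cT(2) T12(2)] comp[OF cont(4) cT(2) T12(2)] T2 r0
    by (intro continuous_intros) auto
  have gram_pq: "gram (p x) (q x)
      = V l u G (T1 x, T2 x) x / (dt l u G (T1 x) x * dt2 l u G (T2 x) x)\<^sup>2" for x
    unfolding p_def q_def gram_scaleR V_eq_gram by (simp add: power_mult_distrib power_divide)
  have gram0: "gram (p x0) (q x0) > 0"
    using n r1(3) r2(3) gram_nonneg[of "p x0" "q x0"] by (auto simp: gram_pq less_le)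
  obtain r where r: "r > 0" "ball x0 r \<subseteq> ball x0 r0" and
    coarea_DIM: "\<forall>B\<in>sets borel. \<forall>f\<in>borel_measurable borel. B \<subseteq> ball x0 r \<longrightarrow> (\<forall>x. 0 \<le> f x) \<longrightarrow>
      (\<exists>h\<in>borel_measurable borel.
        (\<integral>\<^sup>+x\<in>B. ennreal (f x) \<partial>lborel) = (\<integral>\<^sup>+t. h t \<partial>lborel) \<and>
        (\<forall>t. (\<lambda>x. ennreal (f x / sqrt (gram (p x) (q x))) * indicator {x \<in> B. (T1 x, T2 x) = t} x)
            \<in> borel_measurable borel \<and>
          ennreal (unit_ball_vol (DIM(real ^ 'n) - 2) / 4 ^ (DIM(real ^ 'n) - 2)) * h t
          \<le> ennreal (2 * DIM(real ^ 'n)) * (\<integral>\<^sup>+x\<in>{x \<in> B. (T1 x, T2 x) = t}.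
                ennreal (f x / sqrt (gram (p x) (q x))) \<partial>hausdorff_measure (DIM(real ^ 'n) - 2))))"
    by (rule coarea_inequality_local[OF open_ball r0(2) derp derq cp cq gram0])
  have dim: "DIM(real ^ 'n) = CARD('n)" by simp
  note coarea = coarea_DIM[unfolded dim]
  show thesis
  proof (rule that[OF r(1)], goal_cases)
    case 1
    show ?case using r r0 r1 U by blast
  next
    case 2
    show ?case
    proof (intro ballI impI)
      fix B and f :: "real ^ 'n \<Rightarrow> real"
      assume B: "B \<in> sets borel" "B \<subseteq> ball x0 r" and "f \<in> borel_measurable borel" "\<forall>x. 0 \<le> f x"
      then have f: "f \<in> borel_measurable borel" "\<And>x. 0 \<le> f x" by auto
      define w where "w t x = ennreal (f x / sqrt (gram (p x) (q x))) * indicator {x \<in> B. (T1 x, T2 x) = t} x" for t x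
      obtain h where h: "h \<in> borel_measurable borel"
        "(\<integral>\<^sup>+x\<in>B. ennreal (f x) \<partial>lborel) = (\<integral>\<^sup>+t. h t \<partial>lborel)" "\<And>t. w t \<in> borel_measurable borel"
        "\<And>t. ennreal (unit_ball_vol (CARD('n) - 2) / 4 ^ (CARD('n) - 2)) * h t
            \<le> ennreal (2 * CARD('n)) * (\<integral>\<^sup>+x. w t x \<partial>hausdorff_measure (CARD('n) - 2))"
        using coarea[rule_format, OF B(1) f(1) B(2) f(2)] unfolding w_def by blast
      have "h t = 0" if "t \<notin> {a..e} \<times> {a..e}" for t
      proof -
        have "w t x = 0" for x
          using that T12[of x] B(2) r(2) by (cases t) (auto simp: w_def indicator_def)
        then have "ennreal (unit_ball_vol (CARD('n) - 2) / 4 ^ (CARD('n) - 2)) * h t = 0"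
          using h(4)[of t] by simp
        moreover have "unit_ball_vol (real (CARD('n) - 2)) \<noteq> 0"
          by (rule less_imp_neq[THEN not_sym]) (rule unit_ball_vol_pos, simp)
        ultimately show ?thesis by simp
      qed
      moreover have "w (t1, t2) x \<le> ennreal (f x * (\<bar>dt l u G t1 x\<bar> * \<bar>dt2 l u G t2 x\<bar>))
              / ennreal (sqrt (V l u G (t1, t2) x)) * indicator (zero_locus (Hmap l u G) {(t1, t2)}) x
              * indicator B x" for t1 t2 x
      proof (cases "x \<in> B \<and> T1 x = t1 \<and> T2 x = t2")
        case True
        then have xB: "x \<in> ball x0 r1" "x \<in> ball x0 r2" using B(2) r(2) r0 by blast+
        have "x \<in> zero_locus (Hmap l u G) {(t1, t2)}"
          using True T1[OF xB(1)] T2[OF xB(2)] by (auto simp: zero_locus_def Hmap_def zero_prod_def)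
        moreover have "ennreal (f x / sqrt (gram (p x) (q x))) \<le> ennreal (f x * (\<bar>dt l u G t1 x\<bar> * \<bar>dt2 l u G t2 x\<bar>))
              / ennreal (sqrt (V l u G (t1, t2) x))"
        proof (cases "V l u G (t1, t2) x = 0")
          case False
          then have V: "V l u G (t1, t2) x > 0"
            using gram_nonneg by (auto simp: V_eq_gram less_le)
          have "sqrt (gram (p x) (q x)) = sqrt (V l u G (t1, t2) x) / (\<bar>dt l u G t1 x\<bar> * \<bar>dt2 l u G t2 x\<bar>)"
            using True by (simp add: gram_pq real_sqrt_divide abs_mult)
          then show ?thesis
            using V f(2)[of x] by (simp add: divide_ennreal)
        qed (use True in \<open>simp add: gram_pq\<close>)
        ultimately show ?thesis using True by (simp add: w_def)
      qed (auto simp: w_def)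
      ultimately show "\<exists>h w. h \<in> borel_measurable borel \<and> (\<forall>t. w t \<in> borel_measurable borel) \<and>
          (\<integral>\<^sup>+x\<in>B. ennreal (f x) \<partial>lborel) = (\<integral>\<^sup>+t. h t \<partial>lborel) \<and>
          (\<forall>t. t \<notin> {a..e} \<times> {a..e} \<longrightarrow> h t = 0) \<and>
          (\<forall>t. ennreal (unit_ball_vol (CARD('n) - 2) / 4 ^ (CARD('n) - 2)) * h t
            \<le> ennreal (2 * CARD('n)) * (\<integral>\<^sup>+x. w t x \<partial>hausdorff_measure (CARD('n) - 2))) \<and>
          (\<forall>t1 t2 x. w (t1, t2) x \<le> ennreal (f x * (\<bar>dt l u G t1 x\<bar> * \<bar>dt2 l u G t2 x\<bar>))
              / ennreal (sqrt (V l u G (t1, t2) x)) * indicator (zero_locus (Hmap l u G) {(t1, t2)}) x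
              * indicator B x)"
        using h by blast
    qed
  qed
qed

text \<open>
  Countably many charts cover the nondegenerate zeros. Cut to disjoint sets \<open>B k\<close>, they provide for each
  \<open>t\<close> functions with disjoint supports below the integrand of \<open>K\<close>, so the fibre integrals add up to at most
  \<open>K l u G \<rho> t\<close>. A Borel function \<open>f \<le> \<rho>\<close> replaces \<open>\<rho>\<close>, which may fail to be measurable on fibres.
\<close>

lemma nn_integral_nondegenerate_zeros_le:
  fixes G :: "real \<Rightarrow> real ^ 'n \<Rightarrow> real" and f \<rho> :: "real ^ 'n \<Rightarrow> real"
    and C :: "real \<times> real \<Rightarrow> real"
  assumes le: "l \<le> a" "e < u"
    and diff: "\<And>t x. t \<in> {a..e} \<Longrightarrow> dt_exists l u G t x"
    and reg: "regular_on l u G {a..e} (zero_locus (Hmap l u G) ({a..e} \<times> {a..e}))"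
    and f [measurable]: "f \<in> borel_measurable borel" and fnn: "\<And>x. 0 \<le> f x" and f\<rho>: "\<And>x. f x \<le> \<rho> x"
    and C: "set_integrable lebesgue ({a..e} \<times> {a..e}) C"
    and KC: "AE p in lebesgue. p \<in> {a..e} \<times> {a..e} \<longrightarrow> K l u G \<rho> p \<le> ennreal (C p)"
  obtains W where "open W" "nondegenerate_zeros l u G a e \<subseteq> W"
    "W \<subseteq> zero_locus (Hmap l u G) ({a..e} \<times> {a..e})"
    "ennreal (unit_ball_vol (CARD('n) - 2) / 4 ^ (CARD('n) - 2)) * (\<integral>\<^sup>+x\<in>W. ennreal (f x) \<partial>lborel)
      \<le> ennreal (2 * CARD('n)) * (\<integral>\<^sup>+p\<in>{a..e} \<times> {a..e}. ennreal (C p) \<partial>lebesgue)"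
proof (cases "nondegenerate_zeros l u G a e = {}")
  case True
  show thesis by (rule that[of "{}"]) (use True in auto)
next
  case False
  let ?X = "zero_locus (Hmap l u G) ({a..e} \<times> {a..e})" and ?N = "nondegenerate_zeros l u G a e"
  let ?\<kappa> = "ennreal (unit_ball_vol (CARD('n) - 2) / 4 ^ (CARD('n) - 2))" and ?c = "ennreal (2 * CARD('n))"
  let ?H = "hausdorff_measure (CARD('n) - 2) :: (real ^ 'n) measure"
  define P where "P B h w \<longleftrightarrow> h \<in> borel_measurable borel \<and> (\<forall>t. w t \<in> borel_measurable borel) \<and>
        (\<integral>\<^sup>+x\<in>B. ennreal (f x) \<partial>lborel) = (\<integral>\<^sup>+t. h t \<partial>lborel) \<and>
        (\<forall>t. t \<notin> {a..e} \<times> {a..e} \<longrightarrow> h t = 0) \<and>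
        (\<forall>t. ?\<kappa> * h t \<le> ?c * (\<integral>\<^sup>+x. w t x \<partial>?H)) \<and>
        (\<forall>t1 t2 x. w (t1, t2) x \<le> ennreal (f x * (\<bar>dt l u G t1 x\<bar> * \<bar>dt2 l u G t2 x\<bar>))
            / ennreal (sqrt (V l u G (t1, t2) x)) * indicator (zero_locus (Hmap l u G) {(t1, t2)}) x
            * indicator B x)" for B and h :: "real \<times> real \<Rightarrow> ennreal" and w
  have "\<exists>r>0. ball x r \<subseteq> ?X \<and> (\<forall>B\<in>sets borel. B \<subseteq> ball x r \<longrightarrow> (\<exists>h w. P B h w))" if xN: "x \<in> ?N" for x
  proof -
    obtain r where r: "r > 0" "ball x r \<subseteq> ?X" and *: "\<forall>B\<in>sets borel. \<forall>f\<in>borel_measurable borel. B \<subseteq> ball x r \<longrightarrow> (\<forall>x. 0 \<le> f x) \<longrightarrow>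
      (\<exists>h w. h \<in> borel_measurable borel \<and> (\<forall>t. w t \<in> borel_measurable borel) \<and>
        (\<integral>\<^sup>+x\<in>B. ennreal (f x) \<partial>lborel) = (\<integral>\<^sup>+t. h t \<partial>lborel) \<and>
        (\<forall>t. t \<notin> {a..e} \<times> {a..e} \<longrightarrow> h t = 0) \<and>
        (\<forall>t. ?\<kappa> * h t \<le> ?c * (\<integral>\<^sup>+x. w t x \<partial>?H)) \<and>
        (\<forall>t1 t2 x. w (t1, t2) x \<le> ennreal (f x * (\<bar>dt l u G t1 x\<bar> * \<bar>dt2 l u G t2 x\<bar>))
            / ennreal (sqrt (V l u G (t1, t2) x)) * indicator (zero_locus (Hmap l u G) {(t1, t2)}) x
            * indicator B x))"
      by (rule nondegenerate_zero_chart[OF le diff reg xN])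
    have "\<exists>h w. P B h w" if "B \<in> sets borel" "B \<subseteq> ball x r" for B
      unfolding P_def using *[rule_format, OF that(1) f that(2) fnn] .
    with r show ?thesis by blast
  qed
  then obtain r where r: "\<And>x. x \<in> ?N \<Longrightarrow> r x > 0" "\<And>x. x \<in> ?N \<Longrightarrow> ball x (r x) \<subseteq> ?X"
    "\<And>x B. x \<in> ?N \<Longrightarrow> B \<in> sets borel \<Longrightarrow> B \<subseteq> ball x (r x) \<Longrightarrow> \<exists>h w. P B h w"
    by metis
  obtain \<F> where \<F>: "\<F> \<subseteq> (\<lambda>x. ball x (r x)) ` ?N" "countable \<F>" "\<Union>\<F> = (\<Union>x\<in>?N. ball x (r x))"
    using Lindelof[of "(\<lambda>x. ball x (r x)) ` ?N"] by auto
  have NF: "?N \<subseteq> \<Union>\<F>" using r(1) unfolding \<F>(3) by force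
  with False have "\<F> \<noteq> {}" by auto
  with \<F>(2) obtain b where b: "\<F> = range (b :: nat \<Rightarrow> _)" by (metis uncountable_def)
  define B where "B = disjointed b"
  have b_in: "\<exists>x\<in>?N. b k = ball x (r x)" for k using \<F>(1) b by blast
  have b_open: "open (b k)" for k using b_in[of k] by auto
  have B_sets [measurable]: "B k \<in> sets borel" for k
    unfolding B_def disjointed_def by (intro sets.Diff sets.finite_UN borel_open b_open) auto
  have B_disj: "disjoint_family B" and B_Un: "(\<Union>k. B k) = \<Union>\<F>"
    by (simp_all add: B_def disjoint_family_disjointed UN_disjointed_eq b)
  have "\<exists>h w. P (B k) h w" for k
  proof -
    obtain x where "x \<in> ?N" "b k = ball x (r x)" using b_in by blast
    moreover have "B k \<subseteq> b k" by (simp add: B_def disjointed_subset)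
    ultimately show ?thesis using r(3)[of x "B k"] by simp
  qed
  then obtain h w where "\<And>k. P (B k) (h k) (w k)" by metis
  then have h [measurable]: "h k \<in> borel_measurable borel"
    and w: "w k t \<in> borel_measurable borel"
    and eq: "(\<integral>\<^sup>+x\<in>B k. ennreal (f x) \<partial>lborel) = (\<integral>\<^sup>+t. h k t \<partial>lborel)"
    and h0: "t \<notin> {a..e} \<times> {a..e} \<Longrightarrow> h k t = 0"
    and hw: "?\<kappa> * h k t \<le> ?c * (\<integral>\<^sup>+x. w k t x \<partial>?H)"
    and wle: "w k (t1, t2) x \<le> ennreal (f x * (\<bar>dt l u G t1 x\<bar> * \<bar>dt2 l u G t2 x\<bar>))
            / ennreal (sqrt (V l u G (t1, t2) x)) * indicator (zero_locus (Hmap l u G) {(t1, t2)}) x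
            * indicator (B k) x" for k t t1 t2 x
    unfolding P_def by blast+
  have hK: "?\<kappa> * (\<Sum>k. h k (t1, t2)) \<le> ?c * K l u G \<rho> (t1, t2)" for t1 t2
  proof -
    let ?t = "(t1, t2)"
    let ?g = "\<lambda>x. ennreal (f x * (\<bar>dt l u G t1 x\<bar> * \<bar>dt2 l u G t2 x\<bar>))
            / ennreal (sqrt (V l u G ?t x)) * indicator (zero_locus (Hmap l u G) {?t}) x"
    have wH: "w k ?t \<in> borel_measurable ?H" for k
      using w[of k ?t] borel_subset_sets_hausdorff[of "CARD('n) - 2", where 'a="real ^ 'n"]
      by (auto simp: measurable_def hausdorff_measure_def)
    have "?\<kappa> * (\<Sum>k. h k ?t) = (\<Sum>k. ?\<kappa> * h k ?t)"
      by simp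
    also have "\<dots> \<le> (\<Sum>k. ?c * (\<integral>\<^sup>+x. w k ?t x \<partial>?H))"
      by (intro suminf_le hw) auto
    also have "\<dots> = ?c * (\<Sum>k. (\<integral>\<^sup>+x. w k ?t x \<partial>?H))"
      by simp
    also have "(\<Sum>k. (\<integral>\<^sup>+x. w k ?t x \<partial>?H)) = (\<integral>\<^sup>+x. (\<Sum>k. w k ?t x) \<partial>?H)"
      by (intro nn_integral_suminf[symmetric] wH)
    also have "\<dots> \<le> K l u G \<rho> ?t"
      unfolding K_def prod.case
    proof (rule nn_integral_mono)
      fix x
      have "(\<Sum>k. w k ?t x) \<le> (\<Sum>k. ?g x * indicator (B k) x)"
        by (intro suminf_le wle) auto
      also have "\<dots> = ?g x * indicator (\<Union>k. B k) x"
        by (simp add: suminf_indicator[OF B_disj])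
      also have "\<dots> \<le> ?g x" by (auto simp: indicator_def)
      also have "\<dots> \<le> ennreal (\<rho> x * (\<bar>dt l u G t1 x\<bar> * \<bar>dt2 l u G t2 x\<bar>))
            / ennreal (sqrt (V l u G ?t x)) * indicator (zero_locus (Hmap l u G) {?t}) x"
        by (intro mult_right_mono divide_right_mono_ennreal ennreal_leI f\<rho>) auto
      finally show "(\<Sum>k. w k ?t x) \<le> ennreal (\<rho> x * (\<bar>dt l u G t1 x\<bar> * \<bar>dt2 l u G t2 x\<bar>))
            / ennreal (sqrt (V l u G ?t x)) * indicator (zero_locus (Hmap l u G) {?t}) x" .
    qed
    finally show ?thesis by (simp add: mult_left_mono)
  qed
  have "?\<kappa> * (\<integral>\<^sup>+x\<in>\<Union>\<F>. ennreal (f x) \<partial>lborel) = ?\<kappa> * (\<Sum>k. (\<integral>\<^sup>+x\<in>B k. ennreal (f x) \<partial>lborel))"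
  proof -
    have "(\<integral>\<^sup>+x\<in>\<Union>\<F>. ennreal (f x) \<partial>lborel) = (\<integral>\<^sup>+x. (\<Sum>k. ennreal (f x) * indicator (B k) x) \<partial>lborel)"
      unfolding B_Un[symmetric] by (simp add: suminf_indicator[OF B_disj])
    also have "\<dots> = (\<Sum>k. (\<integral>\<^sup>+x\<in>B k. ennreal (f x) \<partial>lborel))"
      by (intro nn_integral_suminf) measurable
    finally show ?thesis by simp
  qed
  also have "\<dots> = ?\<kappa> * (\<integral>\<^sup>+t. (\<Sum>k. h k t) \<partial>lborel)"
    unfolding eq by (subst nn_integral_suminf) auto
  also have "\<dots> = (\<integral>\<^sup>+t. ?\<kappa> * (\<Sum>k. h k t) \<partial>lborel)"
    by (intro nn_integral_cmult[symmetric]) measurable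
  also have "\<dots> = (\<integral>\<^sup>+t. ?\<kappa> * (\<Sum>k. h k t) \<partial>lebesgue)"
    by (rule nn_integral_completion[symmetric])
  also have "\<dots> \<le> (\<integral>\<^sup>+p. ?c * (ennreal (C p) * indicator ({a..e} \<times> {a..e}) p) \<partial>lebesgue)"
  proof (rule nn_integral_mono_AE)
    from KC show "AE p in lebesgue. ?\<kappa> * (\<Sum>k. h k p) \<le> ?c * (ennreal (C p) * indicator ({a..e} \<times> {a..e}) p)"
    proof eventually_elim
      case (elim p)
      show ?case
      proof (cases "p \<in> {a..e} \<times> {a..e}")
        case True
        have "?\<kappa> * (\<Sum>k. h k p) \<le> ?c * K l u G \<rho> p" using hK by (cases p) simp
        also have "\<dots> \<le> ?c * ennreal (C p)" using elim True by (intro mult_left_mono) auto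
        finally show ?thesis using True by simp
      next
        case out: False
        then show ?thesis using h0[OF out] by simp
      qed
    qed
  qed
  also have "\<dots> = ?c * (\<integral>\<^sup>+p\<in>{a..e} \<times> {a..e}. ennreal (C p) \<partial>lebesgue)"
  proof (rule nn_integral_cmult)
    have "(\<lambda>p. indicator ({a..e} \<times> {a..e}) p *\<^sub>R C p) \<in> borel_measurable lebesgue"
      using C unfolding set_integrable_def by (rule borel_measurable_integrable)
    then have "(\<lambda>p. ennreal (indicator ({a..e} \<times> {a..e}) p *\<^sub>R C p)) \<in> borel_measurable lebesgue"
      by measurable
    also have "(\<lambda>p. ennreal (indicator ({a..e} \<times> {a..e}) p *\<^sub>R C p))
        = (\<lambda>p. ennreal (C p) * indicator ({a..e} \<times> {a..e}) p)"
      by (auto split: split_indicator)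
    finally show "(\<lambda>p. ennreal (C p) * indicator ({a..e} \<times> {a..e}) p) \<in> borel_measurable lebesgue" .
  qed
  finally have "?\<kappa> * (\<integral>\<^sup>+x\<in>\<Union>\<F>. ennreal (f x) \<partial>lborel)
      \<le> ?c * (\<integral>\<^sup>+p\<in>{a..e} \<times> {a..e}. ennreal (C p) \<partial>lebesgue)" .
  moreover have "open (\<Union>\<F>)" using b_open by (auto simp: b)
  moreover have "\<Union>\<F> \<subseteq> ?X" using r(2) unfolding \<F>(3) by blast
  ultimately show thesis using NF that by blast
qed

text \<open>
  Lebesgue measure is complete.
\<close>

lemma borel_measurable_lebesgue_AE:
  fixes f g :: "'a::euclidean_space \<Rightarrow> real"
  assumes f: "f \<in> borel_measurable lebesgue" and eq: "AE x in lebesgue. f x = g x"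
  shows "g \<in> borel_measurable lebesgue"
proof (rule measurableI)
  fix A :: "real set" assume A: "A \<in> sets borel"
  show "g -` A \<inter> space lebesgue \<in> sets lebesgue"
  proof (rule completion.in_sets_AE)
    show "f -` A \<inter> space lebesgue \<in> sets lebesgue" by (rule measurable_sets[OF f A])
    show "AE x in lebesgue. x \<in> f -` A \<inter> space lebesgue \<longleftrightarrow> x \<in> g -` A \<inter> space lebesgue"
      using eq by eventually_elim auto
  qed auto
qed simp

text \<open>
  Fubini's theorem for a function that is only Lebesgue measurable on the plane: it agrees almost everywhere
  with a Borel function, hence so do almost all of its sections.
\<close>

lemma set_integral_lebesgue_Times:
  fixes C :: "real \<times> real \<Rightarrow> real"
  assumes C: "set_integrable lebesgue (S \<times> T) C"
  shows "(LINT p:S \<times> T|lebesgue. C p) = (LINT s:S|lebesgue. (LINT t:T|lebesgue. C (s, t)))"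
proof -
  define D where "D p = indicator (S \<times> T) p *\<^sub>R C p" for p
  have D: "integrable lebesgue D" using C by (simp add: set_integrable_def D_def[abs_def])
  obtain D' where D' [measurable]: "D' \<in> borel_measurable lborel" and eq: "AE p in lborel. D p = D' p"
    using completion_ex_borel_measurable_real[OF borel_measurable_integrable[OF D]] by auto
  have eqL: "AE p in lebesgue. D p = D' p" using eq by (rule AE_completion)
  have D'L: "D' \<in> borel_measurable lebesgue" by (rule measurable_completion[OF D'])
  have "integrable lebesgue D'"
    using D eqL by (rule integrable_cong_AE_imp[OF _ D'L]) 
  then have D'int: "integrable (lborel \<Otimes>\<^sub>M lborel) D'"
    by (simp add: integrable_completion lborel_prod)
  have "(LINT p:S \<times> T|lebesgue. C p) = (LINT p|lebesgue. D p)"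
    by (simp add: set_lebesgue_integral_def D_def)
  also have "\<dots> = (LINT p|lebesgue. D' p)"
    by (rule integral_cong_AE[OF borel_measurable_integrable[OF D] D'L eqL])
  also have "\<dots> = integral\<^sup>L (lborel \<Otimes>\<^sub>M lborel) D'"
    by (simp add: integral_completion lborel_prod)
  also have "\<dots> = (LINT s|lborel. (LINT t|lborel. D' (s, t)))"
    by (rule lborel_pair.integral_fst'[OF D'int, symmetric])
  also have "\<dots> = (LINT s|lebesgue. (LINT t|lborel. D' (s, t)))"
  proof (rule integral_completion[symmetric])
    show "(\<lambda>s. LINT t|lborel. D' (s, t)) \<in> borel_measurable lborel"
      using D'int by (intro lborel.borel_measurable_lebesgue_integral) (auto simp: lborel_prod)
  qed
  also have "\<dots> = (LINT s|lebesgue. (LINT t|lebesgue. D (s, t)))"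
  proof (rule integral_cong_AE)
    show 1: "(\<lambda>s. LINT t|lborel. D' (s, t)) \<in> borel_measurable lebesgue"
      using D'int by (intro measurable_completion lborel.borel_measurable_lebesgue_integral) (auto simp: lborel_prod)
    have "AE s in lborel. AE t in lborel. D (s, t) = D' (s, t)"
      by (rule lborel_pair.AE_pair) (unfold lborel_prod, rule eq)
    then have "AE s in lebesgue. AE t in lborel. D (s, t) = D' (s, t)" by (rule AE_completion)
    then show 2: "AE s in lebesgue. (LINT t|lborel. D' (s, t)) = (LINT t|lebesgue. D (s, t))"
    proof eventually_elim
      case (elim s)
      have "D' \<in> borel_measurable (lborel \<Otimes>\<^sub>M lborel)" using D'int by (rule borel_measurable_integrable)
      then have m: "(\<lambda>t. D' (s, t)) \<in> borel_measurable lborel" by measurable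
      have "AE t in lebesgue. D' (s, t) = D (s, t)"
        by (rule AE_completion) (use elim in \<open>eventually_elim, simp\<close>)
      then have "(LINT t|lebesgue. D' (s, t)) = (LINT t|lebesgue. D (s, t))"
        using measurable_completion[OF m]
        by (intro integral_cong_AE) (auto intro: borel_measurable_lebesgue_AE)
      then show ?case using m by (simp add: integral_completion)
    qed
    show "(\<lambda>s. LINT t|lebesgue. D (s, t)) \<in> borel_measurable lebesgue"
      by (rule borel_measurable_lebesgue_AE[OF 1 2])
  qed
  also have "\<dots> = (LINT s:S|lebesgue. (LINT t:T|lebesgue. C (s, t)))"
    unfolding set_lebesgue_integral_def D_def
    by (intro Bochner_Integration.integral_cong) (auto simp: indicator_def split: if_splits)
  finally show ?thesis .
qed

lemma AE_zero_of_set_integral_zero: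
  fixes \<rho> :: "'a::euclidean_space \<Rightarrow> real"
  assumes "set_integrable lebesgue A \<rho>" "(LINT x:A|lebesgue. \<rho> x) = 0" "\<And>x. 0 \<le> \<rho> x"
  shows "AE x in lebesgue. x \<in> A \<longrightarrow> \<rho> x = 0"
proof -
  have "AE x in lebesgue. indicator A x *\<^sub>R \<rho> x = 0"
    using assms unfolding set_integrable_def set_lebesgue_integral_def
    by (subst integral_nonneg_eq_0_iff_AE[symmetric]) auto
  then show ?thesis by eventually_elim (auto simp: indicator_def)
qed

text \<open>
  Modifying \<open>\<rho>\<close> on a null set could raise it on some fibres; setting it to \<open>0\<close> there keeps it below \<open>\<rho>\<close>
  everywhere.
\<close>

lemma borel_minorant:
  fixes \<rho> :: "'a::euclidean_space \<Rightarrow> real"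
  assumes "\<rho> \<in> borel_measurable lebesgue" "\<And>x. 0 \<le> \<rho> x"
  obtains f where "f \<in> borel_measurable borel" "\<And>x. 0 \<le> f x" "\<And>x. f x \<le> \<rho> x" "AE x in lebesgue. f x = \<rho> x"
proof -
  obtain g where g: "g \<in> borel_measurable lborel" "AE x in lborel. \<rho> x = g x"
    using completion_ex_borel_measurable_real[OF assms(1)] by auto
  from g(2) obtain N where N: "{x \<in> space lborel. \<not> \<rho> x = g x} \<subseteq> N" "N \<in> null_sets lborel"
    by (rule AE_E) (auto simp: null_sets_def)
  define f where "f x = (if x \<in> N then 0 else g x)" for x
  have gN: "g x = \<rho> x" if "x \<notin> N" for x
  proof (rule ccontr)
    assume "g x \<noteq> \<rho> x"
    then have "x \<in> {x \<in> space lborel. \<not> \<rho> x = g x}" by auto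
    with N(1) that show False by blast
  qed
  show thesis
  proof (rule that[of f])
    have "N \<in> sets borel" using N(2) by auto
    then show "f \<in> borel_measurable borel"
      using g(1) unfolding f_def by (intro measurable_If_set) auto
    show "0 \<le> f x" "f x \<le> \<rho> x" for x using assms(2)[of x] gN[of x] by (auto simp: f_def)
    have "AE x in lebesgue. x \<notin> N" by (rule AE_completion[OF AE_not_in[OF N(2)]])
    then show "AE x in lebesgue. f x = \<rho> x" by eventually_elim (simp add: f_def gN)
  qed
qed

text \<open>
  The factor lost in the coarea inequality: \<open>2n\<close> comes from comparing a minor to the coarea factor, the
  rest from covering by cubes instead of balls.
\<close>

definition coarea_constant :: "nat \<Rightarrow> real" where
  "coarea_constant n = 2 * n * 4 ^ (n - 2) / unit_ball_vol (real (n - 2))"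

text \<open>
  The open set \<open>W\<close> stands in for the zero locus \<open>X\<close> of \<open>H\<close>, whose measurability is not known in advance:
  it is contained in \<open>X\<close>, and what it leaves out is a \<open>\<rho>\<close>-null subset of \<open>\<Xi>\<close> and a Lebesgue null set.
\<close>

lemma zero_and_critical_time_probability_le:
  fixes G :: "real \<Rightarrow> real ^ 'n \<Rightarrow> real" and \<rho> :: "real ^ 'n \<Rightarrow> real"
    and C :: "real \<times> real \<Rightarrow> real"
  assumes le: "l \<le> a" "a < e" "e < u"
    and density: "integrable lebesgue \<rho>" "\<And>x. 0 \<le> \<rho> x"
    and diff: "\<And>t x. t \<in> {a..e} \<Longrightarrow> dt_exists l u G t x"
    and reg: "regular_on l u G {a..e} (zero_locus (Hmap l u G) ({a..e} \<times> {a..e}))"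
    and C: "set_integrable lebesgue ({a..e} \<times> {a..e}) C" "\<And>p. p \<in> {a..e} \<times> {a..e} \<Longrightarrow> 0 \<le> C p"
    and KC: "AE p in lebesgue. p \<in> {a..e} \<times> {a..e} \<longrightarrow> K l u G \<rho> p \<le> ennreal (C p)"
    and Xi: "set_integrable lebesgue (Xi (Hmap l u G) (Q1 l u G) ({a..e} \<times> {a..e})) \<rho>"
      "(LINT x:Xi (Hmap l u G) (Q1 l u G) ({a..e} \<times> {a..e})|lebesgue. \<rho> x) = 0"
  obtains W where "open W" "W \<subseteq> zero_locus (Hmap l u G) ({a..e} \<times> {a..e})"
    "AE x in lebesgue. x \<in> zero_locus (Hmap l u G) ({a..e} \<times> {a..e}) \<longrightarrow> x \<in> W \<or> \<rho> x = 0"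
    "(LINT x:W|lebesgue. \<rho> x)
      \<le> coarea_constant CARD('n) * (LINT t1:{a..e}|lebesgue. (LINT t2:{a..e}|lebesgue. C (t1, t2)))"
proof -
  let ?S = "{a..e} \<times> {a..e}"
  let ?X = "zero_locus (Hmap l u G) ?S"
  obtain f where f: "f \<in> borel_measurable borel" "\<And>x. 0 \<le> f x" "\<And>x. f x \<le> \<rho> x"
    and f\<rho>: "AE x in lebesgue. f x = \<rho> x"
    using borel_minorant[OF borel_measurable_integrable[OF density(1)] density(2)] by blast
  obtain W where W: "open W" "nondegenerate_zeros l u G a e \<subseteq> W" "W \<subseteq> ?X"
    and est: "ennreal (unit_ball_vol (CARD('n) - 2) / 4 ^ (CARD('n) - 2)) * (\<integral>\<^sup>+x\<in>W. ennreal (f x) \<partial>lborel)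
      \<le> ennreal (2 * CARD('n)) * (\<integral>\<^sup>+p\<in>?S. ennreal (C p) \<partial>lebesgue)"
    by (rule nn_integral_nondegenerate_zeros_le[OF le(1,3) diff reg f C(1) KC])
  have "AE x in lebesgue. x \<notin> ?X - Xi (Hmap l u G) (Q1 l u G) ?S - nondegenerate_zeros l u G a e"
    using degenerate_zeros_negligible[OF le(2) reg] by (intro AE_not_in) (simp add: negligible_iff_null_sets)
  with AE_zero_of_set_integral_zero[OF Xi density(2)]
  have ae: "AE x in lebesgue. x \<in> ?X \<longrightarrow> x \<in> W \<or> \<rho> x = 0"
    by eventually_elim (use W(2) in blast)
  have "ennreal (LINT x:W|lebesgue. \<rho> x) = (\<integral>\<^sup>+x. ennreal (indicator W x *\<^sub>R \<rho> x) \<partial>lebesgue)"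
    unfolding set_lebesgue_integral_def
    using W(1) density
    by (intro nn_integral_eq_integral[symmetric] integrable_mult_indicator) auto
  also have "\<dots> = (\<integral>\<^sup>+x\<in>W. ennreal (f x) \<partial>lebesgue)"
  proof (rule nn_integral_cong_AE)
    show "AE x in lebesgue. ennreal (indicator W x *\<^sub>R \<rho> x) = ennreal (f x) * indicator W x"
      using f\<rho> by eventually_elim (auto split: split_indicator)
  qed
  also have "\<dots> = (\<integral>\<^sup>+x\<in>W. ennreal (f x) \<partial>lborel)"
    by (rule nn_integral_completion)
  finally have lhs: "(\<integral>\<^sup>+x\<in>W. ennreal (f x) \<partial>lborel) = ennreal (LINT x:W|lebesgue. \<rho> x)" by simp
  have "(\<integral>\<^sup>+p\<in>?S. ennreal (C p) \<partial>lebesgue) = (\<integral>\<^sup>+p. ennreal (indicator ?S p *\<^sub>R C p) \<partial>lebesgue)"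
    by (intro nn_integral_cong) (auto split: split_indicator)
  also have "\<dots> = ennreal (LINT p:?S|lebesgue. C p)"
    unfolding set_lebesgue_integral_def using C
    by (intro nn_integral_eq_integral) (auto simp: set_integrable_def split: split_indicator)
  also have "(LINT p:?S|lebesgue. C p) = (LINT t1:{a..e}|lebesgue. (LINT t2:{a..e}|lebesgue. C (t1, t2)))"
    by (rule set_integral_lebesgue_Times[OF C(1)])
  finally have rhs: "(\<integral>\<^sup>+p\<in>?S. ennreal (C p) \<partial>lebesgue)
      = ennreal (LINT t1:{a..e}|lebesgue. (LINT t2:{a..e}|lebesgue. C (t1, t2)))" (is "_ = ennreal ?I") .
  have "0 \<le> (LINT p:?S|lebesgue. C p)"
    unfolding set_lebesgue_integral_def using C(2)
    by (intro Bochner_Integration.integral_nonneg) (auto split: split_indicator)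
  then have I: "0 \<le> ?I" using set_integral_lebesgue_Times[OF C(1)] by simp
  have W0: "0 \<le> (LINT x:W|lebesgue. \<rho> x)"
    unfolding set_lebesgue_integral_def using density(2) by (intro Bochner_Integration.integral_nonneg) auto
  let ?v = "unit_ball_vol (real (CARD('n) - 2))"
  have v: "?v > 0" by (rule unit_ball_vol_pos) simp
  have "ennreal (?v / 4 ^ (CARD('n) - 2) * (LINT x:W|lebesgue. \<rho> x)) \<le> ennreal (2 * CARD('n) * ?I)"
  proof -
    have "ennreal (?v / 4 ^ (CARD('n) - 2) * (LINT x:W|lebesgue. \<rho> x))
        = ennreal (?v / 4 ^ (CARD('n) - 2)) * ennreal (LINT x:W|lebesgue. \<rho> x)"
      using v W0 by (intro ennreal_mult) auto
    moreover have "ennreal (2 * CARD('n) * ?I) = ennreal (2 * CARD('n)) * ennreal ?I"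
      using I by (intro ennreal_mult) auto
    ultimately show ?thesis using est unfolding lhs rhs by simp
  qed
  then have "?v / 4 ^ (CARD('n) - 2) * (LINT x:W|lebesgue. \<rho> x) \<le> 2 * CARD('n) * ?I"
    using I by (subst (asm) ennreal_le_iff) auto
  then have "(LINT x:W|lebesgue. \<rho> x) \<le> coarea_constant CARD('n) * ?I"
    using v by (simp add: coarea_constant_def field_simps)
  with W ae show thesis by (intro that[of W])
qed

section \<open>Counting zeros on adjacent intervals\<close>

lemma continuous_on_time:
  assumes "l \<le> a" "b \<le> u" "\<And>t. t \<in> {a..b} \<Longrightarrow> dt_exists l u G t x"
  shows "continuous_on {a..b} (\<lambda>s. G s x)"
  unfolding continuous_on_eq_continuous_within
proof
  fix t assume t: "t \<in> {a..b}"
  have "continuous (at t within {l..u}) (\<lambda>s. G s x)"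
    using assms(3)[OF t] by (simp add: dt_exists_def differentiable_imp_continuous_within)
  then show "continuous (at t within {a..b}) (\<lambda>s. G s x)"
    by (rule continuous_within_subset) (use assms(1,2) in auto)
qed

lemma dt_at_interior:
  assumes "l \<le> a" "b \<le> u" "a < t" "t < b" "dt_exists l u G t x"
  shows "((\<lambda>s. G s x) has_real_derivative dt l u G t x) (at t)"
proof -
  have "at t within {l..u} = at t" using assms by (intro at_within_Icc_at) auto
  with dt_exists_imp_deriv[OF assms(5)] show ?thesis by simp
qed

lemma two_zeros_imp_critical_time:
  assumes ab: "l \<le> a" "b \<le> u" and t: "t1 \<in> {a..b}" "t2 \<in> {a..b}" "t1 < t2" "G t1 x = 0" "G t2 x = 0"
    and diff: "\<And>t. t \<in> {a..b} \<Longrightarrow> dt_exists l u G t x"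
  shows "x \<in> zero_locus (Hmap l u G) ({a..b} \<times> {a..b})"
proof -
  have der: "((\<lambda>s. G s x) has_real_derivative dt l u G z x) (at z)" if "t1 < z" "z < t2" for z
    using t ab that by (intro dt_at_interior[of l t1 t2] diff) auto
  have "continuous_on {t1..t2} (\<lambda>s. G s x)"
    using t by (intro continuous_on_subset[OF continuous_on_time[OF ab diff]]) auto
  then obtain z where z: "t1 < z" "z < t2" "DERIV (\<lambda>s. G s x) z :> 0"
    using Rolle[of t1 t2 "\<lambda>s. G s x"] t(3-5) der by (auto simp: real_differentiable_def)
  then have "dt l u G z x = 0" using der[of z] DERIV_unique by blast
  with z(1,2) t show ?thesis unfolding mem_zero_locus_Hmap by (intro bexI[of _ t1] bexI[of _ z]) auto
qed

text \<open>
  Intermediate value theorem; the zero cannot be \<open>a\<close> itself.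
\<close>

lemma Theta_imp_zero:
  assumes ab: "l \<le> a" "a < b" "b \<le> u" and diff: "\<And>t. t \<in> {a..b} \<Longrightarrow> dt_exists l u G t x"
    and x: "x \<in> Theta G a (b - a)" "G a x \<noteq> 0"
  shows "\<exists>t\<in>{a<..b}. G t x = 0"
proof -
  have cont: "continuous_on {a..b} (\<lambda>s. G s x)" by (rule continuous_on_time[OF ab(1,3) diff])
  have "\<exists>t. a \<le> t \<and> t \<le> b \<and> G t x = 0"
    using x IVT'[of "\<lambda>s. G s x" a 0 b, OF _ _ _ cont] IVT2'[of "\<lambda>s. G s x" b 0 a, OF _ _ _ cont] ab
    by (auto simp: Theta_def mult_le_0_iff)
  then obtain t where "a \<le> t" "t \<le> b" "G t x = 0" by blast
  with x(2) show ?thesis by (intro bexI[of _ t]) (auto simp: less_le)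
qed

text \<open>
  If \<open>G(a, x)\<close> and \<open>G(b, x)\<close> had the same strict sign, then the extremum of \<open>G(\<sqdot>, x)\<close> towards the other
  sign would be attained in the interior, because of the zero at \<open>t\<close>, and would be a critical time.
\<close>

lemma zero_imp_Theta:
  assumes ab: "l \<le> a" "b \<le> u" and diff: "\<And>t. t \<in> {a..b} \<Longrightarrow> dt_exists l u G t x"
    and t: "t \<in> {a..b}" "G t x = 0"
    and x: "x \<notin> zero_locus (Hmap l u G) ({a..b} \<times> {a..b})"
  shows "x \<in> Theta G a (b - a)"
proof (rule ccontr)
  assume nT: "x \<notin> Theta G a (b - a)"
  \<comment> \<open>the sign \<open>\<sigma>\<close> treats minima and maxima at once\<close>
  have pos: "\<exists>z. a < z \<and> z < b \<and> dt l u G z x = 0"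
    if \<sigma>: "\<sigma> = 1 \<or> \<sigma> = - 1" "\<sigma> * G a x > 0" "\<sigma> * G b x > 0" for \<sigma> :: real
  proof -
    have "continuous_on {a..b} (\<lambda>s. \<sigma> * G s x)"
      by (intro continuous_intros continuous_on_time[OF ab diff])
    then obtain m where m: "m \<in> {a..b}" "\<And>s. s \<in> {a..b} \<Longrightarrow> \<sigma> * G m x \<le> \<sigma> * G s x"
      using continuous_attains_inf[of "{a..b}" "\<lambda>s. \<sigma> * G s x"] t by auto
    have "\<sigma> * G m x \<le> 0" using m(2)[OF t(1)] t(2) by simp
    with \<sigma> m(1) have mm: "a < m" "m < b" by (auto simp: less_le)
    have "((\<lambda>s. \<sigma> * G s x) has_real_derivative \<sigma> * dt l u G m x) (at m)"
      by (intro DERIV_cmult dt_at_interior[OF ab mm] diff m(1))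
    then have "\<sigma> * dt l u G m x = 0"
    proof (rule DERIV_local_min)
      show "0 < min (m - a) (b - m)" using mm by simp
      show "\<forall>y. \<bar>m - y\<bar> < min (m - a) (b - m) \<longrightarrow> \<sigma> * G m x \<le> \<sigma> * G y x"
        by (intro allI impI m(2)) (auto simp: abs_if split: if_splits)
    qed
    with \<sigma> mm show ?thesis by auto
  qed
  have "0 < G a x * G b x" using nT by (simp add: Theta_def not_le)
  then have "\<exists>z. a < z \<and> z < b \<and> dt l u G z x = 0"
    using pos[of 1] pos[of "- 1"] by (auto simp: zero_less_mult_iff)
  then obtain z where "a < z" "z < b" "dt l u G z x = 0" by blast
  with t x show False unfolding mem_zero_locus_Hmap by (metis atLeastAtMost_iff less_imp_le)
qed

lemma zero_count_Un:
  "S \<inter> T = {} \<Longrightarrow> zero_count G (S \<union> T) x = zero_count G S x + zero_count G T x"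
  unfolding zero_count_def
  by (subst plus_emeasure) (auto intro!: arg_cong2[where f=emeasure])

lemma zero_count_mono: "S \<subseteq> T \<Longrightarrow> zero_count G S x \<le> zero_count G T x"
  unfolding zero_count_def by (intro emeasure_mono) auto

lemma zero_count_nat_or_top: "(\<exists>n. zero_count G S x = of_nat n) \<or> zero_count G S x = \<infinity>"
  by (cases "finite {t \<in> S. G t x = 0}") (auto simp: zero_count_def emeasure_count_space)

lemma zero_count_ge_1: "t \<in> S \<Longrightarrow> G t x = 0 \<Longrightarrow> 1 \<le> zero_count G S x"
proof -
  assume "t \<in> S" "G t x = 0"
  then have "emeasure (count_space UNIV) {t} \<le> zero_count G S x"
    unfolding zero_count_def by (intro emeasure_mono) auto
  then show ?thesis by simp
qed

lemma zero_count_le_1: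
  assumes "\<And>s t. s \<in> S \<Longrightarrow> t \<in> S \<Longrightarrow> G s x = 0 \<Longrightarrow> G t x = 0 \<Longrightarrow> s = t"
  shows "zero_count G S x \<le> 1"
proof (cases "{t \<in> S. G t x = 0} = {}")
  case False
  then obtain t where t: "t \<in> S" "G t x = 0" by blast
  then have "{t \<in> S. G t x = 0} = {t}" using assms by blast
  then show ?thesis by (simp add: zero_count_def)
qed (simp only: zero_count_def emeasure_empty zero_le_one)

text \<open>
  Sign changes between \<open>a\<close> and \<open>b\<close> always produce a new zero; outside the zero locus of \<open>H\<close> they are the
  only source of new zeros and produce one each.
\<close>

lemma zero_count_increment:
  assumes ab: "l \<le> a" "a < b" "b \<le> u" and diff: "\<And>t. t \<in> {a..b} \<Longrightarrow> dt_exists l u G t x"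
    and a: "G a x \<noteq> 0"
  shows "x \<in> Theta G a (b - a) \<Longrightarrow> zero_count G {l..a} x + 1 \<le> zero_count G {l..b} x"
    and "x \<notin> zero_locus (Hmap l u G) ({a..b} \<times> {a..b}) \<Longrightarrow>
      zero_count G {l..b} x = zero_count G {l..a} x + (if x \<in> Theta G a (b - a) then 1 else 0)"
proof -
  have "{l..b} = {l..a} \<union> {a<..b}" using ab by auto
  moreover have "zero_count G ({l..a} \<union> {a<..b}) x = zero_count G {l..a} x + zero_count G {a<..b} x"
    by (rule zero_count_Un) auto
  ultimately have split: "zero_count G {l..b} x = zero_count G {l..a} x + zero_count G {a<..b} x"
    by simp
  have ge: "1 \<le> zero_count G {a<..b} x" if "x \<in> Theta G a (b - a)"
    using Theta_imp_zero[OF ab diff that a] zero_count_ge_1 by metis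
  then show "x \<in> Theta G a (b - a) \<Longrightarrow> zero_count G {l..a} x + 1 \<le> zero_count G {l..b} x"
    unfolding split by (intro add_left_mono)
  assume x: "x \<notin> zero_locus (Hmap l u G) ({a..b} \<times> {a..b})"
  have "zero_count G {a<..b} x = (if x \<in> Theta G a (b - a) then 1 else 0)"
  proof (cases "x \<in> Theta G a (b - a)")
    case True
    have uniq: "s = t" if "s \<in> {a<..b}" "t \<in> {a<..b}" "G s x = 0" "G t x = 0" for s t
      using two_zeros_imp_critical_time[OF ab(1,3), of s t G x] two_zeros_imp_critical_time[OF ab(1,3), of t s G x] that diff x
      by (cases s t rule: linorder_cases) auto
    have "zero_count G {a<..b} x \<le> 1" by (rule zero_count_le_1) (rule uniq)
    with ge[OF True] True show ?thesis by simp
  next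
    case False
    have "{t \<in> {a<..b}. G t x = 0} = {}"
      using zero_imp_Theta[OF ab(1,3) diff _ _ x] False by fastforce
    then have "zero_count G {a<..b} x = 0"
      unfolding zero_count_def by (simp only: emeasure_empty)
    with False show ?thesis by simp
  qed
  then show "zero_count G {l..b} x = zero_count G {l..a} x + (if x \<in> Theta G a (b - a) then 1 else 0)"
    by (simp add: split)
qed

text \<open>
  Raising a count by one raises exactly one of the indicators of its levels. An infinite count is not
  changed by adding one, and then no indicator changes.
\<close>

lemma sum_level_increments_le:
  fixes N N' :: ennreal
  assumes "N' = N + (if c then 1 else 0)" and "(\<exists>n::nat. N = of_nat n) \<or> N = \<infinity>"
  shows "(\<Sum>i<k. (if of_nat (Suc i) \<le> N' then 1 else 0) - (if of_nat (Suc i) \<le> N then 1 else 0 :: real))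
    \<le> (if c then 1 else 0)"
proof (cases "c \<and> N \<noteq> \<infinity>")
  case True
  with assms obtain n :: nat where n: "N = of_nat n" "N' = of_nat (Suc n)" by (auto simp: add.commute)
  have "(\<Sum>i<k. (if of_nat (Suc i) \<le> N' then 1 else 0) - (if of_nat (Suc i) \<le> N then 1 else 0 :: real))
    = (\<Sum>i<k. if i = n then 1 else 0)"
    unfolding n by (intro sum.cong refl) (auto simp del: of_nat_Suc simp: of_nat_le_iff)
  also have "\<dots> \<le> 1" by simp
  finally show ?thesis using True by simp
next
  case False
  then have "N' = N" using assms(1) by auto
  then show ?thesis by simp
qed

section \<open>The derivative of the expected number of zeros\<close>

text \<open>
  Off \<open>W\<close>, almost every \<open>x\<close> with \<open>\<rho> x > 0\<close> gains a zero in \<open>(a, b]\<close> exactly if it is in \<open>\<Theta>\<close>, and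
  it gains at most one. On \<open>W\<close> at most \<open>k\<close> of the first \<open>k\<close> levels change.

  The same dichotomy makes \<open>\<Theta>\<close> measurable, although \<open>G(t, \<sqdot>)\<close> is not assumed to be: on \<open>W\<close> the
  functions \<open>G(a, \<sqdot>)\<close> and \<open>G(b, \<sqdot>)\<close> are continuous, and off \<open>W\<close> the set \<open>\<Theta>\<close> is where the
  measurable count of zeros grows.
\<close>

lemma increment_bounds:
  fixes G :: "real \<Rightarrow> real ^ 'n \<Rightarrow> real" and \<rho> :: "real ^ 'n \<Rightarrow> real"
    and C :: "real \<times> real \<Rightarrow> real"
  assumes ab: "l \<le> a" "a < b" "b < u"
    and density: "integrable lebesgue \<rho>" "\<And>x. 0 \<le> \<rho> x"
    and count: "\<And>t. t \<in> {l..u} \<Longrightarrow> (\<lambda>x. zero_count G {l..t} x * ennreal (\<rho> x)) \<in> borel_measurable lebesgue"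
    and fin: "expected_zeros G \<rho> {l..u} < \<infinity>"
    and diff: "\<And>t x. t \<in> {a..b} \<Longrightarrow> dt_exists l u G t x"
    and start: "AE x in lebesgue. x \<in> zero_locus G {a} \<longrightarrow> \<rho> x = 0"
    and reg: "regular_on l u G {a..b} (zero_locus (Hmap l u G) ({a..b} \<times> {a..b}))"
    and C: "set_integrable lebesgue ({a..b} \<times> {a..b}) C" "\<And>p. p \<in> {a..b} \<times> {a..b} \<Longrightarrow> 0 \<le> C p"
    and KC: "AE p in lebesgue. p \<in> {a..b} \<times> {a..b} \<longrightarrow> K l u G \<rho> p \<le> ennreal (C p)"
    and Xi: "set_integrable lebesgue (Xi (Hmap l u G) (Q1 l u G) ({a..b} \<times> {a..b})) \<rho>"
      "(LINT x:Xi (Hmap l u G) (Q1 l u G) ({a..b} \<times> {a..b})|lebesgue. \<rho> x) = 0"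
  shows "set_integrable lebesgue (Theta G a (b - a)) \<rho>"
    and "(LINT x:Theta G a (b - a)|lebesgue. \<rho> x) \<le> cum_expectation l G \<rho> b - cum_expectation l G \<rho> a"
    and "(\<Sum>i<k. (LINT x:Lambda (Suc i) G {l..b}|lebesgue. \<rho> x) - (LINT x:Lambda (Suc i) G {l..a}|lebesgue. \<rho> x))
      \<le> (LINT x:Theta G a (b - a)|lebesgue. \<rho> x)
        + k * (coarea_constant CARD('n) * (LINT t1:{a..b}|lebesgue. (LINT t2:{a..b}|lebesgue. C (t1, t2))))"
proof -
  let ?X = "zero_locus (Hmap l u G) ({a..b} \<times> {a..b})" and ?\<Theta> = "Theta G a (b - a)"
  let ?N = "\<lambda>s x. zero_count G {l..s} x"
  let ?I = "LINT t1:{a..b}|lebesgue. (LINT t2:{a..b}|lebesgue. C (t1, t2))"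
  have \<rho> [measurable]: "\<rho> \<in> borel_measurable lebesgue" by (rule borel_measurable_integrable[OF density(1)])
  have lab: "a \<in> {l..u}" "b \<in> {l..u}" using ab by auto
  note Nmeas [measurable] = count[OF lab(1)] count[OF lab(2)]
  obtain W where W: "open W" "W \<subseteq> ?X" and XW: "AE x in lebesgue. x \<in> ?X \<longrightarrow> x \<in> W \<or> \<rho> x = 0"
    and W_le: "(LINT x:W|lebesgue. \<rho> x) \<le> coarea_constant CARD('n) * ?I"
    by (rule zero_and_critical_time_probability_le[OF ab density diff reg C KC Xi])
  have Wint: "integrable lebesgue (\<lambda>x. indicator W x *\<^sub>R \<rho> x)"
    using W(1) density(1) by (intro integrable_mult_indicator) auto

  have E_fin: "expected_zeros G \<rho> {l..s} < \<infinity>" if "s \<in> {l..u}" for s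
  proof -
    have "expected_zeros G \<rho> {l..s} \<le> expected_zeros G \<rho> {l..u}"
      unfolding expected_zeros_def using that
      by (intro nn_integral_mono mult_right_mono zero_count_mono) auto
    with fin show ?thesis by simp
  qed
  have N_fin: "AE x in lebesgue. ?N b x \<noteq> \<infinity> \<or> \<rho> x = 0"
  proof -
    have "AE x in lebesgue. ?N b x * ennreal (\<rho> x) \<noteq> \<infinity>"
      using E_fin[OF lab(2)] unfolding expected_zeros_def
      by (intro nn_integral_PInf_AE) auto
    then show ?thesis
      by eventually_elim (use density(2) in \<open>auto simp: ennreal_top_mult less_le split: if_splits\<close>)
  qed
  have start': "AE x in lebesgue. G a x \<noteq> 0 \<or> \<rho> x = 0"
    using start by eventually_elim (auto simp: zero_locus_def)

  have \<Theta>W: "?\<Theta> \<inter> W \<in> sets borel"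
  proof -
    have "isCont (G a) x \<and> isCont (G b) x" if "x \<in> W" for x
      using regular_onD(3)[OF reg, of a x] regular_onD(3)[OF reg, of b x] that W(2) ab
      by (auto intro: GDERIV_isCont)
    then have "continuous_on W (\<lambda>x. G a x * G b x)"
      by (intro continuous_at_imp_continuous_on ballI) auto
    then have "open (W \<inter> (\<lambda>x. G a x * G b x) -` {0<..})"
      using W(1) by (intro continuous_open_preimage) auto
    moreover have "?\<Theta> \<inter> W = W - (W \<inter> (\<lambda>x. G a x * G b x) -` {0<..})"
      by (auto simp: Theta_def not_less)
    ultimately show ?thesis using W(1) by auto
  qed
  \<comment> \<open>where \<open>\<rho> > 0\<close> and the count is finite, this says that the count grows\<close>
  define M where "M = {x. ?N a x * ennreal (\<rho> x) < ?N b x * ennreal (\<rho> x)}"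
  have M [measurable]: "M \<in> sets lebesgue"
  proof -
    have "{x \<in> space lebesgue. ?N a x * ennreal (\<rho> x) < ?N b x * ennreal (\<rho> x)} \<in> sets lebesgue"
      by measurable
    then show ?thesis by (simp add: M_def)
  qed
  have W_leb [measurable]: "W \<in> sets lebesgue" using W(1) by auto
  have \<Theta>W_leb [measurable]: "?\<Theta> \<inter> W \<in> sets lebesgue" using \<Theta>W by auto
  have \<Theta>_AE: "AE x in lebesgue. indicator (?\<Theta> \<inter> W \<union> (M - W)) x * \<rho> x = indicator ?\<Theta> x * \<rho> x"
    using XW N_fin start'
  proof eventually_elim
    case (elim x)
    show ?case
    proof (cases "\<rho> x = 0 \<or> x \<in> W")
      case False
      then have x: "x \<notin> ?X" "x \<notin> W" "\<rho> x > 0" "G a x \<noteq> 0" "?N b x \<noteq> \<infinity>"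
        using elim density(2)[of x] by (auto simp: less_le)
      have N: "?N b x = ?N a x + (if x \<in> ?\<Theta> then 1 else 0)"
        using zero_count_increment(2)[OF ab(1,2) less_imp_le[OF ab(3)] diff x(4,1)] .
      then have Na: "?N a x \<noteq> \<infinity>" using x(5) by auto
      have "x \<in> M \<longleftrightarrow> x \<in> ?\<Theta>"
      proof (cases "x \<in> ?\<Theta>")
        case True
        obtain n :: nat where n: "?N a x = of_nat n"
          using zero_count_nat_or_top[of G "{l..a}" x] Na by blast
        then have "?N b x = of_nat (Suc n)" using True N by simp
        then have "?N a x < ?N b x" unfolding n by (simp only: of_nat_less_iff lessI)
        then have "?N a x * ennreal (\<rho> x) < ?N b x * ennreal (\<rho> x)"
          using x(3) by (intro ennreal_mult_strict_right_mono) auto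
        then show ?thesis using True by (simp add: M_def)
      qed (simp add: M_def N)
      then show ?thesis using x by (auto simp: indicator_def)
    qed (auto simp: indicator_def)
  qed
  have \<Theta>_int: "integrable lebesgue (\<lambda>x. indicator ?\<Theta> x * \<rho> x)"
  proof (rule integrable_cong_AE_imp[OF _ _ \<Theta>_AE])
    have 1: "integrable lebesgue (\<lambda>x. indicator (?\<Theta> \<inter> W \<union> (M - W)) x *\<^sub>R \<rho> x)"
      using density(1) by (intro integrable_mult_indicator) measurable
    then show "integrable lebesgue (\<lambda>x. indicator (?\<Theta> \<inter> W \<union> (M - W)) x * \<rho> x)" by simp
    from 1 have "(\<lambda>x. indicator (?\<Theta> \<inter> W \<union> (M - W)) x * \<rho> x) \<in> borel_measurable lebesgue"
      by (auto dest: borel_measurable_integrable)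
    from borel_measurable_lebesgue_AE[OF this \<Theta>_AE]
    show "(\<lambda>x. indicator ?\<Theta> x * \<rho> x) \<in> borel_measurable lebesgue" .
  qed
  then show "set_integrable lebesgue ?\<Theta> \<rho>" by (simp add: set_integrable_def)
  have P0: "0 \<le> (LINT x:?\<Theta>|lebesgue. \<rho> x)"
    unfolding set_lebesgue_integral_def using density(2) by (intro Bochner_Integration.integral_nonneg) auto

  have cum: "ennreal (cum_expectation l G \<rho> s) = expected_zeros G \<rho> {l..s}" if "s \<in> {l..u}" for s
    using E_fin[OF that] by (simp add: cum_expectation_def)
  have "ennreal ((LINT x:?\<Theta>|lebesgue. \<rho> x) + cum_expectation l G \<rho> a)
      = (\<integral>\<^sup>+x. ennreal (indicator ?\<Theta> x * \<rho> x) \<partial>lebesgue) + expected_zeros G \<rho> {l..a}"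
    using P0 \<Theta>_int density(2) cum[OF lab(1)]
    by (subst ennreal_plus) (auto simp: set_lebesgue_integral_def nn_integral_eq_integral cum_expectation_def)
  also have "\<dots> = (\<integral>\<^sup>+x. ennreal (indicator ?\<Theta> x * \<rho> x) + ?N a x * ennreal (\<rho> x) \<partial>lebesgue)"
    unfolding expected_zeros_def using \<Theta>_int
    by (intro nn_integral_add[symmetric]) (auto dest: borel_measurable_integrable)
  also have "\<dots> \<le> (\<integral>\<^sup>+x. ?N b x * ennreal (\<rho> x) \<partial>lebesgue)"
  proof (rule nn_integral_mono_AE)
    show "AE x in lebesgue. ennreal (indicator ?\<Theta> x * \<rho> x) + ?N a x * ennreal (\<rho> x) \<le> ?N b x * ennreal (\<rho> x)"
      using start'
    proof eventually_elim
      case (elim x)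
      show ?case
      proof (cases "x \<in> ?\<Theta> \<and> \<rho> x \<noteq> 0")
        case True
        then have "?N a x + 1 \<le> ?N b x"
          using zero_count_increment(1)[OF ab(1,2) less_imp_le[OF ab(3)] diff] elim by auto
        then have "(?N a x + 1) * ennreal (\<rho> x) \<le> ?N b x * ennreal (\<rho> x)" by (rule mult_right_mono) simp
        with True show ?thesis by (simp add: distrib_right add.commute)
      next
        case False
        then have "indicator ?\<Theta> x * \<rho> x = 0" by (auto simp: indicator_def)
        then show ?thesis using ab by (auto intro!: mult_right_mono zero_count_mono)
      qed
    qed
  qed
  also have "\<dots> = ennreal (cum_expectation l G \<rho> b)"
    using cum[OF lab(2)] by (simp add: expected_zeros_def)
  finally have "(LINT x:?\<Theta>|lebesgue. \<rho> x) + cum_expectation l G \<rho> a \<le> cum_expectation l G \<rho> b"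
    by (subst (asm) ennreal_le_iff) (simp_all add: cum_expectation_def)
  then show "(LINT x:?\<Theta>|lebesgue. \<rho> x) \<le> cum_expectation l G \<rho> b - cum_expectation l G \<rho> a" by simp

  have \<Lambda>_int: "integrable lebesgue (\<lambda>x. indicator (Lambda i G {l..s}) x * \<rho> x)" if s: "s \<in> {l..u}" for i s
  proof -
    note [measurable] = count[OF s]
    have "{x \<in> space lebesgue. of_nat i * ennreal (\<rho> x) \<le> ?N s x * ennreal (\<rho> x)} \<in> sets lebesgue"
      by measurable
    then have "integrable lebesgue (\<lambda>x. indicator {x. of_nat i * ennreal (\<rho> x) \<le> ?N s x * ennreal (\<rho> x)} x *\<^sub>R \<rho> x)"
      using density(1) by (intro integrable_mult_indicator) auto
    also have "(\<lambda>x. indicator {x. of_nat i * ennreal (\<rho> x) \<le> ?N s x * ennreal (\<rho> x)} x *\<^sub>R \<rho> x)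
        = (\<lambda>x. indicator (Lambda i G {l..s}) x * \<rho> x)"
    proof
      fix x
      show "indicator {x. of_nat i * ennreal (\<rho> x) \<le> ?N s x * ennreal (\<rho> x)} x *\<^sub>R \<rho> x
        = indicator (Lambda i G {l..s}) x * \<rho> x"
      proof (cases "\<rho> x = 0")
        case False
        then have "0 < ennreal (\<rho> x)" "ennreal (\<rho> x) < top" using density(2)[of x] by (auto simp: less_le)
        then have "of_nat i * ennreal (\<rho> x) \<le> ?N s x * ennreal (\<rho> x) \<longleftrightarrow> of_nat i \<le> ?N s x"
          using ennreal_mult_le_mult_iff[of "ennreal (\<rho> x)" "of_nat i" "?N s x"] by (simp add: mult.commute)
        then show ?thesis by (auto simp: Lambda_def indicator_def)
      qed simp
    qed
    finally show ?thesis .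
  qed
  have "(\<Sum>i<k. (LINT x:Lambda (Suc i) G {l..b}|lebesgue. \<rho> x) - (LINT x:Lambda (Suc i) G {l..a}|lebesgue. \<rho> x))
    = (LINT x|lebesgue. (\<Sum>i<k. indicator (Lambda (Suc i) G {l..b}) x * \<rho> x - indicator (Lambda (Suc i) G {l..a}) x * \<rho> x))"
    using \<Lambda>_int[OF lab(1)] \<Lambda>_int[OF lab(2)] by (simp add: set_lebesgue_integral_def)
  also have "\<dots> \<le> (LINT x|lebesgue. indicator ?\<Theta> x * \<rho> x + k * (indicator W x * \<rho> x))"
  proof (rule integral_mono_AE)
    show "integrable lebesgue (\<lambda>x. \<Sum>i<k. indicator (Lambda (Suc i) G {l..b}) x * \<rho> x - indicator (Lambda (Suc i) G {l..a}) x * \<rho> x)"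
      using \<Lambda>_int lab by (intro Bochner_Integration.integrable_sum Bochner_Integration.integrable_diff) auto
    show "integrable lebesgue (\<lambda>x. indicator ?\<Theta> x * \<rho> x + k * (indicator W x * \<rho> x))"
      using \<Theta>_int Wint by (intro Bochner_Integration.integrable_add integrable_mult_right) auto
    show "AE x in lebesgue. (\<Sum>i<k. indicator (Lambda (Suc i) G {l..b}) x * \<rho> x - indicator (Lambda (Suc i) G {l..a}) x * \<rho> x)
        \<le> indicator ?\<Theta> x * \<rho> x + k * (indicator W x * \<rho> x)"
      using XW start'
    proof eventually_elim
      case (elim x)
      let ?S = "\<Sum>i<k. indicator (Lambda (Suc i) G {l..b}) x - indicator (Lambda (Suc i) G {l..a}) x :: real"
      have S: "(\<Sum>i<k. indicator (Lambda (Suc i) G {l..b}) x * \<rho> x - indicator (Lambda (Suc i) G {l..a}) x * \<rho> x) = ?S * \<rho> x"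
        by (simp add: sum_distrib_right left_diff_distrib)
      have "\<rho> x = 0 \<or> ?S \<le> indicat_real ?\<Theta> x + k * indicat_real W x"
      proof (cases "\<rho> x = 0 \<or> x \<in> W")
        case True
        have "?S \<le> (\<Sum>i<k. 1)" by (intro sum_mono) (auto simp: indicator_def)
        then have "?S \<le> k" by simp
        moreover have "0 \<le> indicat_real ?\<Theta> x" by simp
        ultimately have "?S \<le> indicat_real ?\<Theta> x + k" by linarith
        with True show ?thesis by auto
      next
        case False
        then have x: "x \<notin> ?X" "G a x \<noteq> 0" using elim by auto
        have "?S = (\<Sum>i<k. (if of_nat (Suc i) \<le> ?N b x then 1 else 0) - (if of_nat (Suc i) \<le> ?N a x then 1 else 0))"
          by (intro sum.cong refl) (auto simp: Lambda_def indicator_def)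
        also have "\<dots> \<le> (if x \<in> ?\<Theta> then 1 else 0)"
          by (rule sum_level_increments_le[OF zero_count_increment(2)[OF ab(1,2) less_imp_le[OF ab(3)] diff x(2,1)]
              zero_count_nat_or_top])
        finally show ?thesis using False by (auto simp: indicator_def)
      qed
      then have "?S * \<rho> x \<le> (indicat_real ?\<Theta> x + k * indicat_real W x) * \<rho> x"
        using density(2)[of x] by (auto intro: mult_right_mono)
      then show ?case unfolding S by (simp add: algebra_simps)
    qed
  qed
  also have "\<dots> = (LINT x:?\<Theta>|lebesgue. \<rho> x) + k * (LINT x:W|lebesgue. \<rho> x)"
    using \<Theta>_int Wint by (simp add: set_lebesgue_integral_def)
  also have "\<dots> \<le> (LINT x:?\<Theta>|lebesgue. \<rho> x) + k * (coarea_constant CARD('n) * ?I)"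
    using W_le by (intro add_left_mono mult_left_mono) auto
  finally show "(\<Sum>i<k. (LINT x:Lambda (Suc i) G {l..b}|lebesgue. \<rho> x) - (LINT x:Lambda (Suc i) G {l..a}|lebesgue. \<rho> x))
      \<le> (LINT x:?\<Theta>|lebesgue. \<rho> x) + k * (coarea_constant CARD('n) * ?I)" .
qed

lemma right_difference_quotient:
  fixes \<phi> :: "real \<Rightarrow> real"
  assumes "(\<phi> has_real_derivative D) (at t within {l..u})" "t \<in> {l..<u}"
  shows "((\<lambda>\<epsilon>. (\<phi> (t + \<epsilon>) - \<phi> t) / \<epsilon>) \<longlongrightarrow> D) (at_right 0)"
proof -
  have "filterlim (\<lambda>\<epsilon>. t + \<epsilon>) (at t within {l..u}) (at_right 0)"
    unfolding filterlim_at
  proof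
    show "\<forall>\<^sub>F \<epsilon> in at_right 0. t + \<epsilon> \<in> {l..u} \<and> t + \<epsilon> \<noteq> t"
      using eventually_at_right_real[of 0 "u - t"] assms(2) by (auto elim!: eventually_mono)
    show "((\<lambda>\<epsilon>. t + \<epsilon>) \<longlongrightarrow> t) (at_right 0)"
      by (auto intro!: tendsto_eq_intros)
  qed
  from filterlim_compose[OF assms(1)[unfolded has_field_derivative_iff] this]
  show ?thesis by simp
qed

theorem theorem2:
  fixes l u ts \<epsilon>bar :: real
    and G :: "real \<Rightarrow> real ^ 'n \<Rightarrow> real"
    and \<rho> :: "real ^ 'n \<Rightarrow> real"
    and C :: "real \<Rightarrow> real \<times> real \<Rightarrow> real"
  assumes dim: "CARD('n) \<ge> 2"
    and density: "prob_density \<rho>"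
    and count_measurable:
      "\<And>t. t \<in> {l..u} \<Longrightarrow>
         (\<lambda>x. zero_count G {l..t} x * ennreal (\<rho> x)) \<in> borel_measurable lebesgue"
    and finite_expectation: "expected_zeros G \<rho> {l..u} < \<infinity>"
    and ts: "ts \<in> {l..<u} - Psi G \<rho> l u"
    and \<epsilon>bar: "\<epsilon>bar \<in> {0<..u - ts}"
    and H_defined: "\<And>t x. t \<in> {ts..<ts + \<epsilon>bar} \<Longrightarrow> dt_exists l u G t x"
    and cond1:
      "\<And>\<epsilon>. \<epsilon> \<in> {0<..<\<epsilon>bar} \<Longrightarrow>
         regular_on l u G {ts..ts + \<epsilon>}
           (zero_locus (Hmap l u G) ({ts..ts + \<epsilon>} \<times> {ts..ts + \<epsilon>}))"
    and cond2:
      "set_integrable lebesgue (zero_locus G {ts}) \<rho>"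
      "(LINT x:zero_locus G {ts}|lebesgue. \<rho> x) = 0"
    and cond3_integrable:
      "\<And>\<epsilon>. \<epsilon> \<in> {0<..<\<epsilon>bar} \<Longrightarrow>
         set_integrable lebesgue ({ts..ts + \<epsilon>} \<times> {ts..ts + \<epsilon>}) (C \<epsilon>)"
    and cond3_nonneg:
      "\<And>\<epsilon> p. \<epsilon> \<in> {0<..<\<epsilon>bar} \<Longrightarrow> p \<in> {ts..ts + \<epsilon>} \<times> {ts..ts + \<epsilon>} \<Longrightarrow> 0 \<le> C \<epsilon> p"
    and cond3_bound:
      "\<And>\<epsilon>. \<epsilon> \<in> {0<..<\<epsilon>bar} \<Longrightarrow>
         AE p in lebesgue. p \<in> {ts..ts + \<epsilon>} \<times> {ts..ts + \<epsilon>} \<longrightarrow> K l u G \<rho> p \<le> ennreal (C \<epsilon> p)"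
    and cond3_small:
      "(\<lambda>\<epsilon>. LINT t1:{ts..ts + \<epsilon>}|lebesgue. (LINT t2:{ts..ts + \<epsilon>}|lebesgue. C \<epsilon> (t1, t2)))
         \<in> o[at_right 0](\<lambda>\<epsilon>. \<epsilon>)"
    and cond4:
      "\<And>\<epsilon>. \<epsilon> \<in> {0<..<\<epsilon>bar} \<Longrightarrow>
         set_integrable lebesgue (Xi (Hmap l u G) (Q1 l u G) ({ts..ts + \<epsilon>} \<times> {ts..ts + \<epsilon>})) \<rho>"
      "\<And>\<epsilon>. \<epsilon> \<in> {0<..<\<epsilon>bar} \<Longrightarrow>
         (LINT x:Xi (Hmap l u G) (Q1 l u G) ({ts..ts + \<epsilon>} \<times> {ts..ts + \<epsilon>})|lebesgue. \<rho> x) = 0"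
  shows "\<exists>\<eta>. (\<forall>\<^sub>F \<epsilon> in at_right 0. set_integrable lebesgue (Theta G ts \<epsilon>) \<rho>) \<and>
    ((\<lambda>\<epsilon>. LINT x:Theta G ts \<epsilon>|lebesgue. \<rho> x) has_real_derivative \<eta>) (at_right 0) \<and>
    (cum_expectation l G \<rho> has_real_derivative \<eta>) (at ts within {l..u})"
proof -
  define P where "P \<epsilon> = (LINT x:Theta G ts \<epsilon>|lebesgue. \<rho> x)" for \<epsilon>
  define A where "A i s = (LINT x:Lambda (Suc i) G {l..s}|lebesgue. \<rho> x)" for i s
  define I where "I \<epsilon> = (LINT t1:{ts..ts + \<epsilon>}|lebesgue. (LINT t2:{ts..ts + \<epsilon>}|lebesgue. C \<epsilon> (t1, t2)))" for \<epsilon>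
  define c where "c = coarea_constant CARD('n)"
  have \<rho>: "integrable lebesgue \<rho>" "\<And>x. 0 \<le> \<rho> x"
    using density by (auto simp: prob_density_def has_bochner_integral_iff)
  have ts': "ts \<in> {l..<u}" "ts \<in> {l..u}" using ts by auto
  obtain D d where D: "(cum_expectation l G \<rho> has_real_derivative D) (at ts within {l..u})"
    and d: "\<And>i. (A i has_real_derivative d i) (at ts within {l..u})" and sums: "d sums D"
    using ts ts'(2) unfolding Psi_def A_def[abs_def] by blast
  have start: "AE x in lebesgue. x \<in> zero_locus G {ts} \<longrightarrow> \<rho> x = 0"
    by (rule AE_zero_of_set_integral_zero[OF cond2 \<rho>(2)])
  have bounds: "set_integrable lebesgue (Theta G ts \<epsilon>) \<rho>"
    "P \<epsilon> \<le> cum_expectation l G \<rho> (ts + \<epsilon>) - cum_expectation l G \<rho> ts"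
    "(\<Sum>i<k. A i (ts + \<epsilon>) - A i ts) \<le> P \<epsilon> + k * (c * I \<epsilon>)" if \<epsilon>: "\<epsilon> \<in> {0<..<\<epsilon>bar}" for \<epsilon> k
  proof -
    have b: "l \<le> ts" "ts < ts + \<epsilon>" "ts + \<epsilon> < u" using \<epsilon> ts' \<epsilon>bar by auto
    have diff: "dt_exists l u G t x" if "t \<in> {ts..ts + \<epsilon>}" for t x
      using that \<epsilon> by (intro H_defined) auto
    note * = increment_bounds[OF b \<rho> count_measurable finite_expectation diff start cond1[OF \<epsilon>]
        cond3_integrable[OF \<epsilon>] cond3_nonneg[OF \<epsilon>] cond3_bound[OF \<epsilon>] cond4(1)[OF \<epsilon>] cond4(2)[OF \<epsilon>]]
    show "set_integrable lebesgue (Theta G ts \<epsilon>) \<rho>"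
      "P \<epsilon> \<le> cum_expectation l G \<rho> (ts + \<epsilon>) - cum_expectation l G \<rho> ts"
      "(\<Sum>i<k. A i (ts + \<epsilon>) - A i ts) \<le> P \<epsilon> + k * (c * I \<epsilon>)"
      using *(1,2) *(3)[of k] by (simp_all add: P_def A_def c_def I_def)
  qed
  have ev: "\<forall>\<^sub>F \<epsilon> in at_right 0. \<epsilon> \<in> {0<..<\<epsilon>bar}"
    using \<epsilon>bar by (intro eventually_at_right_real) auto
  have I0: "((\<lambda>\<epsilon>. I \<epsilon> / \<epsilon>) \<longlongrightarrow> 0) (at_right 0)"
    using smalloD_tendsto[OF cond3_small] by (simp add: I_def[abs_def])
  have lim: "((\<lambda>\<epsilon>. P \<epsilon> / \<epsilon>) \<longlongrightarrow> D) (at_right 0)"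
  proof (rule order_tendstoI)
    fix y assume "D < y"
    with right_difference_quotient[OF D ts'(1)]
    have "\<forall>\<^sub>F \<epsilon> in at_right 0. (cum_expectation l G \<rho> (ts + \<epsilon>) - cum_expectation l G \<rho> ts) / \<epsilon> < y"
      by (rule order_tendstoD(2))
    with ev show "\<forall>\<^sub>F \<epsilon> in at_right 0. P \<epsilon> / \<epsilon> < y"
    proof eventually_elim
      case (elim \<epsilon>)
      have "P \<epsilon> / \<epsilon> \<le> (cum_expectation l G \<rho> (ts + \<epsilon>) - cum_expectation l G \<rho> ts) / \<epsilon>"
        using bounds(2)[OF elim(1)] elim(1) by (intro divide_right_mono) auto
      with elim(2) show ?case by simp
    qed
  next
    fix y assume "y < D"
    with sums have "\<forall>\<^sub>F k in sequentially. y < (\<Sum>i<k. d i)"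
      unfolding sums_def by (rule order_tendstoD(1))
    then obtain k where k: "y < (\<Sum>i<k. d i)" by (auto simp: eventually_sequentially)
    have "((\<lambda>\<epsilon>. (\<Sum>i<k. (A i (ts + \<epsilon>) - A i ts) / \<epsilon>) - k * (c * (I \<epsilon> / \<epsilon>)))
        \<longlongrightarrow> (\<Sum>i<k. d i) - k * (c * 0)) (at_right 0)"
      by (intro tendsto_intros right_difference_quotient[OF d ts'(1)] I0)
    then have "\<forall>\<^sub>F \<epsilon> in at_right 0. y < (\<Sum>i<k. (A i (ts + \<epsilon>) - A i ts) / \<epsilon>) - k * (c * (I \<epsilon> / \<epsilon>))"
      using k by (intro order_tendstoD(1)) auto
    with ev show "\<forall>\<^sub>F \<epsilon> in at_right 0. y < P \<epsilon> / \<epsilon>"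
    proof eventually_elim
      case (elim \<epsilon>)
      have "(\<Sum>i<k. (A i (ts + \<epsilon>) - A i ts) / \<epsilon>) - k * (c * (I \<epsilon> / \<epsilon>))
          = ((\<Sum>i<k. A i (ts + \<epsilon>) - A i ts) - k * (c * I \<epsilon>)) / \<epsilon>"
        by (simp add: sum_divide_distrib diff_divide_distrib)
      also have "\<dots> \<le> P \<epsilon> / \<epsilon>"
        using bounds(3)[OF elim(1), of k] elim(1) by (intro divide_right_mono) auto
      finally show ?case using elim(2) by simp
    qed
  qed
  have "Theta G ts 0 = zero_locus G {ts}"
    by (auto simp: Theta_def zero_locus_def mult_le_0_iff)
  then have P0: "P 0 = 0" using cond2(2) by (simp add: P_def)
  have "(P has_real_derivative D) (at_right 0)"
    unfolding has_field_derivative_iff using lim by (simp add: P0)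
  moreover have "\<forall>\<^sub>F \<epsilon> in at_right 0. set_integrable lebesgue (Theta G ts \<epsilon>) \<rho>"
    using ev by eventually_elim (rule bounds(1))
  ultimately show ?thesis
    using D unfolding P_def[abs_def] by blast
qed

end
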